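(* Let $u\in L^3((0,T);B^s_{3,\infty}(\mathbb{T}^3))$ with $s>1$ be a weak solution of the (inviscid) modified Leray-$\alpha$ model. Then the energy is conserved, which means that $$\|u(\cdot,t_1)\|_{H^1}=\|u(\cdot,t_2)\|_{H^1}$$ for almost all times $t_1,t_2\in(0,T)$.
   Context: Fix $\alpha>0$, $T>0$; $\mathbb{T}^3$ is the flat three-dimensional torus; repeated indices are summed; $\mathcal{D}$ denotes smooth compactly supported functions; $B^s_{3,\infty}$ is the usual Besov space. The $H^1$ norm used is $\|u\|_{H^1}^2=\|u\|_{L^2}^2+\alpha^2\|\nabla u\|_{L^2}^2$. The modified Leray-$\alpha$ model is $\partial_tv+\nabla\cdot(v\otimes u)+\nabla p=0$, $v=u-\alpha^2\Delta u$, $\nabla\cdot u=\nabla\cdot v=0$. A pair $u\in L^\infty((0,T);H^1(\mathbb{T}^3))$ (vector-valued), $p\in L^\infty((0,T);L^1(\mathbb{T}^3))$ (scalar) is a weak solution if for all $\psi\in\mathcal{D}(\mathbb{T}^3\times(0,T);\mathbb{R}^3)$ and $\chi\in\mathcal{D}(\mathbb{T}^3\times(0,T);\mathbb{R})$ $$\int_0^T\!\!\int_{\mathbb{T}^3}\Big[u\cdot\partial_t\psi+\alpha^2\nabla u:\nabla\partial_t\psi+u_iu_j\partial_i\psi_j+\alpha^2\partial_ku_i\partial_ku_j\partial_i\psi_j+\alpha^2\partial_ku_i\,u_j\,\partial_i\partial_k\psi_j+p\,\nabla\cdot\psi\Big]dx\,dt=0,$$ and $\int_0^T\int_{\mathbb{T}^3}u_i\partial_i\chi\,dx\,dt=0$,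 with $\int_{\mathbb{T}^3}p(x,t)\,dx=0$. *)

theory Defs
  imports "HOL-Analysis.Analysis"
begin

section \<open>The flat torus\<close>

text \<open>Functions on the flat torus are functions on \<open>real^3\<close> that have period 1 in each coordinate;
  integration over the torus is integration over the unit cube. (A torus of another side length
  is reduced to this one by rescaling \<open>x\<close>, which only changes the value of \<open>\<alpha>\<close>.)\<close>

definition periodic :: "(real^3 \<Rightarrow> 'b) \<Rightarrow> bool" where
  "periodic f \<longleftrightarrow> (\<forall>x i. f (x + axis i 1) = f x)"

abbreviation torus :: "(real^3) measure" where
  "torus \<equiv> lebesgue_on (cbox 0 1)"

definition Lp_space :: "real \<Rightarrow> (real^3 \<Rightarrow> 'b::euclidean_space) set" where
  "Lp_space p = {f. periodic f \<and> f \<in> borel_measurable torus \<and>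
                    integrable torus (\<lambda>x. norm (f x) powr p)}"

definition Lp_norm :: "real \<Rightarrow> (real^3 \<Rightarrow> 'b::euclidean_space) \<Rightarrow> real" where
  "Lp_norm p f = (LINT x|torus. norm (f x) powr p) powr (1 / p)"

section \<open>Smooth functions and test functions\<close>

definition dir_deriv ::
  "'a::euclidean_space \<Rightarrow> ('a \<Rightarrow> 'b::real_normed_vector) \<Rightarrow> 'a \<Rightarrow> 'b" where
  "dir_deriv b f x = frechet_derivative f (at x) b"

primrec Ck :: "nat \<Rightarrow> ('a::euclidean_space \<Rightarrow> 'b::real_normed_vector) \<Rightarrow> bool" where
  "Ck 0 f \<longleftrightarrow> continuous_on UNIV f"
| "Ck (Suc k) f \<longleftrightarrow> f differentiable_on UNIV \<and> (\<forall>b\<in>Basis. Ck k (dir_deriv b f))"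

definition smooth :: "('a::euclidean_space \<Rightarrow> 'b::real_normed_vector) \<Rightarrow> bool" where
  "smooth f \<longleftrightarrow> (\<forall>k. Ck k f)"

abbreviation dx :: "3 \<Rightarrow> ((real^3) \<times> real \<Rightarrow> 'b::real_normed_vector) \<Rightarrow> (real^3) \<times> real \<Rightarrow> 'b" where
  "dx i \<equiv> dir_deriv (axis i 1, 0)"

abbreviation dt :: "((real^3) \<times> real \<Rightarrow> 'b::real_normed_vector) \<Rightarrow> (real^3) \<times> real \<Rightarrow> 'b" where
  "dt \<equiv> dir_deriv (0, 1)"

text \<open>The torus being compact, only the time variable restricts the support.\<close>

definition test_functions :: "real \<Rightarrow> ((real^3) \<times> real \<Rightarrow> 'b::real_normed_vector) set" where
  "test_functions T = {\<psi>. smooth \<psi> \<and> (\<forall>t. periodic (\<lambda>x. \<psi> (x, t))) \<and>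
     (\<exists>a b. 0 < a \<and> b < T \<and> (\<forall>x t. t \<notin> {a..b} \<longrightarrow> \<psi> (x, t) = 0))}"

section \<open>The Sobolev space \<open>H\<^sup>1\<close>\<close>

definition has_weak_deriv ::
  "3 \<Rightarrow> (real^3 \<Rightarrow> 'b::euclidean_space) \<Rightarrow> (real^3 \<Rightarrow> 'b) \<Rightarrow> bool" where
  "has_weak_deriv k f g \<longleftrightarrow> f \<in> Lp_space 1 \<and> g \<in> Lp_space 1 \<and>
     (\<forall>\<phi> :: real^3 \<Rightarrow> real. smooth \<phi> \<and> periodic \<phi> \<longrightarrow>
        (LINT x|torus. dir_deriv (axis k 1) \<phi> x *\<^sub>R f x) = - (LINT x|torus. \<phi> x *\<^sub>R g x))"

text \<open>A representative of the weak derivative, which is unique up to a null set. The value is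
  meaningful only if a weak derivative exists.\<close>

definition weak_deriv :: "3 \<Rightarrow> (real^3 \<Rightarrow> 'b::euclidean_space) \<Rightarrow> real^3 \<Rightarrow> 'b" where
  "weak_deriv k f = (SOME g. has_weak_deriv k f g)"

definition H1_space :: "(real^3 \<Rightarrow> 'b::euclidean_space) set" where
  "H1_space = {f \<in> Lp_space 2. \<forall>k. \<exists>g\<in>Lp_space 2. has_weak_deriv k f g}"

definition H1_norm :: "real \<Rightarrow> (real^3 \<Rightarrow> 'b::euclidean_space) \<Rightarrow> real" where
  "H1_norm \<alpha> f = sqrt ((LINT x|torus. (norm (f x))\<^sup>2) +
                         \<alpha>\<^sup>2 * (LINT x|torus. (\<Sum>k\<in>UNIV. (norm (weak_deriv k f x))\<^sup>2)))"

section \<open>Besov spaces\<close>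

text \<open>A smooth cut-off generates the inhomogeneous dyadic resolution of unity
  \<open>(\<Sum>j. dyadic \<theta> j \<xi>) = 1\<close>. Different cut-offs give equivalent Besov norms.\<close>

definition lp_cutoff :: "(real^3 \<Rightarrow> real) \<Rightarrow> bool" where
  "lp_cutoff \<theta> \<longleftrightarrow> smooth \<theta> \<and> (\<forall>\<xi>. norm \<xi> \<le> 1 \<longrightarrow> \<theta> \<xi> = 1) \<and> (\<forall>\<xi>. norm \<xi> \<ge> 3/2 \<longrightarrow> \<theta> \<xi> = 0)"

primrec dyadic :: "(real^3 \<Rightarrow> real) \<Rightarrow> nat \<Rightarrow> real^3 \<Rightarrow> real" where
  "dyadic \<theta> 0 \<xi> = \<theta> \<xi>"
| "dyadic \<theta> (Suc j) \<xi> = \<theta> (\<xi> /\<^sub>R 2 ^ Suc j) - \<theta> (\<xi> /\<^sub>R 2 ^ j)"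

definition fourier_coeff :: "(real^3 \<Rightarrow> real^3) \<Rightarrow> real^3 \<Rightarrow> complex^3" where
  "fourier_coeff f k =
     (\<chi> i. LINT x|torus. cis (- 2 * pi * (k \<bullet> x)) * complex_of_real (f x $ i))"

definition lp_block ::
  "(real^3 \<Rightarrow> real) \<Rightarrow> nat \<Rightarrow> (real^3 \<Rightarrow> real^3) \<Rightarrow> real^3 \<Rightarrow> complex^3" where
  "lp_block \<theta> j f x =
     (\<Sum>k | (\<forall>i. k $ i \<in> \<int>) \<and> dyadic \<theta> j k \<noteq> 0.
        (complex_of_real (dyadic \<theta> j k) * cis (2 * pi * (k \<bullet> x))) *s fourier_coeff f k)"

text \<open>The space \<open>B\<^sup>s\<^bsub>p,\<infinity>\<^esub>\<close>. For \<open>s > 0\<close>, the only case used, its elements are \<open>L\<^sup>p\<close>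
  functions, so no distributions are lost by starting from \<open>L\<^sup>1\<close>.\<close>

definition besov_space ::
  "(real^3 \<Rightarrow> real) \<Rightarrow> real \<Rightarrow> real \<Rightarrow> (real^3 \<Rightarrow> real^3) set" where
  "besov_space \<theta> s p = {f \<in> Lp_space 1.
     bdd_above (range (\<lambda>j. 2 powr (s * real j) * Lp_norm p (lp_block \<theta> j f)))}"

definition besov_norm ::
  "(real^3 \<Rightarrow> real) \<Rightarrow> real \<Rightarrow> real \<Rightarrow> (real^3 \<Rightarrow> real^3) \<Rightarrow> real" where
  "besov_norm \<theta> s p f = (SUP j. 2 powr (s * real j) * Lp_norm p (lp_block \<theta> j f))"

section \<open>Bochner spaces on the time interval\<close>

text \<open>\<open>X\<close> is a space of functions on the torus and \<open>N\<close> is its norm. Strong measurability is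
  approximability in \<open>N\<close> by \<open>X\<close>-valued simple functions, almost everywhere in time.\<close>

abbreviation time :: "real \<Rightarrow> real measure" where
  "time T \<equiv> lebesgue_on {0<..<T}"

definition strongly_measurable ::
  "real \<Rightarrow> (real^3 \<Rightarrow> 'b::euclidean_space) set \<Rightarrow> ((real^3 \<Rightarrow> 'b) \<Rightarrow> real)
     \<Rightarrow> (real \<Rightarrow> real^3 \<Rightarrow> 'b) \<Rightarrow> bool" where
  "strongly_measurable T X N u \<longleftrightarrow> (AE t in time T. u t \<in> X) \<and>
     (\<exists>S. (\<forall>n. simple_function (time T) (S n) \<and> (\<forall>t\<in>{0<..<T}. S n t \<in> X)) \<and>
          (AE t in time T. (\<lambda>n. N (S n t - u t)) \<longlonglongrightarrow> 0))"

definition bochner_Lq ::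
  "real \<Rightarrow> real \<Rightarrow> (real^3 \<Rightarrow> 'b::euclidean_space) set \<Rightarrow> ((real^3 \<Rightarrow> 'b) \<Rightarrow> real)
     \<Rightarrow> (real \<Rightarrow> real^3 \<Rightarrow> 'b) set" where
  "bochner_Lq q T X N =
     {u. strongly_measurable T X N u \<and> integrable (time T) (\<lambda>t. N (u t) powr q)}"

definition bochner_Linf ::
  "real \<Rightarrow> (real^3 \<Rightarrow> 'b::euclidean_space) set \<Rightarrow> ((real^3 \<Rightarrow> 'b) \<Rightarrow> real)
     \<Rightarrow> (real \<Rightarrow> real^3 \<Rightarrow> 'b) set" where
  "bochner_Linf T X N =
     {u. strongly_measurable T X N u \<and> (\<exists>C. AE t in time T. N (u t) \<le> C)}"

section \<open>Weak solutions of the modified Leray-\<open>\<alpha>\<close> model\<close>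

definition weak_solution ::
  "real \<Rightarrow> real \<Rightarrow> (real \<Rightarrow> real^3 \<Rightarrow> real^3) \<Rightarrow> (real \<Rightarrow> real^3 \<Rightarrow> real) \<Rightarrow> bool" where
  "weak_solution \<alpha> T u p \<longleftrightarrow>
     u \<in> bochner_Linf T H1_space (H1_norm \<alpha>) \<and>
     p \<in> bochner_Linf T (Lp_space 1) (Lp_norm 1) \<and>
     (\<forall>\<psi> :: (real^3) \<times> real \<Rightarrow> real^3. \<psi> \<in> test_functions T \<longrightarrow>
       (LINT t|time T. LINT x|torus.
          u t x \<bullet> dt \<psi> (x, t)
          + \<alpha>\<^sup>2 * (\<Sum>k\<in>UNIV. weak_deriv k (u t) x \<bullet> dx k (dt \<psi>) (x, t))
          + (\<Sum>i\<in>UNIV. \<Sum>j\<in>UNIV. u t x $ i * u t x $ j * dx i \<psi> (x, t) $ j)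
          + \<alpha>\<^sup>2 * (\<Sum>i\<in>UNIV. \<Sum>j\<in>UNIV. \<Sum>k\<in>UNIV.
                weak_deriv k (u t) x $ i * weak_deriv k (u t) x $ j * dx i \<psi> (x, t) $ j)
          + \<alpha>\<^sup>2 * (\<Sum>i\<in>UNIV. \<Sum>j\<in>UNIV. \<Sum>k\<in>UNIV.
                weak_deriv k (u t) x $ i * u t x $ j * dx i (dx k \<psi>) (x, t) $ j)
          + p t x * (\<Sum>i\<in>UNIV. dx i \<psi> (x, t) $ i)) = 0) \<and>
     (\<forall>\<eta> :: (real^3) \<times> real \<Rightarrow> real. \<eta> \<in> test_functions T \<longrightarrow>
       (LINT t|time T. LINT x|torus. (\<Sum>i\<in>UNIV. u t x $ i * dx i \<eta> (x, t))) = 0) \<and>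
     (AE t in time T. (LINT x|torus. p t x) = 0)"

end

theory Submission
  imports Defs
begin

text \<open>
  Formally the energy balance is obtained by testing the equation with \<open>u\<close>. The dangerous term is
  \<open>\<integral> \<partial>\<^sub>k u\<^sub>i u\<^sub>j \<partial>\<^sub>i \<partial>\<^sub>k w\<^sub>j\<close>, with two derivatives on the test function \<open>w\<close>. But \<open>\<partial>\<^sub>k u\<close> is divergence
  free, so moving \<open>\<partial>\<^sub>i\<close> off \<open>w\<close> turns this term into \<open>- \<integral> \<partial>\<^sub>k u\<^sub>i \<partial>\<^sub>i u\<^sub>j \<partial>\<^sub>k w\<^sub>j\<close>
  (\<open>second_derivative_term\<close>), and the flux of energy
  \<open>\<integral> u\<^sub>i u\<^sub>j \<partial>\<^sub>i w\<^sub>j + \<alpha>\<^sup>2 \<integral> (\<partial>\<^sub>k u\<^sub>i \<partial>\<^sub>k u\<^sub>j \<partial>\<^sub>i w\<^sub>j - \<partial>\<^sub>k u\<^sub>i \<partial>\<^sub>i u\<^sub>j \<partial>\<^sub>k w\<^sub>j)\<close>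
  involves first derivatives only (\<open>flux_eq_reduced\<close>). It is therefore continuous for the \<open>W\<^bsup>1,3\<^esup>\<close>
  norm. At \<open>w = u\<close> it vanishes: the two integrands with factor \<open>\<alpha>\<^sup>2\<close> cancel pointwise, and
  \<open>\<integral> u\<^sub>i u\<^sub>j \<partial>\<^sub>i u\<^sub>j = 0\<close> by incompressibility (\<open>transport_term_zero\<close>). So the flux through
  approximations of \<open>u\<close> tends to zero as soon as they converge in \<open>W\<^bsup>1,3\<^esup>\<close>, without any
  commutator estimate (\<open>flux_tendsto_zero\<close>).

  The regularity is used only to have \<open>u\<close> in \<open>L\<^sup>3(W\<^bsup>1,3\<^esup>)\<close>. By Bernstein's inequality (\<open>bernstein_L3\<close>) the
  \<open>j\<close>-th dyadic block of \<open>\<nabla>u\<close> is of size \<open>2\<^bsup>j(1 - s)\<^esup>\<close> in \<open>L\<^sup>3\<close>, a convergent geometric series if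
  \<open>s > 1\<close>. The sum \<open>M\<close> of the moduli of all blocks of \<open>u\<close> and \<open>\<nabla>u\<close> is then a single function in \<open>L\<^sup>3\<close>
  that dominates all Littlewood-Paley sums \<open>W\<^sub>J\<close> of \<open>u\<close> together with their gradients, which converge
  almost everywhere (\<open>besov_W13_approximation\<close>). Every limit in space is thus an instance of
  dominated convergence.

  The time derivative is handled by using these same \<open>W\<^sub>J\<close> as approximations. They are trigonometric
  polynomials, so the regularised energy \<open>\<langle>u, W\<^sub>J\<rangle>\<close> in \<open>H\<^sup>1\<close> is a combination of squares of finitely many
  Fourier coefficients of \<open>u\<close> (\<open>H1_pairing_lp_sum\<close>). Each coefficient is a weak solution of a scalar
  differential equation with bounded right-hand side (\<open>weak_solution_coefficient\<close>), and its square obeys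
  the chain rule (\<open>square_of_weak_primitive\<close>). Hence the regularised energy changes between two
  times by twice the integral of the flux through \<open>W\<^sub>J\<close> (\<open>energy_increment\<close>, \<open>energy_flux_eq\<close>); the
  pressure does no work since \<open>W\<^sub>J\<close> is divergence free. As \<open>J\<close> grows, the regularised energy tends to the
  square of the \<open>H\<^sup>1\<close> norm, while the flux tends to zero at almost every time and is bounded by a
  multiple of the cube of the Besov norm, which is integrable in time.
\<close>

section \<open>Smooth functions\<close>

lemma dir_deriv_eqI: "(f has_derivative f') (at x) \<Longrightarrow> dir_deriv b f x = f' b"
  unfolding dir_deriv_def using frechet_derivative_at[of f f' x] by simp

lemma Ck_Suc_D: "Ck (Suc k) f \<Longrightarrow> Ck k f"
proof (induction k arbitrary: f)
  case 0
  then show ?case by (simp add: differentiable_imp_continuous_on)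
next
  case (Suc k)
  then show ?case unfolding Ck.simps(2)[of "Suc k"] Ck.simps(2)[of k f] by blast
qed

lemma smooth_imp_Ck: "smooth f \<Longrightarrow> Ck k f" by (simp add: smooth_def)

lemma smooth_imp_differentiable: "smooth f \<Longrightarrow> f differentiable (at x)"
  using smooth_imp_Ck[of f 1] by (auto simp: differentiable_on_def)

lemma smooth_imp_continuous: "smooth f \<Longrightarrow> continuous_on S f"
  using smooth_imp_Ck[of f 0] continuous_on_subset by auto

lemma smooth_has_derivative: "smooth f \<Longrightarrow> (f has_derivative frechet_derivative f (at x)) (at x)"
  using smooth_imp_differentiable frechet_derivative_works by blast

lemma smooth_dir_deriv: "smooth f \<Longrightarrow> b \<in> Basis \<Longrightarrow> smooth (dir_deriv b f)"
  unfolding smooth_def using Ck.simps(2) by blast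

lemma Ck_const: "Ck k (\<lambda>x::'a::euclidean_space. c)"
proof (induction k arbitrary: c)
  case (Suc k)
  have "dir_deriv b (\<lambda>x::'a. c) = (\<lambda>x. 0)" for b
    by (intro ext dir_deriv_eqI[where f'="\<lambda>_. 0", THEN trans]) simp_all
  then show ?case using Suc by auto
qed auto

lemma Ck_add: "Ck k f \<Longrightarrow> Ck k g \<Longrightarrow> Ck k (\<lambda>x. f x + g x)"
proof (induction k arbitrary: f g)
  case (Suc k)
  have d: "f differentiable (at x)" "g differentiable (at x)" for x
    using Suc.prems by (auto simp: differentiable_on_def)
  have "dir_deriv b (\<lambda>x. f x + g x) = (\<lambda>x. dir_deriv b f x + dir_deriv b g x)" for b
    unfolding dir_deriv_def[of b f] dir_deriv_def[of b g]
    by (intro ext dir_deriv_eqI has_derivative_add) (use d frechet_derivative_works in blast)+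
  then show ?case using Suc by (auto simp: differentiable_on_def)
qed (auto intro: continuous_intros)

lemma Ck_sum: "(\<And>i. i \<in> I \<Longrightarrow> Ck k (f i)) \<Longrightarrow> Ck k (\<lambda>x. \<Sum>i\<in>I. f i x)"
  by (induction I rule: infinite_finite_induct) (auto intro: Ck_const Ck_add)

lemma Ck_scaleR:
  fixes f :: "'a::euclidean_space \<Rightarrow> real"
  shows "Ck k f \<Longrightarrow> Ck k g \<Longrightarrow> Ck k (\<lambda>x. f x *\<^sub>R g x)"
proof (induction k arbitrary: f g)
  case (Suc k)
  have d: "f differentiable (at x)" "g differentiable (at x)" for x
    using Suc.prems by (auto simp: differentiable_on_def)
  have *: "((\<lambda>x. f x *\<^sub>R g x) has_derivative
     (\<lambda>h. f x *\<^sub>R frechet_derivative g (at x) h + frechet_derivative f (at x) h *\<^sub>R g x)) (at x)" for x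
    by (rule has_derivative_scaleR) (use d frechet_derivative_works in blast)+
  then have "(\<lambda>x. f x *\<^sub>R g x) differentiable_on UNIV"
    by (auto simp: differentiable_on_def differentiable_def)
  moreover have "dir_deriv b (\<lambda>x. f x *\<^sub>R g x) = (\<lambda>x. f x *\<^sub>R dir_deriv b g x + dir_deriv b f x *\<^sub>R g x)" for b
    unfolding dir_deriv_def[of b f] dir_deriv_def[of b g] using * by (intro ext dir_deriv_eqI)
  moreover have "Ck k f" "Ck k g" using Suc.prems Ck_Suc_D by blast+
  ultimately show ?case using Suc by (simp add: Ck_add)
qed (auto intro: continuous_intros)

lemma Ck_affine:
  fixes f :: "'a::euclidean_space \<Rightarrow> 'b::real_normed_vector" and L :: "'c::euclidean_space \<Rightarrow> 'a"
  assumes "bounded_linear L"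
  shows "Ck k f \<Longrightarrow> Ck k (\<lambda>x. f (L x + a))"
proof (induction k arbitrary: f)
  case 0
  then show ?case
    using continuous_on_compose2[of UNIV f UNIV "\<lambda>x. L x + a"] linear_continuous_on[OF assms]
    by (simp add: continuous_on_add)
next
  case (Suc k)
  have d: "(f has_derivative frechet_derivative f (at x)) (at x)" for x
    using Suc.prems frechet_derivative_works by (auto simp: differentiable_on_def)
  have "((\<lambda>x. L x + a) has_derivative L) (at x)" for x
    using has_derivative_add[OF bounded_linear_imp_has_derivative[OF assms] has_derivative_const[of a]] by simp
  from has_derivative_compose[OF this d]
  have *: "((\<lambda>x. f (L x + a)) has_derivative (\<lambda>h. frechet_derivative f (at (L x + a)) (L h))) (at x)" for x .
  have lin: "linear (frechet_derivative f (at x))" for x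
    using d has_derivative_linear by blast
  have "frechet_derivative f (at (L x + a)) (L b) = (\<Sum>c\<in>Basis. (L b \<bullet> c) *\<^sub>R dir_deriv c f (L x + a))" for x b
  proof -
    have "frechet_derivative f (at (L x + a)) (L b)
      = frechet_derivative f (at (L x + a)) (\<Sum>c\<in>Basis. (L b \<bullet> c) *\<^sub>R c)"
      by (simp add: euclidean_representation)
    then show ?thesis by (simp add: linear_sum[OF lin] linear_scale[OF lin] dir_deriv_def)
  qed
  then have "dir_deriv b (\<lambda>x. f (L x + a)) = (\<lambda>x. \<Sum>c\<in>Basis. (L b \<bullet> c) *\<^sub>R dir_deriv c f (L x + a))" for b
    using dir_deriv_eqI[OF *] by (intro ext) simp
  moreover have "(\<lambda>x. f (L x + a)) differentiable_on UNIV"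
    using * by (auto simp: differentiable_on_def differentiable_def)
  ultimately show ?case using Suc by (auto intro!: Ck_sum Ck_scaleR Ck_const)
qed

lemma Ck_cos: "Ck k (\<lambda>x. cos (v \<bullet> x + c))"
proof (induction k arbitrary: c)
  case 0
  show ?case by (auto intro!: continuous_intros)
next
  case (Suc k)
  have *: "((\<lambda>x. cos (v \<bullet> x + c)) has_derivative (\<lambda>h. (v \<bullet> h) * cos (v \<bullet> x + (c + pi/2)))) (at x)" for x
    by (auto intro!: derivative_eq_intros ext simp: cos_add sin_add algebra_simps)
  then have "dir_deriv b (\<lambda>x. cos (v \<bullet> x + c)) = (\<lambda>x. (v \<bullet> b) *\<^sub>R cos (v \<bullet> x + (c + pi/2)))" for b
    using dir_deriv_eqI[OF *] by (intro ext) simp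
  then show ?case using * Suc Ck_scaleR[OF Ck_const Suc]
    by (auto simp: differentiable_on_def differentiable_def)
qed

lemma smooth_const: "smooth (\<lambda>x. c)" by (simp add: smooth_def Ck_const)
lemma smooth_add: "smooth f \<Longrightarrow> smooth g \<Longrightarrow> smooth (\<lambda>x. f x + g x)" by (simp add: smooth_def Ck_add)
lemma smooth_sum: "(\<And>i. i \<in> I \<Longrightarrow> smooth (f i)) \<Longrightarrow> smooth (\<lambda>x. \<Sum>i\<in>I. f i x)" by (simp add: smooth_def Ck_sum)
lemma smooth_scaleR: "smooth f \<Longrightarrow> smooth g \<Longrightarrow> smooth (\<lambda>x. (f x :: real) *\<^sub>R g x)" by (simp add: smooth_def Ck_scaleR)
lemma smooth_mult: "smooth f \<Longrightarrow> smooth g \<Longrightarrow> smooth (\<lambda>x. (f x :: real) * g x)" using smooth_scaleR[of f g] by simp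
lemma smooth_affine: "bounded_linear L \<Longrightarrow> smooth f \<Longrightarrow> smooth (\<lambda>x. f (L x + a))" by (simp add: smooth_def Ck_affine)
lemma smooth_cos: "smooth (\<lambda>x. cos (v \<bullet> x + c))" by (simp add: smooth_def Ck_cos)

lemma smooth_primitive:
  fixes f F :: "real \<Rightarrow> real"
  assumes "smooth f" "\<And>x. (F has_real_derivative f x) (at x)"
  shows "smooth F"
proof -
  have h: "(F has_derivative (\<lambda>h. f x * h)) (at x)" for x
    using assms(2)[of x] by (simp add: has_field_derivative_def)
  then have d: "F differentiable_on UNIV" by (auto simp: differentiable_on_def differentiable_def)
  have "dir_deriv 1 F = f" using dir_deriv_eqI[OF h, where b=1] by (intro ext) simp
  then have "Ck (Suc k) F" for k using d assms(1) by (simp add: smooth_def)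
  then have "Ck k F" for k by (rule Ck_Suc_D)
  then show ?thesis by (simp add: smooth_def)
qed

lemma dir_deriv_mult:
  fixes f g :: "'a::euclidean_space \<Rightarrow> real"
  assumes "smooth f" "smooth g"
  shows "dir_deriv b (\<lambda>x. f x * g x) x = f x * dir_deriv b g x + dir_deriv b f x * g x"
  unfolding dir_deriv_def[of b f] dir_deriv_def[of b g]
  by (rule dir_deriv_eqI[OF has_derivative_mult]) (use assms smooth_has_derivative in blast)+

section \<open>Integrals over boxes and geometric series in \<open>L\<^sup>3\<close>\<close>

text \<open>Open boxes are closed under intersection and generate the Borel sets, so the integral vanishes
over every Borel set. The argument is carried out for a Borel measurable version of \<open>f\<close>.\<close>

lemma AE_zero_if_box_integrals_zero:
  fixes f :: "'a::euclidean_space \<Rightarrow> real"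
  assumes f: "integrable lebesgue f" and box: "\<And>c d. (LINT x:box c d|lebesgue. f x) = 0"
  shows "AE x in lebesgue. f x = 0"
proof -
  obtain g where g[measurable]: "g \<in> borel_measurable lborel" and fg: "AE x in lborel. f x = g x"
    using completion_ex_borel_measurable_real[of f lborel] f by auto
  have fg': "AE x in lebesgue. f x = g x" using fg AE_completion by blast
  have gi: "integrable lborel g"
    using f fg' integrable_cong_AE[of f lebesgue g] integrable_completion[of g lborel]
    by (metis borel_measurable_integrable g measurable_completion)
  have sg: "set_integrable lborel A g" if "A \<in> sets borel" for A
    using gi that unfolding set_integrable_def by (intro integrable_mult_indicator) auto
  have boxg: "(LINT x:box c d|lborel. g x) = 0" for c d
  proof -
    have "(LINT x:box c d|lborel. g x) = (LINT x:box c d|lebesgue. g x)"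
      unfolding set_lebesgue_integral_def
      by (rule integral_completion[symmetric]) measurable
    also have "\<dots> = (LINT x:box c d|lebesgue. f x)"
      unfolding set_lebesgue_integral_def
    proof (rule integral_cong_AE)
      have "g \<in> borel_measurable lebesgue" using g measurable_completion by blast
      then show "(\<lambda>x. indicator (box c d) x *\<^sub>R g x) \<in> borel_measurable lebesgue"
        "(\<lambda>x. indicator (box c d) x *\<^sub>R f x) \<in> borel_measurable lebesgue"
        using f by (auto intro!: borel_measurable_times borel_measurable_indicator)
      show "AE x in lebesgue. indicator (box c d) x *\<^sub>R g x = indicator (box c d) x *\<^sub>R f x"
        using fg' by eventually_elim simp
    qed
    finally show ?thesis using box by simp
  qed
  have univ: "(LINT x:UNIV|lborel. g x) = 0"
  proof -
    have "(\<lambda>n. LINT x:box (- (real n *\<^sub>R One)) (real n *\<^sub>R One)|lborel. g x) \<longlonglongrightarrow> (LINT x:UNIV|lborel. g x)"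
      unfolding set_lebesgue_integral_def
    proof (rule integral_dominated_convergence[where w="\<lambda>x. norm (g x)"])
      show "AE x in lborel. (\<lambda>n. indicator (box (- (real n *\<^sub>R One)) (real n *\<^sub>R One)) x *\<^sub>R g x) \<longlonglongrightarrow> indicator UNIV x *\<^sub>R g x"
      proof (intro AE_I2 tendsto_eventually)
        fix x :: 'a
        obtain N where N: "norm x < real N" using reals_Archimedean2 by blast
        have "x \<in> box (- (real n *\<^sub>R One)) (real n *\<^sub>R One)" if "n \<ge> N" for n
        proof (unfold mem_box, intro ballI)
          fix i :: 'a assume i: "i \<in> Basis"
          have "\<bar>x \<bullet> i\<bar> < real n" using Basis_le_norm[OF i, of x] N that by linarith
          then show "- (real n *\<^sub>R One) \<bullet> i < x \<bullet> i \<and> x \<bullet> i < real n *\<^sub>R One \<bullet> i"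
            using i by (simp add: abs_less_iff)
        qed
        then show "\<forall>\<^sub>F n in sequentially. indicator (box (- (real n *\<^sub>R One)) (real n *\<^sub>R One)) x *\<^sub>R g x = indicator UNIV x *\<^sub>R g x"
          unfolding eventually_sequentially by (intro exI[of _ N]) simp
      qed
    qed (use gi in \<open>auto simp: indicator_def\<close>)
    then have "(\<lambda>n::nat. 0) \<longlonglongrightarrow> (LINT x:UNIV|lborel. g x)" by (simp only: boxg)
    then show ?thesis by (simp only: LIMSEQ_const_iff)
  qed
  have all: "(LINT x:A|lborel. g x) = 0" if "A \<in> sets borel" for A
  proof -
    have "Int_stable (range (\<lambda>(a, b). box a b :: 'a set))"
      by (auto simp: Int_stable_def box_Int_box)
    moreover have "(range (\<lambda>(a, b). box a b :: 'a set)) \<subseteq> Pow UNIV"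
      by auto
    moreover have "A \<in> sigma_sets UNIV (range (\<lambda>(a, b). box a b))"
      using that unfolding borel_eq_box by simp
    ultimately show ?thesis
    proof (induction rule: sigma_sets_induct_disjoint)
      case (basic A) then show ?case using boxg by auto
    next
      case empty then show ?case by (simp add: set_lebesgue_integral_def)
    next
      case (compl A)
      then have A: "A \<in> sets borel" by (simp add: borel_eq_box)
      have "(LINT x:A \<union> (UNIV - A)|lborel. g x) = (LINT x:A|lborel. g x) + (LINT x:UNIV - A|lborel. g x)"
        by (rule set_integral_Un) (use A sg in auto)
      moreover have "A \<union> (UNIV - A) = UNIV" by blast
      ultimately show ?case using compl univ by simp
    next
      case (union F)
      then have "F i \<in> sets borel" for i by (auto simp add: borel_eq_box)
      then have "(LINT x:(\<Union>i. F i)|lborel. g x) = (\<Sum>i. (LINT x:(F i)|lborel. g x))"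
        using union.hyps by (intro lebesgue_integral_countable_add sg) (auto simp: disjoint_family_on_def)
      then show ?case using union by simp
    qed
  qed
  have "AE x in lborel. g x = 0"
    using density_unique_real[of lborel g "\<lambda>x. 0"] gi all by simp
  then have "AE x in lborel. f x = 0" using fg by eventually_elim simp
  then show ?thesis using AE_completion by blast
qed

text \<open>Convexity of the cube. This replaces the triangle inequality of \<open>L\<^sup>3\<close>: with suitable weights it
bounds the cube of a sum by cubes of the summands, which can be integrated one by one.\<close>

lemma sum_cube_jensen:
  fixes w b :: "'i \<Rightarrow> real"
  assumes "finite Q" "\<And>q. q \<in> Q \<Longrightarrow> 0 \<le> w q" "\<And>q. q \<in> Q \<Longrightarrow> 0 \<le> b q"
  shows "(\<Sum>q\<in>Q. w q * b q) ^ 3 \<le> (\<Sum>q\<in>Q. w q)\<^sup>2 * (\<Sum>q\<in>Q. w q * b q ^ 3)"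
proof (cases "(\<Sum>q\<in>Q. w q) = 0")
  case True
  then have "w q = 0" if "q \<in> Q" for q using assms that by (simp add: sum_nonneg_eq_0_iff)
  then show ?thesis by simp
next
  case False
  define W where "W = (\<Sum>q\<in>Q. w q)"
  have W: "W > 0" using False assms by (simp add: W_def less_le sum_nonneg)
  have "(\<lambda>x::real. x ^ 3) (\<Sum>q\<in>Q. (w q / W) *\<^sub>R b q) \<le> (\<Sum>q\<in>Q. (w q / W) * (b q) ^ 3)"
  proof (rule convex_on_sum[where C="{0::real..}"])
    show "convex_on {0::real..} (\<lambda>x. x ^ 3)" by (rule convex_power_odd) simp
    show "(\<Sum>q\<in>Q. w q / W) = 1" using W by (simp add: W_def flip: sum_divide_distrib)
  qed (use assms W False in auto)
  then have "(\<Sum>q\<in>Q. w q * b q) ^ 3 / W ^ 3 \<le> (\<Sum>q\<in>Q. w q * b q ^ 3) / W"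
    by (simp add: power_divide flip: sum_divide_distrib)
  then have "(\<Sum>q\<in>Q. w q * b q) ^ 3 \<le> W ^ 3 * ((\<Sum>q\<in>Q. w q * b q ^ 3) / W)"
    using W by (simp add: pos_divide_le_eq mult.commute)
  then show ?thesis using W unfolding W_def[symmetric] by (simp add: power3_eq_cube power2_eq_square)
qed

text \<open>A series whose terms decay geometrically in \<open>L\<^sup>3\<close> converges almost everywhere, and the limit inherits
the \<open>L\<^sup>3\<close> bound by monotone convergence. The constant is the one that the triangle inequality in \<open>L\<^sup>3\<close>
would give.\<close>

lemma summable_cube_bound:
  fixes a :: "nat \<Rightarrow> 'a \<Rightarrow> real"
  assumes a: "\<And>j. a j \<in> borel_measurable M" "\<And>j x. 0 \<le> a j x"
    and i: "\<And>j. integrable M (\<lambda>x. a j x ^ 3)"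
    and B: "\<And>j. (LINT x|M. a j x ^ 3) \<le> B * \<rho> ^ (3 * j)"
    and \<rho>: "0 < \<rho>" "\<rho> < 1"
  shows "AE x in M. summable (\<lambda>j. a j x)"
    and "integrable M (\<lambda>x. (\<Sum>j. a j x) ^ 3)"
    and "(LINT x|M. (\<Sum>j. a j x) ^ 3) \<le> B / (1 - \<rho>) ^ 3"
proof -
  note [measurable] = a(1)
  define S where "S n x = (\<Sum>j<n. a j x)" for n x
  have [measurable]: "S n \<in> borel_measurable M" for n unfolding S_def by measurable
  have S0: "0 \<le> S n x" for n x by (simp add: S_def a sum_nonneg)
  have mono: "S n x \<le> S m x" if "n \<le> m" for n m x
    unfolding S_def by (rule sum_mono2) (use that a in auto)
  have B0: "0 \<le> B"
    using B[of 0] integral_nonneg_AE[of "\<lambda>x. a 0 x ^ 3" M] a by fastforce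
  have geo: "(\<Sum>j<n. \<rho> ^ j) \<le> 1 / (1 - \<rho>)" for n
    using sum_le_suminf[of "\<lambda>j. \<rho> ^ j" "{..<n}"] \<rho> by (simp add: suminf_geometric summable_geometric)
  define K where "K = B / (1 - \<rho>) ^ 3"
  have bound: "(\<integral>\<^sup>+x. ennreal (S n x ^ 3) \<partial>M) \<le> ennreal K" for n
  proof -
    \<comment> \<open>With weights \<open>\<rho> ^ j\<close> in Jensen's inequality the remaining factors \<open>b j\<close> have cubes with integral
      at most \<open>B\<close>.\<close>
    define b where "b j x = a j x / \<rho> ^ j" for j x
    have bi: "integrable M (\<lambda>x. \<rho> ^ j * b j x ^ 3)" for j
      using integrable_mult_right[OF i[of j], of "\<rho> ^ j / (\<rho> ^ j) ^ 3"] by (simp add: b_def power_divide)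
    have bb: "(LINT x|M. \<rho> ^ j * b j x ^ 3) \<le> B * \<rho> ^ j" for j
    proof -
      have "(LINT x|M. \<rho> ^ j * b j x ^ 3) = \<rho> ^ j / (\<rho> ^ j) ^ 3 * (LINT x|M. a j x ^ 3)"
        by (simp add: b_def power_divide)
      also have "\<dots> \<le> \<rho> ^ j / (\<rho> ^ j) ^ 3 * (B * \<rho> ^ (3 * j))"
        using \<rho> by (intro mult_left_mono B) auto
      also have "\<dots> = B * \<rho> ^ j" using \<rho> by (simp add: mult.commute[of 3 j] flip: power_mult)
      finally show ?thesis .
    qed
    have pw: "S n x ^ 3 \<le> (1 / (1 - \<rho>))\<^sup>2 * (\<Sum>j<n. \<rho> ^ j * b j x ^ 3)" for x
    proof -
      have "S n x = (\<Sum>j<n. \<rho> ^ j * b j x)" using \<rho> by (simp add: S_def b_def)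
      then have "S n x ^ 3 \<le> (\<Sum>j<n. \<rho> ^ j)\<^sup>2 * (\<Sum>j<n. \<rho> ^ j * b j x ^ 3)"
        using sum_cube_jensen[of "{..<n}" "\<lambda>j. \<rho> ^ j" "\<lambda>j. b j x"] \<rho> a by (simp add: b_def)
      also have "\<dots> \<le> (1 / (1 - \<rho>))\<^sup>2 * (\<Sum>j<n. \<rho> ^ j * b j x ^ 3)"
        using geo[of n] \<rho> a by (intro mult_right_mono power_mono sum_nonneg) (auto simp: b_def intro!: sum_nonneg)
      finally show ?thesis .
    qed
    let ?r = "\<lambda>x. (1 / (1 - \<rho>))\<^sup>2 * (\<Sum>j<n. \<rho> ^ j * b j x ^ 3)"
    have ri: "integrable M ?r" using bi by auto
    have "(LINT x|M. ?r x) = (1 / (1 - \<rho>))\<^sup>2 * (\<Sum>j<n. LINT x|M. \<rho> ^ j * b j x ^ 3)"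
      using bi by (simp add: Bochner_Integration.integral_sum)
    also have "\<dots> \<le> (1 / (1 - \<rho>))\<^sup>2 * (\<Sum>j<n. B * \<rho> ^ j)"
      by (intro mult_left_mono sum_mono bb) auto
    also have "\<dots> = (1 / (1 - \<rho>))\<^sup>2 * B * (\<Sum>j<n. \<rho> ^ j)" by (simp add: sum_distrib_left mult.assoc)
    also have "\<dots> \<le> (1 / (1 - \<rho>))\<^sup>2 * B * (1 / (1 - \<rho>))"
      using geo[of n] B0 by (intro mult_left_mono) auto
    also have "\<dots> = K" by (simp add: K_def power2_eq_square power3_eq_cube)
    finally have "(LINT x|M. ?r x) \<le> K" .
    moreover have "(\<integral>\<^sup>+x. ennreal (S n x ^ 3) \<partial>M) \<le> (\<integral>\<^sup>+x. ennreal (?r x) \<partial>M)"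
      by (intro nn_integral_mono ennreal_leI pw)
    moreover have "0 \<le> ?r x" for x using order_trans[OF _ pw] S0 by fastforce
    ultimately show ?thesis using nn_integral_eq_integral[OF ri] ennreal_leI order_trans by (metis (no_types, lifting) AE_I2)
  qed
  have sup: "(\<integral>\<^sup>+x. (SUP n. ennreal (S n x ^ 3)) \<partial>M) \<le> ennreal K"
  proof -
    have "(\<integral>\<^sup>+x. (SUP n. ennreal (S n x ^ 3)) \<partial>M) = (SUP n. \<integral>\<^sup>+x. ennreal (S n x ^ 3) \<partial>M)"
      by (rule nn_integral_monotone_convergence_SUP)
        (auto simp: incseq_def le_fun_def S0 intro!: ennreal_leI power_mono mono)
    also have "\<dots> \<le> ennreal K" by (rule SUP_least) (rule bound)
    finally show ?thesis .
  qed
  have "AE x in M. (SUP n. ennreal (S n x ^ 3)) \<noteq> \<infinity>"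
    by (rule nn_integral_PInf_AE) (use sup in \<open>auto simp: top_unique\<close>)
  then show sm: "AE x in M. summable (\<lambda>j. a j x)"
  proof eventually_elim
    case (elim x)
    then obtain C where C: "(SUP n. ennreal (S n x ^ 3)) = ennreal C" "C \<ge> 0"
      by (metis ennreal_cases infinity_ennreal_def)
    have S1: "S n x \<le> C + 1" for n
    proof (rule ccontr)
      assume "\<not> S n x \<le> C + 1"
      then have 1: "C + 1 < S n x" by simp
      have "ennreal (S n x ^ 3) \<le> ennreal C" using C(1) by (metis SUP_upper UNIV_I)
      then have 2: "S n x ^ 3 \<le> C" using C(2) by simp
      have "1 \<le> S n x" using 1 C(2) by simp
      then have "S n x \<le> S n x ^ 3" using self_le_power[of "S n x" 3] by simp
      then show False using 1 2 by simp
    qed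
    have "(\<Sum>k\<le>n. a k x) \<le> C + 1" for n
      using S1[of "Suc n"] by (simp add: S_def lessThan_Suc_atMost)
    then show ?case using a(2) by (intro bounded_imp_summable[of _ "C+1"])
  qed
  have nn: "(\<integral>\<^sup>+x. ennreal ((\<Sum>j. a j x) ^ 3) \<partial>M) \<le> ennreal K"
  proof -
    have "(\<integral>\<^sup>+x. ennreal ((\<Sum>j. a j x) ^ 3) \<partial>M) \<le> (\<integral>\<^sup>+x. (SUP n. ennreal (S n x ^ 3)) \<partial>M)"
    proof (rule nn_integral_mono_AE, use sm in eventually_elim)
      case (elim x)
      have "(\<lambda>n. S n x) \<longlonglongrightarrow> (\<Sum>j. a j x)" unfolding S_def using elim by (rule summable_LIMSEQ)
      then have "(\<lambda>n. ennreal (S n x ^ 3)) \<longlonglongrightarrow> ennreal ((\<Sum>j. a j x) ^ 3)"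
        by (intro tendsto_ennrealI tendsto_power)
      then show ?case by (rule LIMSEQ_le_const2) (meson SUP_upper UNIV_I)
    qed
    then show ?thesis using sup by order
  qed
  have M0: "0 \<le> (\<Sum>j. a j x) ^ 3" if "summable (\<lambda>j. a j x)" for x
    using that a by (simp add: suminf_nonneg)
  then have AE0: "AE x in M. 0 \<le> (\<Sum>j. a j x) ^ 3" using sm by (auto elim: AE_mp)
  show int: "integrable M (\<lambda>x. (\<Sum>j. a j x) ^ 3)"
    by (rule integrableI_nonneg) (use nn AE0 in \<open>auto simp: less_top[symmetric] top_unique\<close>)
  have K0: "0 \<le> K" using B0 \<rho> by (simp add: K_def)
  show "(LINT x|M. (\<Sum>j. a j x) ^ 3) \<le> B / (1 - \<rho>) ^ 3"
    using nn nn_integral_eq_integral[OF int AE0] K0 by (simp add: K_def)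
qed

section \<open>Characters and translations of the torus\<close>

lemma continuous_integrable_torus:
  fixes f :: "real^3 \<Rightarrow> 'b::euclidean_space"
  shows "continuous_on UNIV f \<Longrightarrow> integrable torus f"
  by (meson continuous_imp_integrable continuous_on_subset subset_UNIV)

lemma measure_torus: "measure torus (cbox 0 1) = 1"
  by (simp add: measure_restrict_space content_cbox_cart interval_eq_empty_cart not_less)

text \<open>The shifted cube is cut along a face of the unit cube, and the part that sticks out is moved back by one period.\<close>

lemma torus_shift:
  fixes f :: "real^3 \<Rightarrow> 'b::euclidean_space"
  assumes f: "continuous_on UNIV f" "periodic f" and y: "0 \<le> y" "y \<le> 1"
  shows "(LINT x|torus. f (x + y *\<^sub>R axis i 1)) = (LINT x|torus. f x)"
proof -
  define c :: "real^3" where "c = y *\<^sub>R axis i 1"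
  define e :: "real^3" where "e = axis i 1"
  have xe: "x \<bullet> e = x $ i" and ei: "e $ j = (if j = i then 1 else 0)"
    and ci: "c $ j = (if j = i then y else 0)" for x j
    by (auto simp: e_def c_def inner_axis) (auto simp: axis_def)
  define Q where "Q x \<longleftrightarrow> (\<forall>j. j \<noteq> i \<longrightarrow> 0 \<le> x $ j \<and> x $ j \<le> 1)" for x :: "real^3"
  have boxi: "x \<in> cbox a b \<longleftrightarrow> (a $ i \<le> x $ i \<and> x $ i \<le> b $ i) \<and> Q x"
    if ab: "\<And>j. j \<noteq> i \<Longrightarrow> a $ j = 0" "\<And>j. j \<noteq> i \<Longrightarrow> b $ j = 1" for a b x :: "real^3"
    unfolding mem_box_cart Q_def using ab by (metis (no_types))
  have b: "x \<in> cbox c (1 + c) \<longleftrightarrow> (y \<le> x $ i \<and> x $ i \<le> 1 + y) \<and> Q x"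
    "x \<in> cbox c 1 \<longleftrightarrow> (y \<le> x $ i \<and> x $ i \<le> 1) \<and> Q x"
    "x \<in> cbox e (1 + c) \<longleftrightarrow> (1 \<le> x $ i \<and> x $ i \<le> 1 + y) \<and> Q x"
    "x \<in> cbox 0 (1 + c - e) \<longleftrightarrow> (0 \<le> x $ i \<and> x $ i \<le> y) \<and> Q x"
    "x \<in> cbox 0 1 \<longleftrightarrow> (0 \<le> x $ i \<and> x $ i \<le> 1) \<and> Q x" for x
    by (subst boxi; simp add: ci ei)+
  have ct: "continuous_on S f" for S using f continuous_on_subset by blast
  have ctc: "continuous_on S (\<lambda>x. f (x + c))" for S
    by (rule continuous_on_compose2[OF f(1)]) (auto intro!: continuous_intros)
  have "(LINT x|torus. f (x + c)) = integral (cbox 0 1) (\<lambda>x. f (x + c))"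
    by (intro lebesgue_integral_eq_integral continuous_integrable_torus ctc) auto
  also have "\<dots> = integral (cbox c (1 + c)) f"
    using integral_shift_cbox[of c c "1 + c" f] by simp
  also have "\<dots> = integral (cbox c (1 + c) \<inter> {x. x \<bullet> e \<le> 1}) f + integral (cbox c (1 + c) \<inter> {x. x \<bullet> e \<ge> 1}) f"
    by (rule integral_split) (auto intro!: integrable_continuous ct simp: e_def)
  also have "cbox c (1 + c) \<inter> {x. x \<bullet> e \<le> 1} = cbox c 1"
    using y by (auto simp: set_eq_iff b xe)
  also have "cbox c (1 + c) \<inter> {x. x \<bullet> e \<ge> 1} = cbox e (1 + c)"
    using y by (auto simp: set_eq_iff b xe)
  also have "integral (cbox e (1 + c)) f = integral (cbox 0 (1 + c - e)) f"
    using integral_shift_cbox[of e e "1 + c" f] f(2) by (simp add: e_def periodic_def)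
  also have "integral (cbox c 1) f + integral (cbox 0 (1 + c - e)) f = integral (cbox 0 1) f"
  proof -
    have "integral (cbox 0 1) f = integral (cbox 0 1 \<inter> {x. x \<bullet> e \<le> y}) f + integral (cbox 0 1 \<inter> {x. x \<bullet> e \<ge> y}) f"
      by (rule integral_split) (auto intro!: integrable_continuous ct simp: e_def)
    moreover have "cbox 0 1 \<inter> {x. x \<bullet> e \<le> y} = cbox 0 (1 + c - e)"
      using y by (auto simp: set_eq_iff b xe)
    moreover have "cbox 0 1 \<inter> {x. x \<bullet> e \<ge> y} = cbox c 1"
      using y by (auto simp: set_eq_iff b xe)
    ultimately show ?thesis by simp
  qed
  also have "\<dots> = (LINT x|torus. f x)"
    by (intro lebesgue_integral_eq_integral[symmetric] continuous_integrable_torus f) auto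
  finally show ?thesis by (simp add: c_def)
qed

definition frequencies :: "(real^3) set" where
  "frequencies = {k. \<forall>i. k $ i \<in> \<int>}"

lemma cis_add_2pi_int: "n \<in> \<int> \<Longrightarrow> cis (a + 2 * pi * n) = cis a"
  by (simp add: cis_mult[symmetric])

lemma periodic_cis: "k \<in> frequencies \<Longrightarrow> periodic (\<lambda>x. cis (2 * pi * (k \<bullet> x)))"
  by (auto simp: periodic_def frequencies_def inner_add_right inner_axis distrib_left cis_add_2pi_int)

lemma integral_cis:
  assumes "k \<in> frequencies"
  shows "(LINT x|torus. cis (2 * pi * (k \<bullet> x))) = (if k = 0 then 1 else 0)"
proof (cases "k = 0")
  case True
  then show ?thesis using measure_torus by simp
next
  case False
  then obtain i where i: "k $ i \<noteq> 0" by (auto simp: vec_eq_iff)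
  define y where "y = 1 / (2 * \<bar>k $ i\<bar>)"
  have "1 \<le> \<bar>k $ i\<bar>" using i assms Ints_nonzero_abs_ge1[of "k $ i"] by (auto simp: frequencies_def)
  then have y: "0 \<le> y" "y \<le> 1" by (auto simp: y_def field_simps)
  have ky: "k $ i * y = 1/2 \<or> k $ i * y = -1/2" using i by (auto simp: y_def abs_if)
  let ?I = "LINT x|torus. cis (2 * pi * (k \<bullet> x))"
  have "?I = (LINT x|torus. cis (2 * pi * (k \<bullet> (x + y *\<^sub>R axis i 1))))"
    by (rule torus_shift[symmetric]) (use y assms periodic_cis in \<open>auto intro!: continuous_intros\<close>)
  also have "\<dots> = (LINT x|torus. cis (2 * pi * (k $ i * y)) * cis (2 * pi * (k \<bullet> x)))"
    by (simp add: cis_mult inner_add_right inner_axis algebra_simps)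
  also have "\<dots> = - ?I"
  proof -
    have "2 * pi * (k $ i * y) = pi \<or> 2 * pi * (k $ i * y) = - pi" using ky by auto
    then have "cis (2 * pi * (k $ i * y)) = -1"
    proof
      assume "2 * pi * (k $ i * y) = pi"
      then show ?thesis by (simp only: cis_pi)
    next
      assume "2 * pi * (k $ i * y) = - pi"
      then have "cis (2 * pi * (k $ i * y)) = cis (- pi)" by (simp only:)
      then show ?thesis by (simp add: complex_eq_iff)
    qed
    then show ?thesis by simp
  qed
  finally show ?thesis using False by simp
qed

lemma sum_cis_multiples:
  assumes "M > 0"
  shows "(\<Sum>q<M. cis (2 * pi * of_int m * real q / real M)) = (if int M dvd m then of_nat M else 0)"
proof -
  define z where "z = cis (2 * pi * of_int m / real M)"
  have zq: "cis (2 * pi * of_int m * real q / real M) = z ^ q" for q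
  proof -
    have "2 * pi * of_int m * real q / real M = real q * (2 * pi * of_int m / real M)" by simp
    then have "cis (2 * pi * of_int m * real q / real M) = cis (real q * (2 * pi * of_int m / real M))" by (simp only:)
    also have "\<dots> = z ^ q" unfolding z_def by (rule Complex.DeMoivre[symmetric])
    finally show ?thesis .
  qed
  have "z ^ M = cis (2 * pi * of_int m)" unfolding z_def Complex.DeMoivre using assms by simp
  then have zM: "z ^ M = 1" by simp
  have z1: "z = 1 \<longleftrightarrow> int M dvd m"
  proof
    assume "z = 1"
    then have "cos (2 * pi * of_int m / real M) = 1" by (metis cis.sel(1) one_complex.sel(1) z_def)
    then obtain n :: int where "2 * pi * of_int m / real M = n * 2 * pi" unfolding cos_one_2pi_int by auto
    then have "real_of_int m = real_of_int (n * int M)" using assms by (simp add: field_simps)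
    then show "int M dvd m" by (simp only: of_int_eq_iff) simp
  next
    assume "int M dvd m"
    then obtain n where "m = int M * n" by blast
    then have "2 * pi * of_int m / real M = 2 * pi * real_of_int n" using assms by simp
    then show "z = 1" unfolding z_def by (metis cis_multiple_2pi Ints_of_int)
  qed
  show ?thesis
  proof (cases "z = 1")
    case True then show ?thesis using z1 by (simp add: zq)
  next
    case False then show ?thesis using z1 geometric_sum[OF False, of M] zM by (simp add: zq)
  qed
qed

text \<open>On frequencies \<open>\<bar>m\<bar> \<le> N\<close>, multiplication by \<open>m\<close> (that is, differentiation) is a combination of the
translations by multiples of \<open>1/(4N)\<close> whose coefficients have total mass at most \<open>2N\<close>. The
coefficients come from the Fejer kernel \<open>w\<close> on \<open>4N\<close> points: its transform \<open>\<Phi>\<close> is the triangle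
\<open>max 0 (1 - \<bar>m\<bar>/N)\<close> for \<open>\<bar>m\<bar> \<le> 2N\<close>, and \<open>N (\<Phi>(m - N) - \<Phi>(m + N)) = m\<close> for \<open>\<bar>m\<bar> \<le> N\<close>. As \<open>w\<close> is
nonnegative its mass is \<open>\<Phi>(0) = 1\<close>.\<close>

lemma bernstein_weights:
  assumes N: "N > 0"
  obtains \<alpha> :: "nat \<Rightarrow> complex" where
    "\<And>m::int. \<bar>m\<bar> \<le> int N \<Longrightarrow> (\<Sum>q<4*N. \<alpha> q * cis (2 * pi * of_int m * real q / real (4*N))) = of_int m"
    "(\<Sum>q<4*N. norm (\<alpha> q)) \<le> 2 * real N"
proof -
  define M where "M = 4 * N"
  have M: "M > 0" using N by (simp add: M_def)
  define e where "e m q = cis (2 * pi * of_int m * real q / real M)" for m :: int and q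
  have e_add: "e (m + n) q = e m q * e n q" for m n q
    by (simp add: e_def cis_mult add_divide_distrib[symmetric] algebra_simps)
  have e_cnj: "cnj (e m q) = e (- m) q" for m q by (simp add: e_def cis_cnj)
  have e_norm: "norm (e m q) = 1" for m q by (simp add: e_def)
  define D where "D q = (\<Sum>r<N. e (int r) q)" for q
  define w where "w q = (norm (D q))\<^sup>2 / (real M * real N)" for q
  have w0: "w q \<ge> 0" for q by (simp add: w_def)
  define \<Phi> where "\<Phi> m = (\<Sum>q<M. of_real (w q) * e m q)" for m
  have DD: "(of_real (norm (D q)))\<^sup>2 = (\<Sum>r<N. \<Sum>r'<N. e (int r - int r') q)" for q
  proof -
    have "(of_real (norm (D q)))\<^sup>2 = D q * cnj (D q)" using complex_norm_square[of "D q"] by simp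
    also have "\<dots> = (\<Sum>r<N. \<Sum>r'<N. e (int r) q * e (- int r') q)"
      by (simp add: D_def sum_product e_cnj)
    finally show ?thesis by (simp add: e_add[symmetric])
  qed
  have \<Phi>: "\<Phi> m = of_nat (card {r. r < N \<and> 0 \<le> int r + m \<and> int r + m < int N}) / of_nat N"
    if m: "\<bar>m\<bar> \<le> 2 * int N" for m
  proof -
    have "of_nat (M * N) * \<Phi> m = (\<Sum>q<M. of_real ((norm (D q))\<^sup>2) * e m q)"
      using M N by (simp add: \<Phi>_def w_def sum_distrib_left)
    also have "\<dots> = (\<Sum>q<M. \<Sum>r<N. \<Sum>r'<N. e (int r - int r' + m) q)"
      by (simp add: DD sum_distrib_right e_add)
    also have "\<dots> = (\<Sum>r<N. \<Sum>r'<N. \<Sum>q<M. e (int r - int r' + m) q)"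
      by (rule trans[OF sum.swap]) (rule sum.cong[OF refl], rule sum.swap)
    also have "\<dots> = (\<Sum>r<N. \<Sum>r'<N. if int r' = int r + m then of_nat M else 0)"
    proof (intro sum.cong refl)
      fix r r' assume r: "r \<in> {..<N}" "r' \<in> {..<N}"
      \<comment> \<open>No aliasing: \<open>\<bar>r - r' + m\<bar> < 3N\<close>, which is less than the number \<open>4N\<close> of points.\<close>
      have "int M dvd (int r - int r' + m) \<longleftrightarrow> int r' = int r + m"
      proof
        assume "int M dvd (int r - int r' + m)"
        moreover have "\<bar>int r - int r' + m\<bar> < int M" using r m N by (auto simp: M_def)
        ultimately have "int r - int r' + m = 0" using dvd_imp_le_int[of "int r - int r' + m" "int M"] by fastforce
        then show "int r' = int r + m" by simp
      qed auto
      then show "(\<Sum>q<M. e (int r - int r' + m) q) = (if int r' = int r + m then of_nat M else 0)"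
        using sum_cis_multiples[OF M, of "int r - int r' + m"] unfolding e_def by simp
    qed
    also have "\<dots> = (\<Sum>r<N. if 0 \<le> int r + m \<and> int r + m < int N then of_nat M else 0)"
    proof (intro sum.cong refl)
      fix r assume "r \<in> {..<N}"
      have "(\<Sum>r'<N. if int r' = int r + m then of_nat M else (0::complex))
          = (\<Sum>r'<N. if 0 \<le> int r + m \<and> r' = nat (int r + m) then of_nat M else 0)"
        by (intro sum.cong refl) auto
      then show "(\<Sum>r'<N. if int r' = int r + m then of_nat M else (0::complex)) =
          (if 0 \<le> int r + m \<and> int r + m < int N then of_nat M else 0)"
        by (cases "0 \<le> int r + m") (auto simp: nat_less_iff)
    qed
    also have "\<dots> = (\<Sum>r\<in>{r. r < N \<and> 0 \<le> int r + m \<and> int r + m < int N}. of_nat M)"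
      by (subst sum.inter_filter[symmetric]) (auto intro!: sum.cong)
    finally show ?thesis using M N by (simp add: field_simps)
  qed
  define \<alpha> where "\<alpha> q = of_nat N * of_real (w q) * (e (- int N) q - e (int N) q)" for q
  have "(\<Sum>q<M. \<alpha> q * e m q) = of_int m" if m: "\<bar>m\<bar> \<le> int N" for m
  proof -
    have "(\<Sum>q<M. \<alpha> q * e m q) = of_nat N * (\<Phi> (m - int N) - \<Phi> (m + int N))"
      by (simp add: \<alpha>_def \<Phi>_def algebra_simps sum_distrib_left sum_subtractf e_add[symmetric])
    also have "\<dots> = of_nat (card {r. r < N \<and> 0 \<le> int r + (m - int N) \<and> int r + (m - int N) < int N})
       - of_nat (card {r. r < N \<and> 0 \<le> int r + (m + int N) \<and> int r + (m + int N) < int N})"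
      using N m by (subst (1 2) \<Phi>) (auto simp: algebra_simps)
    also have "{r. r < N \<and> 0 \<le> int r + (m - int N) \<and> int r + (m - int N) < int N} = {nat (int N - m)..<N}"
      using m by auto
    also have "{r. r < N \<and> 0 \<le> int r + (m + int N) \<and> int r + (m + int N) < int N} = {..<nat (- m)}"
      using m by auto
    also have "of_nat (card {nat (int N - m)..<N}) - of_nat (card {..<nat (- m)}) = (of_int m :: complex)"
      using m by (cases "0 \<le> m") (auto simp: of_nat_diff nat_le_iff of_nat_nat)
    finally show ?thesis .
  qed
  moreover have "(\<Sum>q<M. norm (\<alpha> q)) \<le> 2 * real N"
  proof -
    have "\<Phi> 0 = 1" using N by (simp add: \<Phi>)
    then have w1: "(\<Sum>q<M. w q) = 1"
      by (simp add: \<Phi>_def e_def flip: of_real_sum)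
    have "norm (\<alpha> q) \<le> 2 * real N * w q" for q
    proof -
      have "norm (e (- int N) q - e (int N) q) \<le> 2"
        using norm_triangle_ineq4[of "e (- int N) q" "e (int N) q"] by (simp add: e_norm)
      then show ?thesis using w0[of q] mult_left_mono[of "norm (e (- int N) q - e (int N) q)" 2 "real N * w q"]
        by (simp add: \<alpha>_def norm_mult mult_ac)
    qed
    then have "(\<Sum>q<M. norm (\<alpha> q)) \<le> (\<Sum>q<M. 2 * real N * w q)" by (intro sum_mono)
    then show ?thesis using w1 by (simp flip: sum_distrib_left)
  qed
  ultimately show ?thesis using that[of \<alpha>] unfolding e_def M_def by blast
qed

section \<open>Uniqueness of Fourier coefficients\<close>

text \<open>The bounded multipliers of \<open>f\<close> after which all Fourier coefficients vanish. If those of \<open>f\<close> itself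
vanish, the class contains the constants; being closed under products with cosines and under bounded
limits, it then contains the indicators of boxes.\<close>

definition annihilating :: "(real^3 \<Rightarrow> complex) \<Rightarrow> (real^3 \<Rightarrow> real) \<Rightarrow> bool" where
  "annihilating f \<phi> \<longleftrightarrow> \<phi> \<in> borel_measurable borel \<and> bounded (range \<phi>) \<and>
     (\<forall>k\<in>frequencies. (LINT x|torus. \<phi> x *\<^sub>R (cis (2 * pi * (k \<bullet> x)) * f x)) = 0)"

lemma annihilatingD:
  assumes "annihilating f \<phi>"
  shows "\<phi> \<in> borel_measurable borel" "\<exists>B. \<forall>x. \<bar>\<phi> x\<bar> \<le> B"
    "k \<in> frequencies \<Longrightarrow> (LINT x|torus. \<phi> x *\<^sub>R (cis (2 * pi * (k \<bullet> x)) * f x)) = 0"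
  using assms unfolding annihilating_def by (blast, simp add: bounded_iff, blast)

lemma measurable_torus: "\<phi> \<in> borel_measurable borel \<Longrightarrow> \<phi> \<in> borel_measurable torus"
  for \<phi> :: "real^3 \<Rightarrow> 'b::euclidean_space"
  by (rule measurable_restrict_space1, rule measurable_completion) simp

lemma integrable_bounded_mult:
  fixes \<phi> :: "real^3 \<Rightarrow> real" and f :: "real^3 \<Rightarrow> 'b::euclidean_space"
  assumes "\<phi> \<in> borel_measurable torus" "bounded (range \<phi>)" "integrable torus f"
  shows "integrable torus (\<lambda>x. \<phi> x *\<^sub>R f x)"
proof -
  obtain B where B: "\<And>x. \<bar>\<phi> x\<bar> \<le> B" using assms(2) by (auto simp: bounded_iff)
  have "integrable torus (\<lambda>x. B *\<^sub>R norm (f x))" using assms(3) by simp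
  then show ?thesis
  proof (rule Bochner_Integration.integrable_bound)
    show "(\<lambda>x. \<phi> x *\<^sub>R f x) \<in> borel_measurable torus"
      using assms by (intro borel_measurable_scaleR) auto
    show "AE x in torus. norm (\<phi> x *\<^sub>R f x) \<le> norm (B *\<^sub>R norm (f x))"
    proof (intro AE_I2)
      fix x
      have "norm (\<phi> x *\<^sub>R f x) \<le> B * norm (f x)" using B by (simp add: mult_right_mono)
      then show "norm (\<phi> x *\<^sub>R f x) \<le> norm (B *\<^sub>R norm (f x))" by simp
    qed
  qed
qed

lemma integrable_cis_mult:
  assumes "integrable torus f"
  shows "integrable torus (\<lambda>x. cis (2 * pi * (k \<bullet> x)) * f x)"
proof (rule Bochner_Integration.integrable_bound[OF assms])
  have "(\<lambda>x. cis (2 * pi * (k \<bullet> x))) \<in> borel_measurable torus"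
    by (intro measurable_torus borel_measurable_continuous_onI continuous_intros)
  then show "(\<lambda>x. cis (2 * pi * (k \<bullet> x)) * f x) \<in> borel_measurable torus"
    by (rule borel_measurable_times[OF _ borel_measurable_integrable[OF assms]])
  show "AE x in torus. norm (cis (2 * pi * (k \<bullet> x)) * f x) \<le> norm (f x)"
    by (intro AE_I2) (simp only: norm_mult norm_cis mult_1_left order_refl)
qed

lemma annihilating_integrable:
  assumes "integrable torus f" "annihilating f \<phi>"
  shows "integrable torus (\<lambda>x. \<phi> x *\<^sub>R (cis (2 * pi * (k \<bullet> x)) * f x))"
proof -
  have "\<phi> \<in> borel_measurable borel" "bounded (range \<phi>)"
    using assms(2) unfolding annihilating_def by blast+
  then show ?thesis
    using integrable_bounded_mult[OF measurable_torus _ integrable_cis_mult[OF assms(1)]] by blast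
qed

lemma annihilating_add:
  assumes "integrable torus f" "annihilating f \<phi>" "annihilating f \<psi>"
  shows "annihilating f (\<lambda>x. \<phi> x + \<psi> x)"
proof -
  have "(LINT x|torus. (\<phi> x + \<psi> x) *\<^sub>R (cis (2 * pi * (k \<bullet> x)) * f x)) = 0" if "k \<in> frequencies" for k
    unfolding scaleR_add_left
    using that assms annihilating_integrable[OF assms(1,2), of k] annihilating_integrable[OF assms(1,3), of k]
    by (simp add: annihilating_def)
  moreover have "bounded (range (\<lambda>x. \<phi> x + \<psi> x))"
    using assms unfolding annihilating_def by (intro bounded_plus_comp) auto
  ultimately show ?thesis using assms unfolding annihilating_def by (auto intro!: borel_measurable_add)
qed

lemma annihilating_scale:
  assumes "annihilating f \<phi>"
  shows "annihilating f (\<lambda>x. c * \<phi> x)"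
proof -
  have "(LINT x|torus. (c * \<phi> x) *\<^sub>R (cis (2 * pi * (k \<bullet> x)) * f x)) = 0" if "k \<in> frequencies" for k
    unfolding scaleR_scaleR[symmetric] using that assms by (simp only: integral_scaleR_right annihilating_def) simp
  moreover have "bounded (range (\<lambda>x. c * \<phi> x))"
    using bounded_scaling[of "range \<phi>" c] assms by (simp add: annihilating_def image_image)
  ultimately show ?thesis using assms unfolding annihilating_def by (auto intro!: borel_measurable_times)
qed

text \<open>Multiplication by this cosine shifts frequencies by the \<open>i\<close>-th unit vector in both directions.\<close>

lemma annihilating_cos:
  assumes f: "integrable torus f" and \<phi>: "annihilating f \<phi>"
  shows "annihilating f (\<lambda>x. cos (2 * pi * (x $ i - c)) * \<phi> x)"
proof -
  obtain B where B: "\<And>x. \<bar>\<phi> x\<bar> \<le> B" using annihilatingD(2)[OF \<phi>] by blast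
  have "bounded (range (\<lambda>x. cos (2 * pi * (x $ i - c)) * \<phi> x))"
    unfolding bounded_iff
  proof (intro exI ballI, elim imageE)
    fix y and x :: "real^3" assume "y = cos (2 * pi * (x $ i - c)) * \<phi> x"
    moreover have "\<bar>cos (2 * pi * (x $ i - c))\<bar> * \<bar>\<phi> x\<bar> \<le> 1 * B" by (intro mult_mono B) auto
    ultimately show "norm y \<le> B" by (simp add: abs_mult)
  qed
  moreover have "(\<lambda>x. cos (2 * pi * (x $ i - c)) * \<phi> x) \<in> borel_measurable borel"
  proof (rule borel_measurable_times)
    show "(\<lambda>x::real^3. cos (2 * pi * (x $ i - c))) \<in> borel_measurable borel"
      by (intro borel_measurable_continuous_onI continuous_intros)
  qed (use \<phi> in \<open>simp add: annihilating_def\<close>)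
  moreover have "(LINT x|torus. (cos (2 * pi * (x $ i - c)) * \<phi> x) *\<^sub>R (cis (2 * pi * (k \<bullet> x)) * f x)) = 0"
    if k: "k \<in> frequencies" for k
  proof -
    have kp: "k + axis i 1 \<in> frequencies" "k - axis i 1 \<in> frequencies"
      using k by (auto simp: frequencies_def axis_def)
    let ?F = "\<lambda>k x. \<phi> x *\<^sub>R (cis (2 * pi * (k \<bullet> x)) * f x)"
    have cosc: "complex_of_real (cos a) = (cis a + cis (- a)) / 2" for a by (simp add: complex_eq_iff)
    have c1: "cis (2 * pi * (x $ i - c)) * cis (2 * pi * (k \<bullet> x)) = cis (- (2 * pi * c)) * cis (2 * pi * ((k + axis i 1) \<bullet> x))"
      and c2: "cis (- (2 * pi * (x $ i - c))) * cis (2 * pi * (k \<bullet> x)) = cis (2 * pi * c) * cis (2 * pi * ((k - axis i 1) \<bullet> x))" for x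
      unfolding cis_mult by (simp_all add: inner_add_left inner_diff_left inner_axis' algebra_simps)
    have "(cos (2 * pi * (x $ i - c)) * \<phi> x) *\<^sub>R (cis (2 * pi * (k \<bullet> x)) * f x)
      = (cis (- (2 * pi * c)) / 2) * ?F (k + axis i 1) x + (cis (2 * pi * c) / 2) * ?F (k - axis i 1) x" for x
    proof -
      have "(cos (2 * pi * (x $ i - c)) * \<phi> x) *\<^sub>R (cis (2 * pi * (k \<bullet> x)) * f x)
        = of_real (\<phi> x) / 2 * (cis (2 * pi * (x $ i - c)) * cis (2 * pi * (k \<bullet> x)) + cis (- (2 * pi * (x $ i - c))) * cis (2 * pi * (k \<bullet> x))) * f x"
        by (simp only: scaleR_conv_of_real of_real_mult cosc) (simp add: algebra_simps)
      then show ?thesis unfolding c1 c2 by (simp add: scaleR_conv_of_real algebra_simps)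
    qed
    then have "(LINT x|torus. (cos (2 * pi * (x $ i - c)) * \<phi> x) *\<^sub>R (cis (2 * pi * (k \<bullet> x)) * f x))
      = (LINT x|torus. (cis (- (2 * pi * c)) / 2) * ?F (k + axis i 1) x + (cis (2 * pi * c) / 2) * ?F (k - axis i 1) x)"
      by (simp only:)
    also have "\<dots> = (LINT x|torus. (cis (- (2 * pi * c)) / 2) * ?F (k + axis i 1) x) + (LINT x|torus. (cis (2 * pi * c) / 2) * ?F (k - axis i 1) x)"
      by (rule Bochner_Integration.integral_add; rule integrable_mult_right; rule annihilating_integrable[OF f \<phi>])
    also have "\<dots> = 0"
      unfolding integral_mult_right_zero using annihilatingD(3)[OF \<phi>] kp by simp
    finally show ?thesis .
  qed
  ultimately show ?thesis by (simp add: annihilating_def)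
qed

lemma annihilating_polynomial:
  fixes p :: "real \<Rightarrow> real"
  assumes f: "integrable torus f" and p: "real_polynomial_function p"
  shows "annihilating f \<phi> \<Longrightarrow> annihilating f (\<lambda>x. p (cos (2 * pi * (x $ i - c))) * \<phi> x)"
  using p
proof (induction arbitrary: \<phi>)
  case (linear h)
  have "h y = h 1 * y" for y using linear(1) by (metis bounded_linear.linear linear_scale mult.commute mult.right_neutral real_scaleR_def)
  then have "h (cos (2 * pi * (x $ i - c))) * \<phi> x = h 1 * (cos (2 * pi * (x $ i - c)) * \<phi> x)" for x
    by (metis mult.assoc)
  then show ?case using annihilating_scale[OF annihilating_cos[OF f linear(2)]] by presburger
next
  case (const c)
  then show ?case by (rule annihilating_scale)
next
  case (add g h)
  then show ?case using annihilating_add[OF f] by (simp add: distrib_right)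
next
  case (mult g h)
  then show ?case by (simp add: mult.assoc)
qed

lemma annihilating_limit:
  assumes f: "integrable torus f" and \<phi>: "\<And>n. annihilating f (\<phi> n)"
    and B: "\<And>n x. \<bar>\<phi> n x\<bar> \<le> B" and lim: "\<And>x. (\<lambda>n. \<phi> n x) \<longlonglongrightarrow> \<psi> x"
  shows "annihilating f \<psi>"
proof -
  have m: "\<phi> n \<in> borel_measurable borel" for n by (rule annihilatingD(1)[OF \<phi>])
  have m': "\<psi> \<in> borel_measurable borel" by (rule borel_measurable_LIMSEQ_real[OF lim m])
  have B': "\<bar>\<psi> x\<bar> \<le> B" for x
    by (rule LIMSEQ_le_const2[OF tendsto_rabs[OF lim[of x]]]) (use B in auto)
  have "(LINT x|torus. \<psi> x *\<^sub>R (cis (2 * pi * (k \<bullet> x)) * f x)) = 0" if k: "k \<in> frequencies" for k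
  proof -
    have i: "integrable torus (\<lambda>x. cis (2 * pi * (k \<bullet> x)) * f x)" by (rule integrable_cis_mult[OF f])
    have "(\<lambda>n. LINT x|torus. \<phi> n x *\<^sub>R (cis (2 * pi * (k \<bullet> x)) * f x)) \<longlonglongrightarrow> (LINT x|torus. \<psi> x *\<^sub>R (cis (2 * pi * (k \<bullet> x)) * f x))"
    proof (rule integral_dominated_convergence[where w="\<lambda>x. B * norm (f x)"])
      show "(\<lambda>x. \<psi> x *\<^sub>R (cis (2 * pi * (k \<bullet> x)) * f x)) \<in> borel_measurable torus"
        "(\<lambda>x. \<phi> n x *\<^sub>R (cis (2 * pi * (k \<bullet> x)) * f x)) \<in> borel_measurable torus" for n
        by (intro borel_measurable_scaleR measurable_torus m m' borel_measurable_integrable[OF i])+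
      show "integrable torus (\<lambda>x. B * norm (f x))" using f by simp
      show "AE x in torus. (\<lambda>n. \<phi> n x *\<^sub>R (cis (2 * pi * (k \<bullet> x)) * f x)) \<longlonglongrightarrow> \<psi> x *\<^sub>R (cis (2 * pi * (k \<bullet> x)) * f x)"
        by (intro AE_I2 tendsto_scaleR lim tendsto_const)
      show "AE x in torus. norm (\<phi> n x *\<^sub>R (cis (2 * pi * (k \<bullet> x)) * f x)) \<le> B * norm (f x)" for n
        using B by (intro AE_I2) (simp add: norm_mult mult_right_mono)
    qed
    moreover have "(LINT x|torus. \<phi> n x *\<^sub>R (cis (2 * pi * (k \<bullet> x)) * f x)) = 0" for n
      by (rule annihilatingD(3)[OF \<phi> k])
    ultimately have "(\<lambda>n::nat. 0) \<longlonglongrightarrow> (LINT x|torus. \<psi> x *\<^sub>R (cis (2 * pi * (k \<bullet> x)) * f x))" by (simp only:)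
    then show ?thesis by (simp only: LIMSEQ_const_iff)
  qed
  moreover have "bounded (range \<psi>)" using B' by (auto simp: bounded_iff)
  ultimately show ?thesis using m' by (simp add: annihilating_def)
qed

text \<open>Weierstrass approximation of \<open>G\<close> by polynomials on the range of the cosine.\<close>

lemma annihilating_continuous:
  fixes G :: "real \<Rightarrow> real"
  assumes f: "integrable torus f" and G: "continuous_on {-1..1} G" and \<phi>: "annihilating f \<phi>"
  shows "annihilating f (\<lambda>x. G (cos (2 * pi * (x $ i - c))) * \<phi> x)"
proof -
  have "\<exists>p. real_polynomial_function p \<and> (\<forall>y\<in>{-1..1}. \<bar>G y - p y\<bar> < 1 / real (Suc n))" for n
    by (rule Stone_Weierstrass_real_polynomial_function[OF compact_Icc G, of "1 / real (Suc n)"]) auto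
  then obtain p where p: "\<And>n. real_polynomial_function (p n)"
    and pG: "\<And>n y. y \<in> {-1..1} \<Longrightarrow> \<bar>G y - p n y\<bar> < 1 / real (Suc n)" by metis
  have "\<exists>C. \<forall>y\<in>{-1..1}. \<bar>G y\<bar> \<le> C"
    using compact_imp_bounded[OF compact_continuous_image[OF G compact_Icc]] by (simp add: bounded_iff)
  then obtain C where C: "\<And>y. y \<in> {-1..1} \<Longrightarrow> \<bar>G y\<bar> \<le> C" by blast
  obtain B where B: "\<And>x. \<bar>\<phi> x\<bar> \<le> B" using annihilatingD(2)[OF \<phi>] by blast
  show ?thesis
  proof (rule annihilating_limit[OF f annihilating_polynomial[OF f p \<phi>], where B="(C + 1) * B"])
    fix n and x :: "real^3"
    let ?y = "cos (2 * pi * (x $ i - c))"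
    have y: "?y \<in> {-1..1}" by simp
    have "1 / real (Suc n) \<le> 1" by simp
    then have "\<bar>p n ?y\<bar> \<le> C + 1" using pG[OF y, of n] C[OF y] by linarith
    then show "\<bar>p n ?y * \<phi> x\<bar> \<le> (C + 1) * B" using B[of x] unfolding abs_mult by (intro mult_mono) auto
  next
    fix x :: "real^3"
    let ?y = "cos (2 * pi * (x $ i - c))"
    have y: "?y \<in> {-1..1}" by simp
    have "(\<lambda>n. G ?y - p n ?y) \<longlonglongrightarrow> 0"
      by (rule Lim_null_comparison[OF _ LIMSEQ_Suc[OF lim_1_over_n]]) (use less_imp_le[OF pG[OF y]] in \<open>auto intro!: always_eventually\<close>)
    from tendsto_diff[OF tendsto_const[of "G ?y"] this]
    have "(\<lambda>n. p n ?y) \<longlonglongrightarrow> G ?y" by simp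
    then show "(\<lambda>n. p n ?y * \<phi> x) \<longlonglongrightarrow> G ?y * \<phi> x" by (rule tendsto_mult[OF _ tendsto_const])
  qed
qed

text \<open>The indicator of the half-line above \<open>h\<close> is the limit of the continuous functions \<open>G n\<close>, which rise
linearly from 0 to 1 on an interval of length \<open>1/n\<close>.\<close>

lemma annihilating_arc:
  assumes f: "integrable torus f" and \<phi>: "annihilating f \<phi>"
  shows "annihilating f (\<lambda>x. indicator {x. h < cos (2 * pi * (x $ i - c))} x * \<phi> x)"
proof -
  obtain B where B: "\<And>x. \<bar>\<phi> x\<bar> \<le> B" using annihilatingD(2)[OF \<phi>] by blast
  define G where "G n y = min 1 (real n * max 0 (y - h))" for n y
  show ?thesis
  proof (rule annihilating_limit[OF f annihilating_continuous[OF f _ \<phi>], where B=B])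
    show "continuous_on {-1..1} (G n)" for n unfolding G_def by (intro continuous_intros)
    fix x :: "real^3"
    have "0 \<le> G n y" "G n y \<le> 1" for n y by (auto simp: G_def)
    then show "\<bar>G n (cos (2 * pi * (x $ i - c))) * \<phi> x\<bar> \<le> B" for n
      using mult_mono[of "G n (cos (2 * pi * (x $ i - c)))" 1 "\<bar>\<phi> x\<bar>" B] B[of x] by (simp add: abs_mult)
    have "(\<lambda>n. G n y) \<longlonglongrightarrow> (if h < y then 1 else 0)" for y
    proof (cases "h < y")
      case True
      obtain N where N: "1 / (y - h) < real N" using reals_Archimedean2 by blast
      have "G n y = 1" if "n \<ge> N" for n
      proof -
        have "1 < real N * (y - h)" using N True by (simp add: field_simps)
        also have "\<dots> \<le> real n * (y - h)" using that True by (intro mult_right_mono) auto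
        finally show ?thesis using True by (simp add: G_def)
      qed
      then have "\<forall>\<^sub>F n in sequentially. G n y = 1" unfolding eventually_sequentially by blast
      then show ?thesis using True by (simp add: tendsto_eventually)
    next
      case False then show ?thesis by (simp add: G_def)
    qed
    then have "(\<lambda>n. G n (cos (2 * pi * (x $ i - c))) * \<phi> x) \<longlonglongrightarrow> (if h < cos (2 * pi * (x $ i - c)) then 1 else 0) * \<phi> x"
      by (intro tendsto_mult) auto
    moreover have "indicator {x. h < cos (2 * pi * (x $ i - c))} x = (if h < cos (2 * pi * (x $ i - c)) then 1 else 0 :: real)"
      by (simp add: indicator_def)
    ultimately show "(\<lambda>n. G n (cos (2 * pi * (x $ i - c))) * \<phi> x) \<longlonglongrightarrow> indicator {x. h < cos (2 * pi * (x $ i - c))} x * \<phi> x"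
      by (simp only:)
  qed
qed

text \<open>An interval is the superlevel set of a cosine centred at its midpoint; the bounds on \<open>a\<close> and \<open>b\<close> keep
the periodic copies of the interval outside the unit interval.\<close>

lemma arc_iff_interval:
  assumes ab: "0 \<le> a" "a < b" "b \<le> 1" and x: "0 < x" "x < 1"
  shows "cos (pi * (b - a)) < cos (2 * pi * (x - (a + b) / 2)) \<longleftrightarrow> a < x \<and> x < b"
proof -
  define d where "d = \<bar>x - (a + b) / 2\<bar>"
  define r where "r = (b - a) / 2"
  have dr: "d \<le> 1 - r" "0 \<le> d" "0 < r" "r \<le> 1/2" using ab x by (auto simp: d_def r_def field_simps)
  have eq: "a < x \<and> x < b \<longleftrightarrow> d < r" by (auto simp: d_def r_def abs_less_iff field_simps)
  have 1: "cos (2 * pi * (x - (a + b) / 2)) = cos (2 * pi * d)"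
    using cos_abs_real[of "2 * pi * (x - (a + b) / 2)"] by (simp add: d_def abs_mult)
  have 2: "cos (pi * (b - a)) = cos (2 * pi * r)"
  proof -
    have "2 * pi * r = pi * (b - a)" by (simp add: r_def)
    then show ?thesis by (simp only:)
  qed
  show ?thesis
  proof (cases "d \<le> 1/2")
    case True
    then have "2 * pi * d \<le> pi" "2 * pi * r \<le> pi" using dr by (auto simp: field_simps)
    then have "cos (2 * pi * r) < cos (2 * pi * d) \<longleftrightarrow> 2 * pi * d < 2 * pi * r"
      using dr by (intro cos_mono_less_eq) auto
    then show ?thesis by (simp add: 1 2 eq)
  next
    case False
    have "cos (2 * pi * d) = cos (2 * pi - 2 * pi * d)" by (simp add: cos_diff)
    also have "\<dots> = cos (2 * pi * (1 - d))" by (simp add: algebra_simps)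
    finally have 3: "cos (2 * pi * d) = cos (2 * pi * (1 - d))" .
    have "2 * pi * (1 - d) \<le> pi" "2 * pi * r \<le> pi" using dr False by (auto simp: field_simps)
    then have "cos (2 * pi * r) < cos (2 * pi * (1 - d)) \<longleftrightarrow> 2 * pi * (1 - d) < 2 * pi * r"
      using dr by (intro cos_mono_less_eq) auto
    then show ?thesis using dr False by (simp add: 1 2 3 eq)
  qed
qed

text \<open>A box inside the unit cube is, up to a null set, a product of three arcs, so its indicator is an
annihilating multiplier, and the frequency 0 shows that \<open>f\<close> has integral zero over it.\<close>

theorem fourier_uniqueness:
  fixes f :: "real^3 \<Rightarrow> complex"
  assumes f: "integrable torus f"
    and z: "\<And>k. k \<in> frequencies \<Longrightarrow> (LINT x|torus. cis (2 * pi * (k \<bullet> x)) * f x) = 0"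
  shows "AE x in torus. f x = 0"
proof -
  have one: "annihilating f (\<lambda>x. 1)" using z by (simp add: annihilating_def)
  have null: "AE x in torus. x \<in> box 0 1"
    by (rule AE_I'[of "cbox 0 1 - box 0 1"])
      (auto simp: null_sets_restrict_space negligible_frontier_interval negligible_iff_null_sets[symmetric])
  have boxz: "(LINT x|torus. indicator (box c d) x *\<^sub>R f x) = 0" for c d
  proof -
    define a where "a i = max 0 (c $ i)" for i
    define b where "b i = min 1 (d $ i)" for i
    have in_box: "x \<in> box c d \<longleftrightarrow> (\<forall>i. a i < x $ i \<and> x $ i < b i)" if "x \<in> box 0 1" for x
      using that by (auto simp: mem_box_cart a_def b_def)
    show ?thesis
    proof (cases "\<forall>i. a i < b i")
      case False
      have "AE x in torus. indicator (box c d) x *\<^sub>R f x = 0"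
        using null
      proof eventually_elim
        case (elim x)
        then have "x \<notin> box c d" using in_box[OF elim] False less_trans by blast
        then show ?case by simp
      qed
      then show ?thesis by (rule integral_eq_zero_AE)
    next
      case True
      have ab: "0 \<le> a i" "a i < b i" "b i \<le> 1" for i using True by (auto simp: a_def b_def)
      let ?A = "\<lambda>i. {x :: real^3. cos (pi * (b i - a i)) < cos (2 * pi * (x $ i - (a i + b i) / 2))}"
      have "annihilating f (\<lambda>x. indicator (?A 1) x * (indicator (?A 2) x * (indicator (?A 3) x * 1)))"
        by (intro annihilating_arc f one)
      then have "(LINT x|torus. (indicator (?A 1) x * (indicator (?A 2) x * (indicator (?A 3) x * 1))) *\<^sub>R (cis (2 * pi * (0 \<bullet> x)) * f x)) = 0"
        by (rule annihilatingD(3)) (simp add: frequencies_def)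
      also have "(LINT x|torus. (indicator (?A 1) x * (indicator (?A 2) x * (indicator (?A 3) x * 1))) *\<^sub>R (cis (2 * pi * (0 \<bullet> x)) * f x))
        = (LINT x|torus. indicator (box c d) x *\<^sub>R f x)"
      proof (rule integral_cong_AE)
        show "AE x in torus. (indicator (?A 1) x * (indicator (?A 2) x * (indicator (?A 3) x * 1))) *\<^sub>R (cis (2 * pi * (0 \<bullet> x)) * f x) = indicator (box c d) x *\<^sub>R f x"
          using null
        proof eventually_elim
          case (elim x)
          then have "x \<in> ?A i \<longleftrightarrow> a i < x $ i \<and> x $ i < b i" for i
            using arc_iff_interval[OF ab[of i], of "x $ i"] by (simp add: mem_box_cart)
          then show ?case using in_box[OF elim] by (auto simp: indicator_def forall_3)
        qed
        show "(\<lambda>x. indicator (box c d) x *\<^sub>R f x) \<in> borel_measurable torus"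
          by (rule borel_measurable_scaleR[OF measurable_torus borel_measurable_integrable[OF f]]) simp
        show "(\<lambda>x. (indicator (?A 1) x * (indicator (?A 2) x * (indicator (?A 3) x * 1))) *\<^sub>R (cis (2 * pi * (0 \<bullet> x)) * f x)) \<in> borel_measurable torus"
          using annihilating_integrable[OF f \<open>annihilating f (\<lambda>x. indicator (?A 1) x * (indicator (?A 2) x * (indicator (?A 3) x * 1)))\<close>, of 0] by (rule borel_measurable_integrable)
      qed
      finally show ?thesis by simp
    qed
  qed
  have real: "AE x in torus. g x = 0" if g: "integrable torus g" and gz: "\<And>c d. (LINT x|torus. indicator (box c d) x *\<^sub>R g x) = 0" for g :: "real^3 \<Rightarrow> real"
  proof -
    define F where "F x = indicator (cbox 0 1) x *\<^sub>R g x" for x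
    have "integrable lebesgue F" unfolding F_def
      using g by (simp add: integrable_restrict_space)
    moreover have "(LINT x:box c d|lebesgue. F x) = 0" for c d
    proof -
      have "(LINT x:box c d|lebesgue. F x) = (LINT x|lebesgue. indicator (cbox 0 1) x *\<^sub>R (indicator (box c d) x *\<^sub>R g x))"
        unfolding set_lebesgue_integral_def F_def by (simp add: mult.left_commute)
      also have "\<dots> = (LINT x|torus. indicator (box c d) x *\<^sub>R g x)"
        by (simp add: integral_restrict_space)
      finally show ?thesis using gz by simp
    qed
    ultimately have "AE x in lebesgue. F x = 0" by (rule AE_zero_if_box_integrals_zero)
    then show ?thesis unfolding F_def by (auto simp: AE_restrict_space_iff elim: AE_mp)
  qed
  have bi: "integrable torus (\<lambda>x. indicator (box c d) x *\<^sub>R f x)" for c d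
    by (rule integrable_bounded_mult[OF measurable_torus _ f]) (auto simp: bounded_iff indicator_def intro!: exI[of _ 1])
  have "AE x in torus. Re (f x) = 0"
  proof (rule real)
    show "(LINT x|torus. indicator (box c d) x *\<^sub>R Re (f x)) = 0" for c d
      using integral_Re[OF bi[of c d]] boxz[of c d] by simp
  qed (use f in simp)
  moreover have "AE x in torus. Im (f x) = 0"
  proof (rule real)
    show "(LINT x|torus. indicator (box c d) x *\<^sub>R Im (f x)) = 0" for c d
      using integral_Im[OF bi[of c d]] boxz[of c d] by simp
  qed (use f in simp)
  ultimately show ?thesis by eventually_elim (simp add: complex_eq_iff)
qed

section \<open>Trigonometric polynomials and Bernstein's inequality\<close>

abbreviation pd :: "3 \<Rightarrow> (real^3 \<Rightarrow> real) \<Rightarrow> real^3 \<Rightarrow> real" where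
  "pd i \<equiv> dir_deriv (axis i 1)"

lemma periodic_pd:
  assumes \<phi>: "smooth \<phi>" "periodic \<phi>"
  shows "periodic (pd i \<phi>)"
proof -
  have "pd i \<phi> (x + axis j 1) = pd i \<phi> x" for x j
  proof -
    have "((\<lambda>y. y + axis j 1) has_derivative (\<lambda>h. h)) (at x)"
      using has_derivative_add[OF has_derivative_ident has_derivative_const[of "axis j (1::real)"]] by simp
    from has_derivative_compose[OF this smooth_has_derivative[OF \<phi>(1)]]
    have "((\<lambda>y. \<phi> (y + axis j 1)) has_derivative frechet_derivative \<phi> (at (x + axis j 1))) (at x)" .
    moreover have "(\<lambda>y. \<phi> (y + axis j 1)) = \<phi>" using \<phi>(2) by (auto simp: periodic_def)
    ultimately show ?thesis using dir_deriv_eqI[of \<phi> _ x] by (simp add: dir_deriv_def[of _ \<phi> "x + axis j 1"])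
  qed
  then show ?thesis by (simp add: periodic_def)
qed

lemma smooth_pd: "smooth \<phi> \<Longrightarrow> smooth (pd i \<phi>)"
  by (rule smooth_dir_deriv) (simp_all add: axis_in_Basis_iff)

lemma smooth_measurable_torus: "smooth (\<phi> :: real^3 \<Rightarrow> real) \<Longrightarrow> \<phi> \<in> borel_measurable torus"
  by (intro measurable_torus borel_measurable_continuous_onI smooth_imp_continuous)

lemma smooth_bounded_cube:
  fixes \<phi> :: "real^3 \<Rightarrow> real"
  assumes "smooth \<phi>"
  obtains K where "0 \<le> K" "\<And>x. x \<in> cbox 0 1 \<Longrightarrow> \<bar>\<phi> x\<bar> \<le> K"
proof -
  have "bounded (\<phi> ` cbox 0 1)"
    by (intro compact_imp_bounded compact_continuous_image smooth_imp_continuous assms compact_cbox)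
  then obtain K where K: "\<forall>x\<in>cbox 0 1. \<bar>\<phi> x\<bar> \<le> K" by (auto simp: bounded_iff)
  show ?thesis by (rule that[of "max 0 K"]) (use K in \<open>auto intro: order_trans\<close>)
qed

lemma integrable_mult_smooth:
  fixes \<phi> :: "real^3 \<Rightarrow> real"
  assumes g: "integrable torus g" and \<phi>: "smooth \<phi>"
  shows "integrable torus (\<lambda>x. g x * \<phi> x)"
proof -
  obtain K where K: "0 \<le> K" "\<And>x. x \<in> cbox 0 1 \<Longrightarrow> \<bar>\<phi> x\<bar> \<le> K" using smooth_bounded_cube[OF \<phi>] by blast
  show ?thesis
  proof (rule Bochner_Integration.integrable_bound)
    show "integrable torus (\<lambda>x. g x * K)" using g by simp
    show "(\<lambda>x. g x * \<phi> x) \<in> borel_measurable torus"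
      by (rule borel_measurable_times[OF borel_measurable_integrable[OF g] smooth_measurable_torus[OF \<phi>]])
    show "AE x in torus. norm (g x * \<phi> x) \<le> norm (g x * K)"
      using K by (intro AE_I2) (simp add: abs_mult mult_left_mono)
  qed
qed

lemma integrable_smooth_scaleR:
  fixes h :: "real^3 \<Rightarrow> real" and F :: "real^3 \<Rightarrow> real^3"
  assumes h: "smooth h" and F: "integrable torus F"
  shows "integrable torus (\<lambda>x. h x *\<^sub>R F x)"
proof -
  obtain B where B: "\<And>x. x \<in> cbox 0 1 \<Longrightarrow> \<bar>h x\<bar> \<le> B" using smooth_bounded_cube[OF h] by blast
  show ?thesis
  proof (rule Bochner_Integration.integrable_bound)
    show "integrable torus (\<lambda>x. B *\<^sub>R norm (F x))" using F by simp
    show "(\<lambda>x. h x *\<^sub>R F x) \<in> borel_measurable torus"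
      by (rule borel_measurable_scaleR[OF smooth_measurable_torus[OF h] borel_measurable_integrable[OF F]])
    show "AE x in torus. norm (h x *\<^sub>R F x) \<le> norm (B *\<^sub>R norm (F x))"
    proof (intro AE_I2)
      fix x assume "x \<in> space torus"
      then have "norm (h x *\<^sub>R F x) \<le> B * norm (F x)" using B by (simp add: mult_right_mono)
      then show "norm (h x *\<^sub>R F x) \<le> norm (B *\<^sub>R norm (F x))" by simp
    qed
  qed
qed

text \<open>Real plane waves with a phase: differentiation is a shift of the phase by \<open>pi/2\<close>, and the phases 0
and \<open>pi/2\<close> span all waves of a given frequency.\<close>

definition wave :: "real^3 \<Rightarrow> real \<Rightarrow> real^3 \<Rightarrow> real" where
  "wave k c x = cos (2 * pi * (k \<bullet> x) + c)"

definition trig_coeff :: "(real^3 \<Rightarrow> real) \<Rightarrow> real^3 \<Rightarrow> real \<Rightarrow> real" where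
  "trig_coeff g k c = (LINT x|torus. g x * wave k c x)"

text \<open>The cube contains the ball of radius \<open>3/2 \<cdot> 2 ^ j\<close> outside which the \<open>j\<close>-th dyadic multiplier vanishes.\<close>

definition low_freq :: "nat \<Rightarrow> (real^3) set" where
  "low_freq j = {k \<in> frequencies. \<forall>i. \<bar>k $ i\<bar> \<le> 2 ^ (j + 1)}"

text \<open>The real part of the Littlewood-Paley sum of \<open>g\<close> up to level \<open>J\<close> (see \<open>lp_sum_eq_Re\<close>). The sum itself need not be real,
because the cut-off \<open>\<theta>\<close> need not be even.\<close>

definition lp_sum :: "(real^3 \<Rightarrow> real) \<Rightarrow> nat \<Rightarrow> (real^3 \<Rightarrow> real) \<Rightarrow> real^3 \<Rightarrow> real" where
  "lp_sum \<theta> J g x =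
     (\<Sum>k\<in>low_freq J. \<Sum>c\<in>{0, pi/2}. (\<theta> (k /\<^sub>R 2 ^ J) * trig_coeff g k c) * wave k c x)"

definition trig_poly :: "(real^3) set \<Rightarrow> (real^3 \<Rightarrow> complex) \<Rightarrow> real^3 \<Rightarrow> complex" where
  "trig_poly F c x = (\<Sum>k\<in>F. c k * cis (2 * pi * (k \<bullet> x)))"

lemma smooth_wave: "smooth (wave k c)"
proof -
  have "wave k c = (\<lambda>x. cos ((2 * pi) *\<^sub>R k \<bullet> x + c))" by (auto simp: wave_def)
  then show ?thesis using smooth_cos by metis
qed

lemma dir_deriv_wave: "pd i (wave k c) x = (2 * pi * k $ i) * wave k (c + pi/2) x"
proof -
  have "(wave k c has_derivative (\<lambda>h. (2 * pi * (k \<bullet> h)) * wave k (c + pi/2) x)) (at x)"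
    unfolding wave_def by (auto intro!: derivative_eq_intros ext simp: cos_add sin_add algebra_simps)
  from dir_deriv_eqI[OF this] show ?thesis by (simp add: inner_axis)
qed

lemma periodic_wave: "k \<in> frequencies \<Longrightarrow> periodic (wave k c)"
proof -
  assume k: "k \<in> frequencies"
  have "wave k c (x + axis i 1) = wave k c x" for x i
  proof -
    have e: "2 * pi * (k \<bullet> (x + axis i 1)) + c = (2 * pi * (k \<bullet> x) + c) + 2 * pi * (k $ i)"
      by (simp add: inner_add_right inner_axis algebra_simps)
    have "k $ i \<in> \<int>" using k by (simp add: frequencies_def)
    then have "cos (2 * pi * (k $ i)) = 1" "sin (2 * pi * (k $ i)) = 0"
      by (auto intro: cos_integer_2pi sin_integer_2pi)
    then have "cos ((2 * pi * (k \<bullet> x) + c) + 2 * pi * (k $ i)) = cos (2 * pi * (k \<bullet> x) + c)"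
      unfolding cos_add[of "2 * pi * (k \<bullet> x) + c" "2 * pi * (k $ i)"] by simp
    then show ?thesis unfolding wave_def e .
  qed
  then show ?thesis by (simp add: periodic_def)
qed

lemma wave_add_pi: "wave k (c + pi) x = - wave k c x"
  unfolding wave_def by (metis add.assoc cos_periodic_pi)

lemma dir_deriv_sum:
  fixes f :: "'i \<Rightarrow> 'a::euclidean_space \<Rightarrow> 'b::real_normed_vector"
  assumes "\<And>i. i \<in> I \<Longrightarrow> smooth (f i)"
  shows "dir_deriv b (\<lambda>x. \<Sum>i\<in>I. f i x) x = (\<Sum>i\<in>I. dir_deriv b (f i) x)"
  unfolding dir_deriv_def[of b "f i" for i]
  by (rule dir_deriv_eqI[OF has_derivative_sum]) (rule smooth_has_derivative[OF assms])

lemma dir_deriv_scale: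
  fixes f :: "'a::euclidean_space \<Rightarrow> real"
  assumes "smooth f"
  shows "dir_deriv b (\<lambda>x. r * f x) x = r * dir_deriv b f x"
  unfolding dir_deriv_def[of b f]
  by (rule dir_deriv_eqI[OF has_derivative_mult_right]) (rule smooth_has_derivative[OF assms])

lemma smooth_lp_sum: "smooth (lp_sum \<theta> J g)"
  unfolding lp_sum_def[abs_def]
  by (rule smooth_sum, rule smooth_sum, rule smooth_mult[OF smooth_const smooth_wave])

lemma dir_deriv_lp_sum:
  "pd i (lp_sum \<theta> J g) x =
     (\<Sum>k\<in>low_freq J. \<Sum>c\<in>{0, pi/2}. (\<theta> (k /\<^sub>R 2 ^ J) * trig_coeff g k c) * (2 * pi * k $ i * wave k (c + pi/2) x))"
proof -
  have s1: "smooth (\<lambda>x. a * wave k c x)" for a k c by (rule smooth_mult[OF smooth_const smooth_wave])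
  have s2: "smooth (\<lambda>x. \<Sum>c\<in>C. a c * wave k c x)" for a k C by (rule smooth_sum, rule s1)
  show ?thesis
    unfolding lp_sum_def[abs_def] dir_deriv_sum[OF s2] dir_deriv_sum[OF s1] dir_deriv_scale[OF smooth_wave] dir_deriv_wave ..
qed

lemma periodic_lp_sum: "periodic (lp_sum \<theta> J g)"
proof -
  have "wave k c (x + axis i 1) = wave k c x" if "k \<in> low_freq J" for k c x i
    using periodic_wave[of k c] that unfolding low_freq_def periodic_def by blast
  then show ?thesis unfolding periodic_def lp_sum_def
    by (intro allI sum.cong refl) (simp only:)
qed

lemma finite_low_freq: "finite (low_freq j)"
proof -
  let ?S = "{r \<in> \<int>. \<bar>r\<bar> \<le> (2::real) ^ (j + 1)}"
  have "finite (vec_lambda ` (PiE (UNIV :: 3 set) (\<lambda>_. ?S)) :: (real^3) set)"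
    by (intro finite_imageI finite_PiE finite_abs_int_segment) simp
  moreover have "low_freq j \<subseteq> vec_lambda ` (PiE (UNIV :: 3 set) (\<lambda>_. ?S))"
  proof
    fix k assume "k \<in> low_freq j"
    then have "(\<lambda>i. k $ i) \<in> PiE (UNIV :: 3 set) (\<lambda>_. ?S)" by (auto simp: low_freq_def frequencies_def)
    then show "k \<in> vec_lambda ` (PiE (UNIV :: 3 set) (\<lambda>_. ?S))"
      by (rule image_eqI[rotated]) (rule vec_lambda_eta[symmetric])
  qed
  ultimately show ?thesis by (rule finite_subset[rotated])
qed

lemma low_freq_mono: "j \<le> J \<Longrightarrow> low_freq j \<subseteq> low_freq J"
proof -
  assume "j \<le> J"
  then have "(2::real) ^ (j + 1) \<le> 2 ^ (J + 1)" by (intro power_increasing) auto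
  then show ?thesis unfolding low_freq_def subset_iff mem_Collect_eq by (meson order_trans)
qed

lemma continuous_trig_poly: "continuous_on S (trig_poly F c)"
  unfolding trig_poly_def[abs_def] by (intro continuous_intros)

lemma periodic_trig_poly:
  assumes "F \<subseteq> frequencies" shows "periodic (trig_poly F c)"
proof -
  have "cis (2 * pi * (k \<bullet> (x + axis i 1))) = cis (2 * pi * (k \<bullet> x))" if "k \<in> F" for k x i
    using periodic_cis[of k] assms that unfolding periodic_def by blast
  then show ?thesis unfolding periodic_def trig_poly_def
    by (intro allI sum.cong refl) (simp only:)
qed

lemma fourier_coeff_trig_poly:
  assumes F: "finite F" "F \<subseteq> frequencies" and m: "m \<in> frequencies"
  shows "(LINT x|torus. cis (2 * pi * ((- m) \<bullet> x)) * trig_poly F c x) = (if m \<in> F then c m else 0)"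
proof -
  have "cis (2 * pi * ((- m) \<bullet> x)) * trig_poly F c x = (\<Sum>k\<in>F. c k * cis (2 * pi * ((k - m) \<bullet> x)))" for x
    unfolding trig_poly_def sum_distrib_left
    by (intro sum.cong refl) (simp add: cis_mult inner_diff_left algebra_simps)
  then have "(LINT x|torus. cis (2 * pi * ((- m) \<bullet> x)) * trig_poly F c x)
    = (\<Sum>k\<in>F. LINT x|torus. c k * cis (2 * pi * ((k - m) \<bullet> x)))"
    by (simp only:) (rule Bochner_Integration.integral_sum, intro continuous_integrable_torus continuous_intros)
  also have "\<dots> = (\<Sum>k\<in>F. c k * (if k - m = 0 then 1 else 0))"
  proof (intro sum.cong refl)
    fix k assume "k \<in> F"
    then have "k - m \<in> frequencies" using F m by (auto simp: frequencies_def)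
    then show "(LINT x|torus. c k * cis (2 * pi * ((k - m) \<bullet> x))) = c k * (if k - m = 0 then 1 else 0)"
      by (simp only: integral_mult_right_zero integral_cis)
  qed
  also have "\<dots> = (\<Sum>k\<in>F. if k = m then c k else 0)" by (intro sum.cong) auto
  finally show ?thesis using F by simp
qed

text \<open>By \<open>bernstein_weights\<close> the derivative is a combination of \<open>4N\<close> translates with total weight at most
\<open>2\<pi> \<cdot> 2N\<close>; translations preserve the \<open>L\<^sup>3\<close> norm.\<close>

lemma bernstein_L3:
  assumes F: "finite F" "F \<subseteq> frequencies" "\<And>k. k \<in> F \<Longrightarrow> \<bar>k $ i\<bar> \<le> real N" and N: "N > 0"
  shows "(LINT x|torus. norm (trig_poly F (\<lambda>k. (2 * pi * k $ i) * \<i> * c k) x) ^ 3)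
    \<le> (4 * pi * real N) ^ 3 * (LINT x|torus. norm (trig_poly F c x) ^ 3)"
proof -
  obtain \<alpha> where \<alpha>: "\<And>m::int. \<bar>m\<bar> \<le> int N \<Longrightarrow> (\<Sum>q<4*N. \<alpha> q * cis (2 * pi * of_int m * real q / real (4*N))) = of_int m"
    and \<alpha>N: "(\<Sum>q<4*N. norm (\<alpha> q)) \<le> 2 * real N"
    using bernstein_weights[OF N] by blast
  let ?g = "trig_poly F c"
  define G where "G q x = ?g (x + (real q / real (4 * N)) *\<^sub>R axis i 1)" for q x
  have contG: "continuous_on UNIV (G q)" for q
    unfolding G_def by (intro continuous_on_compose2[OF continuous_trig_poly[of UNIV]] continuous_intros) auto
  have rep: "trig_poly F (\<lambda>k. (2 * pi * k $ i) * \<i> * c k) x = (2 * pi * \<i>) * (\<Sum>q<4*N. \<alpha> q * G q x)" for x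
  proof -
    have "(\<Sum>q<4*N. \<alpha> q * G q x) = (\<Sum>k\<in>F. c k * cis (2 * pi * (k \<bullet> x)) * (\<Sum>q<4*N. \<alpha> q * cis (2 * pi * k $ i * real q / real (4*N))))"
    proof -
      have "\<alpha> q * G q x = (\<Sum>k\<in>F. c k * cis (2 * pi * (k \<bullet> x)) * (\<alpha> q * cis (2 * pi * k $ i * real q / real (4*N))))" for q
      proof -
        have "cis (2 * pi * (k \<bullet> (x + (real q / real (4 * N)) *\<^sub>R axis i 1))) = cis (2 * pi * (k \<bullet> x)) * cis (2 * pi * k $ i * real q / real (4*N))" for k
        proof -
          have "2 * pi * (k \<bullet> (x + (real q / real (4 * N)) *\<^sub>R axis i 1)) = 2 * pi * (k \<bullet> x) + 2 * pi * k $ i * real q / real (4*N)"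
            by (simp add: inner_add_right inner_axis distrib_left)
          then show ?thesis by (simp only: cis_mult)
        qed
        then show ?thesis by (simp add: G_def trig_poly_def sum_distrib_left mult_ac)
      qed
      then have "(\<Sum>q<4*N. \<alpha> q * G q x) = (\<Sum>q<4*N. \<Sum>k\<in>F. c k * cis (2 * pi * (k \<bullet> x)) * (\<alpha> q * cis (2 * pi * k $ i * real q / real (4*N))))"
        by (simp only:)
      also have "\<dots> = (\<Sum>k\<in>F. \<Sum>q<4*N. c k * cis (2 * pi * (k \<bullet> x)) * (\<alpha> q * cis (2 * pi * k $ i * real q / real (4*N))))"
        by (rule sum.swap)
      finally show ?thesis by (simp only: sum_distrib_left)
    qed
    also have "\<dots> = (\<Sum>k\<in>F. c k * cis (2 * pi * (k \<bullet> x)) * of_real (k $ i))"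
    proof (intro sum.cong refl)
      fix k assume k: "k \<in> F"
      then have "k $ i \<in> \<int>" using F by (auto simp: frequencies_def)
      then obtain m where m: "k $ i = of_int m" by (auto elim: Ints_cases)
      then have "\<bar>m\<bar> \<le> int N" using F(3)[OF k] by linarith
      from \<alpha>[OF this] show "c k * cis (2 * pi * (k \<bullet> x)) * (\<Sum>q<4*N. \<alpha> q * cis (2 * pi * k $ i * real q / real (4*N)))
         = c k * cis (2 * pi * (k \<bullet> x)) * of_real (k $ i)" by (simp only: m) simp
    qed
    finally show ?thesis by (simp add: trig_poly_def sum_distrib_left mult_ac)
  qed
  let ?I = "LINT x|torus. norm (?g x) ^ 3"
  have I0: "0 \<le> ?I" by simp
  have Gi: "integrable torus (\<lambda>x. norm (G q x) ^ 3)" for q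
    by (intro continuous_integrable_torus continuous_intros contG)
  have GI: "(LINT x|torus. norm (G q x) ^ 3) = ?I" if "q < 4 * N" for q
    unfolding G_def
  proof (rule torus_shift[of "\<lambda>x. norm (?g x) ^ 3"])
    show "continuous_on UNIV (\<lambda>x. norm (?g x) ^ 3)" by (intro continuous_intros continuous_trig_poly)
    show "periodic (\<lambda>x. norm (?g x) ^ 3)" using periodic_trig_poly[OF F(2), of c] by (simp add: periodic_def)
  qed (use that in auto)
  define S where "S = (\<Sum>q<4*N. norm (\<alpha> q))"
  have S: "0 \<le> S" "S \<le> 2 * real N" using \<alpha>N by (auto simp: S_def sum_nonneg)
  have pw: "norm (trig_poly F (\<lambda>k. (2 * pi * k $ i) * \<i> * c k) x) ^ 3 \<le> (2 * pi) ^ 3 * (S\<^sup>2 * (\<Sum>q<4*N. norm (\<alpha> q) * norm (G q x) ^ 3))" for x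
  proof -
    have "norm (\<Sum>q<4*N. \<alpha> q * G q x) \<le> (\<Sum>q<4*N. norm (\<alpha> q) * norm (G q x))"
      by (rule order_trans[OF norm_sum]) (simp add: norm_mult)
    then have "norm (\<Sum>q<4*N. \<alpha> q * G q x) ^ 3 \<le> (\<Sum>q<4*N. norm (\<alpha> q) * norm (G q x)) ^ 3"
      by (intro power_mono) auto
    also have "\<dots> \<le> S\<^sup>2 * (\<Sum>q<4*N. norm (\<alpha> q) * norm (G q x) ^ 3)"
      unfolding S_def by (rule sum_cube_jensen) auto
    finally have "(2 * pi) ^ 3 * norm (\<Sum>q<4*N. \<alpha> q * G q x) ^ 3 \<le> (2 * pi) ^ 3 * (S\<^sup>2 * (\<Sum>q<4*N. norm (\<alpha> q) * norm (G q x) ^ 3))"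
      by (rule mult_left_mono) simp
    moreover have "norm (trig_poly F (\<lambda>k. (2 * pi * k $ i) * \<i> * c k) x) = (2 * pi) * norm (\<Sum>q<4*N. \<alpha> q * G q x)"
      unfolding rep by (simp add: norm_mult)
    ultimately show ?thesis by (simp only: power_mult_distrib)
  qed
  have "(LINT x|torus. norm (trig_poly F (\<lambda>k. (2 * pi * k $ i) * \<i> * c k) x) ^ 3)
    \<le> (LINT x|torus. (2 * pi) ^ 3 * (S\<^sup>2 * (\<Sum>q<4*N. norm (\<alpha> q) * norm (G q x) ^ 3)))"
  proof (rule integral_mono)
    show "integrable torus (\<lambda>x. norm (trig_poly F (\<lambda>k. (2 * pi * k $ i) * \<i> * c k) x) ^ 3)"
      by (intro continuous_integrable_torus continuous_intros continuous_trig_poly)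
    show "integrable torus (\<lambda>x. (2 * pi) ^ 3 * (S\<^sup>2 * (\<Sum>q<4*N. norm (\<alpha> q) * norm (G q x) ^ 3)))"
      by (intro continuous_integrable_torus continuous_intros contG)
  qed (rule pw)
  also have "\<dots> = (2 * pi) ^ 3 * (S\<^sup>2 * (\<Sum>q<4*N. norm (\<alpha> q) * (LINT x|torus. norm (G q x) ^ 3)))"
  proof -
    have "(LINT x|torus. (\<Sum>q<4*N. norm (\<alpha> q) * norm (G q x) ^ 3)) = (\<Sum>q<4*N. LINT x|torus. norm (\<alpha> q) * norm (G q x) ^ 3)"
      by (rule Bochner_Integration.integral_sum, rule integrable_mult_right, rule Gi)
    then show ?thesis by (simp only: integral_mult_right_zero)
  qed
  also have "\<dots> = (2 * pi) ^ 3 * (S\<^sup>2 * (S * ?I))"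
  proof -
    have "(\<Sum>q<4*N. norm (\<alpha> q) * (LINT x|torus. norm (G q x) ^ 3)) = (\<Sum>q<4*N. norm (\<alpha> q) * ?I)"
      by (rule sum.cong[OF refl]) (simp only: GI lessThan_iff)
    then show ?thesis by (simp only: S_def sum_distrib_right)
  qed
  also have "\<dots> = (2 * pi) ^ 3 * S ^ 3 * ?I" by (simp add: power2_eq_square power3_eq_cube)
  also have "\<dots> \<le> (2 * pi) ^ 3 * (2 * real N) ^ 3 * ?I"
    using S I0 by (intro mult_right_mono mult_left_mono power_mono) auto
  also have "(2 * pi) ^ 3 * (2 * real N) ^ 3 = (4 * pi * real N) ^ 3"
  proof -
    have "(2 * pi) * (2 * real N) = 4 * pi * real N" by simp
    then show ?thesis using power_mult_distrib[of "2 * pi" "2 * real N" 3] by (simp only:)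
  qed
  finally show ?thesis .
qed

section \<open>Fourier coefficients and Littlewood-Paley sums\<close>

text \<open>The Fourier coefficient of a real function: its imaginary part is an integral against \<open>- sin\<close>, which is the
cosine with phase \<open>pi/2\<close>.\<close>

definition complex_coeff :: "(real^3 \<Rightarrow> real) \<Rightarrow> real^3 \<Rightarrow> complex" where
  "complex_coeff g k = Complex (trig_coeff g k 0) (trig_coeff g k (pi/2))"

lemma integrable_vec_nth: "integrable M f \<Longrightarrow> integrable M (\<lambda>x. f x $ l)"
  for f :: "'a \<Rightarrow> real^3"
  by (rule integrable_bounded_linear[OF bounded_linear_vec_nth])

lemma integral_vec_nth: "integrable M f \<Longrightarrow> (LINT x|M. f x $ l) = (LINT x|M. f x) $ l"
  for f :: "'a \<Rightarrow> real^3"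
  by (rule integral_bounded_linear[OF bounded_linear_vec_nth])

lemma Lp_space_1_integrable: "f \<in> Lp_space 1 \<Longrightarrow> integrable torus f"
  unfolding Lp_space_def by (auto simp: integrable_norm_iff)

lemma measurable_wave: "wave k c \<in> borel_measurable torus"
  by (intro measurable_torus borel_measurable_continuous_onI smooth_imp_continuous smooth_wave)

lemma bounded_wave: "bounded (range (wave k c))"
  unfolding bounded_iff wave_def by (intro exI[of _ 1]) auto

lemma integrable_mult_wave: "integrable torus g \<Longrightarrow> integrable torus (\<lambda>x. g x * wave k c x)" for g :: "real^3 \<Rightarrow> real"
  using integrable_bounded_mult[OF measurable_wave bounded_wave, of g k c] by (simp add: mult.commute)

lemma integral_cis_complex_coeff:
  assumes g: "integrable torus g"
  shows "(LINT x|torus. cis (2 * pi * ((- k) \<bullet> x)) * complex_of_real (g x)) = complex_coeff g k"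
proof -
  have "cis (2 * pi * ((- k) \<bullet> x)) * complex_of_real (g x)
    = complex_of_real (g x * wave k 0 x) + \<i> * complex_of_real (g x * wave k (pi/2) x)" for x
    unfolding wave_def by (simp add: complex_eq_iff cos_add)
  then have "(LINT x|torus. cis (2 * pi * ((- k) \<bullet> x)) * complex_of_real (g x))
    = (LINT x|torus. complex_of_real (g x * wave k 0 x) + \<i> * complex_of_real (g x * wave k (pi/2) x))"
    by (simp only:)
  also have "\<dots> = (LINT x|torus. complex_of_real (g x * wave k 0 x)) + (LINT x|torus. \<i> * complex_of_real (g x * wave k (pi/2) x))"
    by (rule Bochner_Integration.integral_add; (rule integrable_mult_right)?; rule integrable_of_real; rule integrable_mult_wave[OF g])
  also have "\<dots> = complex_coeff g k"
    by (simp only: integral_mult_right_zero integral_complex_of_real) (simp add: complex_coeff_def trig_coeff_def complex_eq_iff)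
  finally show ?thesis .
qed

lemma fourier_coeff_nth:
  assumes f: "integrable torus f"
  shows "fourier_coeff f k $ l = complex_coeff (\<lambda>x. f x $ l) k"
  using integral_cis_complex_coeff[OF integrable_vec_nth[OF f, of l], of k]
  by (simp add: fourier_coeff_def)

lemma weak_deriv_nth:
  fixes f g :: "real^3 \<Rightarrow> real^3"
  assumes w: "has_weak_deriv i f g" and \<phi>: "smooth \<phi>" "periodic \<phi>"
  shows "(LINT x|torus. pd i \<phi> x * f x $ l) = - (LINT x|torus. \<phi> x * g x $ l)"
proof -
  have f: "integrable torus f" and g: "integrable torus g"
    using w Lp_space_1_integrable unfolding has_weak_deriv_def by blast+
  have "\<forall>\<phi> :: real^3 \<Rightarrow> real. smooth \<phi> \<and> periodic \<phi> \<longrightarrow>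
      (LINT x|torus. pd i \<phi> x *\<^sub>R f x) = - (LINT x|torus. \<phi> x *\<^sub>R g x)"
    using w unfolding has_weak_deriv_def by (elim conjE)
  from arg_cong[OF this[rule_format, OF conjI[OF \<phi>]], of "\<lambda>v. v $ l"]
  have "(LINT x|torus. pd i \<phi> x *\<^sub>R f x) $ l = (- (LINT x|torus. \<phi> x *\<^sub>R g x)) $ l" .
  then show ?thesis
    using integral_vec_nth[OF integrable_smooth_scaleR[OF smooth_pd[OF \<phi>(1), of i] f], of l]
      integral_vec_nth[OF integrable_smooth_scaleR[OF \<phi>(1) g], of l] by simp
qed

lemma trig_coeff_weak_deriv:
  fixes f g :: "real^3 \<Rightarrow> real^3"
  assumes w: "has_weak_deriv i f g" and k: "k \<in> frequencies"
  shows "trig_coeff (\<lambda>x. g x $ l) k c = - (2 * pi * k $ i) * trig_coeff (\<lambda>x. f x $ l) k (c + pi/2)"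
proof -
  have "trig_coeff (\<lambda>x. g x $ l) k c = (LINT x|torus. wave k c x * g x $ l)"
    unfolding trig_coeff_def by (rule Bochner_Integration.integral_cong[OF refl]) (rule mult.commute)
  also have "\<dots> = - (LINT x|torus. pd i (wave k c) x * f x $ l)"
    unfolding weak_deriv_nth[OF w smooth_wave[of k c] periodic_wave[OF k, of c], of l] minus_minus ..
  also have "(LINT x|torus. pd i (wave k c) x * f x $ l)
      = (LINT x|torus. (2 * pi * k $ i) * (f x $ l * wave k (c + pi/2) x))"
    unfolding dir_deriv_wave by (rule Bochner_Integration.integral_cong[OF refl]) simp
  also have "\<dots> = (2 * pi * k $ i) * trig_coeff (\<lambda>x. f x $ l) k (c + pi/2)"
    unfolding trig_coeff_def by (rule integral_mult_right_zero)
  finally show ?thesis by (simp only: mult_minus_left)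
qed

lemma complex_coeff_weak_deriv:
  fixes f g :: "real^3 \<Rightarrow> real^3"
  assumes w: "has_weak_deriv i f g" and k: "k \<in> frequencies"
  shows "complex_coeff (\<lambda>x. g x $ l) k = ((2 * pi * k $ i) * \<i>) * complex_coeff (\<lambda>x. f x $ l) k"
proof -
  have "wave k pi x = - wave k 0 x" for x using wave_add_pi[of k 0 x] by simp
  then have "trig_coeff (\<lambda>x. f x $ l) k pi = - trig_coeff (\<lambda>x. f x $ l) k 0"
    unfolding trig_coeff_def by (simp only: mult_minus_right Bochner_Integration.integral_minus)
  moreover have "trig_coeff (\<lambda>x. g x $ l) k 0 = - (2 * pi * k $ i) * trig_coeff (\<lambda>x. f x $ l) k (pi/2)"
    using trig_coeff_weak_deriv[OF w k, of l 0] by simp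
  moreover have "trig_coeff (\<lambda>x. g x $ l) k (pi/2) = - (2 * pi * k $ i) * trig_coeff (\<lambda>x. f x $ l) k pi"
    using trig_coeff_weak_deriv[OF w k, of l "pi/2"] by simp
  ultimately show ?thesis
    by (simp add: complex_coeff_def complex_eq_iff)
qed

lemma wave_complex_coeff:
  "(\<Sum>c\<in>{0, pi/2}. trig_coeff g k c * wave k c x) = Re (complex_coeff g k * cis (2 * pi * (k \<bullet> x)))"
  "(\<Sum>c\<in>{0, pi/2}. trig_coeff g k c * wave k (c + pi/2) x) = Re (\<i> * complex_coeff g k * cis (2 * pi * (k \<bullet> x)))"
  by (simp_all add: complex_coeff_def wave_def cos_add sin_add)

lemma lp_sum_eq_Re:
  "lp_sum \<theta> J g x = Re (trig_poly (low_freq J) (\<lambda>k. of_real (\<theta> (k /\<^sub>R 2 ^ J)) * complex_coeff g k) x)"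
proof -
  have "(\<Sum>c\<in>{0, pi/2}. (\<theta> (k /\<^sub>R 2 ^ J) * trig_coeff g k c) * wave k c x)
      = Re (of_real (\<theta> (k /\<^sub>R 2 ^ J)) * complex_coeff g k * cis (2 * pi * (k \<bullet> x)))" for k
  proof -
    have "(\<Sum>c\<in>{0, pi/2}. (\<theta> (k /\<^sub>R 2 ^ J) * trig_coeff g k c) * wave k c x)
      = \<theta> (k /\<^sub>R 2 ^ J) * (\<Sum>c\<in>{0, pi/2}. trig_coeff g k c * wave k c x)"
      by (simp only: sum_distrib_left mult.assoc)
    then show ?thesis unfolding wave_complex_coeff by (simp add: algebra_simps)
  qed
  then show ?thesis unfolding lp_sum_def trig_poly_def Re_sum by (simp only:)
qed

lemma dir_deriv_lp_sum_eq_Re: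
  "pd i (lp_sum \<theta> J g) x =
     Re (trig_poly (low_freq J) (\<lambda>k. of_real (\<theta> (k /\<^sub>R 2 ^ J)) * (((2 * pi * k $ i) * \<i>) * complex_coeff g k)) x)"
proof -
  have "(\<Sum>c\<in>{0, pi/2}. (\<theta> (k /\<^sub>R 2 ^ J) * trig_coeff g k c) * (2 * pi * k $ i * wave k (c + pi/2) x))
      = Re (of_real (\<theta> (k /\<^sub>R 2 ^ J)) * (((2 * pi * k $ i) * \<i>) * complex_coeff g k) * cis (2 * pi * (k \<bullet> x)))" for k
  proof -
    have "(\<Sum>c\<in>{0, pi/2}. (\<theta> (k /\<^sub>R 2 ^ J) * trig_coeff g k c) * (2 * pi * k $ i * wave k (c + pi/2) x))
      = \<theta> (k /\<^sub>R 2 ^ J) * (2 * pi * k $ i) * (\<Sum>c\<in>{0, pi/2}. trig_coeff g k c * wave k (c + pi/2) x)"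
      unfolding sum_distrib_left by (intro sum.cong refl) (simp only: mult_ac)
    then show ?thesis unfolding wave_complex_coeff by (simp add: algebra_simps)
  qed
  then show ?thesis unfolding dir_deriv_lp_sum trig_poly_def Re_sum by (simp only:)
qed

lemma dyadic_eq_0:
  assumes "lp_cutoff \<theta>" "k \<in> frequencies" "k \<notin> low_freq j"
  shows "dyadic \<theta> j k = 0"
proof -
  have \<theta>: "\<theta> \<xi> = 0" if "3/2 \<le> norm \<xi>" for \<xi> using assms(1) that by (auto simp: lp_cutoff_def)
  obtain i where i: "2 ^ (j + 1) < \<bar>k $ i\<bar>" using assms by (auto simp: low_freq_def not_le)
  have k: "2 ^ (j + 1) \<le> norm k" using component_le_norm_cart[of k i] i by linarith
  show ?thesis
  proof (cases j)
    case 0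
    then show ?thesis using k \<theta>[of k] by simp
  next
    case (Suc j')
    have 4: "4 * 2 ^ j' \<le> norm k" using k Suc by simp
    have p: "(0::real) < 2 ^ j'" by simp
    have "3/2 * 2 ^ Suc j' \<le> norm k" "3/2 * 2 ^ j' \<le> norm k" using 4 p unfolding power_Suc by linarith+
    then have "3/2 \<le> norm k / 2 ^ Suc j'" "3/2 \<le> norm k / 2 ^ j'"
      by (simp_all only: pos_le_divide_eq zero_less_power zero_less_numeral)
    moreover have "norm (k /\<^sub>R 2 ^ n) = norm k / 2 ^ n" for n by (simp add: divide_simps)
    ultimately have "\<theta> (k /\<^sub>R 2 ^ Suc j') = 0" "\<theta> (k /\<^sub>R 2 ^ j') = 0"
      by (intro \<theta>; simp only:)+
    then show ?thesis unfolding Suc dyadic.simps by simp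
  qed
qed

lemma sum_dyadic: "(\<Sum>j\<le>J. dyadic \<theta> j k) = \<theta> (k /\<^sub>R 2 ^ J)"
  by (induction J) auto

lemma lp_block_nth:
  assumes \<theta>: "lp_cutoff \<theta>" and f: "integrable torus f"
  shows "lp_block \<theta> j f x $ l = trig_poly (low_freq j) (\<lambda>k. of_real (dyadic \<theta> j k) * complex_coeff (\<lambda>x. f x $ l) k) x"
proof -
  have sub: "{k. (\<forall>i. k $ i \<in> \<int>) \<and> dyadic \<theta> j k \<noteq> 0} \<subseteq> low_freq j"
  proof
    fix k assume "k \<in> {k. (\<forall>i. k $ i \<in> \<int>) \<and> dyadic \<theta> j k \<noteq> 0}"
    then have "k \<in> frequencies" "dyadic \<theta> j k \<noteq> 0" by (simp_all add: frequencies_def)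
    then show "k \<in> low_freq j" using dyadic_eq_0[OF \<theta>, of k j] by blast
  qed
  have "lp_block \<theta> j f x $ l = (\<Sum>k | (\<forall>i. k $ i \<in> \<int>) \<and> dyadic \<theta> j k \<noteq> 0.
       of_real (dyadic \<theta> j k) * complex_coeff (\<lambda>x. f x $ l) k * cis (2 * pi * (k \<bullet> x)))"
    unfolding lp_block_def sum_component vector_smult_component fourier_coeff_nth[OF f]
    by (rule sum.cong[OF refl]) (simp only: mult_ac)
  also have "\<dots> = (\<Sum>k\<in>low_freq j. of_real (dyadic \<theta> j k) * complex_coeff (\<lambda>x. f x $ l) k * cis (2 * pi * (k \<bullet> x)))"
  proof (rule sum.mono_neutral_left[OF finite_low_freq sub], rule ballI)
    fix k assume "k \<in> low_freq j - {k. (\<forall>i. k $ i \<in> \<int>) \<and> dyadic \<theta> j k \<noteq> 0}"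
    then have "dyadic \<theta> j k = 0" unfolding low_freq_def frequencies_def by blast
    then show "of_real (dyadic \<theta> j k) * complex_coeff (\<lambda>x. f x $ l) k * cis (2 * pi * (k \<bullet> x)) = 0" by simp
  qed
  finally show ?thesis unfolding trig_poly_def .
qed

text \<open>The dyadic multipliers telescope to \<open>\<theta>\<close> at scale \<open>2 ^ J\<close>.\<close>

lemma sum_trig_poly_blocks:
  assumes \<theta>: "lp_cutoff \<theta>"
  shows "(\<Sum>j\<le>J. trig_poly (low_freq j) (\<lambda>k. of_real (dyadic \<theta> j k) * c k) x)
    = trig_poly (low_freq J) (\<lambda>k. of_real (\<theta> (k /\<^sub>R 2 ^ J)) * c k) x"
proof -
  have "(\<Sum>j\<le>J. trig_poly (low_freq j) (\<lambda>k. of_real (dyadic \<theta> j k) * c k) x)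
    = (\<Sum>j\<le>J. \<Sum>k\<in>low_freq J. of_real (dyadic \<theta> j k) * c k * cis (2 * pi * (k \<bullet> x)))"
  proof (rule sum.cong[OF refl])
    fix j assume "j \<in> {..J}"
    then have sub: "low_freq j \<subseteq> low_freq J" by (intro low_freq_mono) simp
    show "trig_poly (low_freq j) (\<lambda>k. of_real (dyadic \<theta> j k) * c k) x
      = (\<Sum>k\<in>low_freq J. of_real (dyadic \<theta> j k) * c k * cis (2 * pi * (k \<bullet> x)))"
      unfolding trig_poly_def
    proof (rule sum.mono_neutral_left[OF finite_low_freq sub], rule ballI)
      fix k assume "k \<in> low_freq J - low_freq j"
      then have "k \<in> frequencies" "k \<notin> low_freq j" by (simp_all add: low_freq_def)
      then have "dyadic \<theta> j k = 0" by (rule dyadic_eq_0[OF \<theta>])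
      then show "of_real (dyadic \<theta> j k) * c k * cis (2 * pi * (k \<bullet> x)) = 0" by simp
    qed
  qed
  also have "\<dots> = (\<Sum>k\<in>low_freq J. \<Sum>j\<le>J. of_real (dyadic \<theta> j k) * c k * cis (2 * pi * (k \<bullet> x)))"
    by (rule sum.swap)
  also have "\<dots> = (\<Sum>k\<in>low_freq J. of_real (\<Sum>j\<le>J. dyadic \<theta> j k) * c k * cis (2 * pi * (k \<bullet> x)))"
    unfolding sum_distrib_right of_real_sum ..
  finally show ?thesis unfolding sum_dyadic unfolding trig_poly_def .
qed

text \<open>By dominated convergence the limit of the sums has the coefficients \<open>c\<close>, as each frequency is eventually below the cut-off,
and coefficients determine an integrable function. The coefficients are a separate argument \<open>c\<close>
because they arise in a different form, with a factor \<open>2\<pi>\<i>k\<close>, when \<open>g\<close> is a weak derivative.\<close>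

lemma trig_poly_limit:
  fixes g :: "real^3 \<Rightarrow> real"
  assumes \<theta>: "lp_cutoff \<theta>" and g: "integrable torus g" and c: "\<And>k. k \<in> frequencies \<Longrightarrow> complex_coeff g k = c k"
    and M: "integrable torus M"
    and AE: "AE x in torus. convergent (\<lambda>J. trig_poly (low_freq J) (\<lambda>k. of_real (\<theta> (k /\<^sub>R 2 ^ J)) * c k) x) \<and>
       (\<forall>J. norm (trig_poly (low_freq J) (\<lambda>k. of_real (\<theta> (k /\<^sub>R 2 ^ J)) * c k) x) \<le> M x)"
  shows "AE x in torus. (\<lambda>J. trig_poly (low_freq J) (\<lambda>k. of_real (\<theta> (k /\<^sub>R 2 ^ J)) * c k) x) \<longlonglongrightarrow> of_real (g x)"
proof -
  define P where "P J = trig_poly (low_freq J) (\<lambda>k. of_real (\<theta> (k /\<^sub>R 2 ^ J)) * c k)" for J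
  have AE': "AE x in torus. convergent (\<lambda>J. P J x)" "\<And>J. AE x in torus. norm (P J x) \<le> M x"
    using AE unfolding P_def by (auto elim: AE_mp)
  have Pm: "P J \<in> borel_measurable torus" for J
    unfolding P_def by (intro measurable_torus borel_measurable_continuous_onI continuous_trig_poly)
  define w where "w x = lim (\<lambda>J. P J x)" for x
  have wm: "w \<in> borel_measurable torus" unfolding w_def by (rule borel_measurable_lim_metric[OF Pm])
  have wl: "AE x in torus. (\<lambda>J. P J x) \<longlonglongrightarrow> w x"
    using AE'(1) by eventually_elim (simp add: w_def convergent_LIMSEQ_iff)
  have wi: "integrable torus w"
    by (rule integrable_dominated_convergence[OF wm Pm M wl AE'(2)])
  have lf: "low_freq J \<subseteq> frequencies" for J by (auto simp: low_freq_def)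
  have zero: "(LINT x|torus. cis (2 * pi * (k \<bullet> x)) * (w x - of_real (g x))) = 0" if k: "k \<in> frequencies" for k
  proof -
    define m where "m = - k"
    have km: "k = - m" and m: "m \<in> frequencies" using k by (auto simp: m_def frequencies_def)
    have A: "(\<lambda>J. LINT x|torus. cis (2 * pi * ((- m) \<bullet> x)) * P J x) \<longlonglongrightarrow> (LINT x|torus. cis (2 * pi * ((- m) \<bullet> x)) * w x)"
    proof (rule integral_dominated_convergence[OF _ _ M])
      have "(\<lambda>x. cis (2 * pi * ((- m) \<bullet> x))) \<in> borel_measurable torus"
        by (intro measurable_torus borel_measurable_continuous_onI continuous_intros)
      then show "(\<lambda>x. cis (2 * pi * ((- m) \<bullet> x)) * w x) \<in> borel_measurable torus"
         "(\<lambda>x. cis (2 * pi * ((- m) \<bullet> x)) * P J x) \<in> borel_measurable torus" for J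
        by (rule borel_measurable_times[OF _ wm], rule borel_measurable_times[OF _ Pm])
      show "AE x in torus. (\<lambda>J. cis (2 * pi * ((- m) \<bullet> x)) * P J x) \<longlonglongrightarrow> cis (2 * pi * ((- m) \<bullet> x)) * w x"
        using wl by eventually_elim (rule tendsto_mult_left)
      show "AE x in torus. norm (cis (2 * pi * ((- m) \<bullet> x)) * P J x) \<le> M x" for J
        using AE'(2)[of J] by eventually_elim (simp only: norm_mult norm_cis mult_1_left)
    qed
    have B: "\<forall>\<^sub>F J in sequentially. (LINT x|torus. cis (2 * pi * ((- m) \<bullet> x)) * P J x) = c m"
    proof -
      obtain N where N: "norm m < 2 ^ N" using real_arch_pow[of 2 "norm m"] by auto
      have "(LINT x|torus. cis (2 * pi * ((- m) \<bullet> x)) * P J x) = c m" if "N \<le> J" for J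
      proof -
        have "(2::real) ^ N \<le> 2 ^ J" using that by (intro power_increasing) auto
        then have mJ: "norm m \<le> 2 ^ J" using N by linarith
        have "\<bar>m $ i\<bar> \<le> 2 ^ (J + 1)" for i using component_le_norm_cart[of m i] mJ by simp
        then have 1: "m \<in> low_freq J" using m by (auto simp: low_freq_def)
        have "norm (m /\<^sub>R 2 ^ J) \<le> 1" using mJ by (simp add: field_simps)
        then have 2: "\<theta> (m /\<^sub>R 2 ^ J) = 1" using \<theta> unfolding lp_cutoff_def by blast
        show ?thesis unfolding P_def fourier_coeff_trig_poly[OF finite_low_freq lf m] using 1 2 by simp
      qed
      then show ?thesis unfolding eventually_sequentially by blast
    qed
    have "(LINT x|torus. cis (2 * pi * ((- m) \<bullet> x)) * w x) = c m"
      by (rule LIMSEQ_unique[OF A tendsto_eventually[OF B]])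
    moreover have "(LINT x|torus. cis (2 * pi * ((- m) \<bullet> x)) * of_real (g x)) = c m"
      unfolding integral_cis_complex_coeff[OF g] by (rule c[OF m])
    moreover have "(LINT x|torus. cis (2 * pi * ((- m) \<bullet> x)) * (w x - of_real (g x)))
      = (LINT x|torus. cis (2 * pi * ((- m) \<bullet> x)) * w x) - (LINT x|torus. cis (2 * pi * ((- m) \<bullet> x)) * of_real (g x))"
      unfolding right_diff_distrib
      by (rule Bochner_Integration.integral_diff[OF integrable_cis_mult[OF wi] integrable_cis_mult[OF integrable_of_real[OF g]]])
    ultimately show ?thesis unfolding km by (simp only: diff_self)
  qed
  have "AE x in torus. w x - of_real (g x) = 0"
    by (rule fourier_uniqueness[OF Bochner_Integration.integrable_diff[OF wi integrable_of_real[OF g]] zero])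
  then have "AE x in torus. w x = of_real (g x)" by eventually_elim (simp only: right_minus_eq)
  with wl show ?thesis
  proof eventually_elim
    case (elim x)
    have "(\<lambda>J. P J x) \<longlonglongrightarrow> of_real (g x)" using elim(1) unfolding elim(2) .
    then show ?case unfolding P_def .
  qed
qed

section \<open>From \<open>B\<^sup>s\<^bsub>3,\<infinity>\<^esub>\<close> with \<open>s > 1\<close> to \<open>W\<^bsup>1,3\<^esup>\<close>\<close>

lemma Lp_norm_3_cube:
  fixes F :: "real^3 \<Rightarrow> 'b::euclidean_space"
  shows "Lp_norm 3 F ^ 3 = (LINT x|torus. norm (F x) ^ 3)"
proof -
  have p: "norm (F x) powr 3 = norm (F x) ^ 3" for x
    using powr_realpow'[of "norm (F x)" 3] by simp
  have "0 \<le> (LINT x|torus. norm (F x) ^ 3)" by simp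
  then have "((LINT x|torus. norm (F x) ^ 3) powr (1/3)) ^ 3 = (LINT x|torus. norm (F x) ^ 3)"
    using powr_realpow'[of "(LINT x|torus. norm (F x) ^ 3) powr (1/3)" 3] by (simp add: powr_powr)
  then show ?thesis unfolding Lp_norm_def p .
qed

text \<open>\<open>None\<close> stands for no differentiation, so that the functions and their derivatives are treated alike.\<close>

definition deriv_symbol :: "3 option \<Rightarrow> real^3 \<Rightarrow> complex" where
  "deriv_symbol d k = (case d of None \<Rightarrow> 1 | Some i \<Rightarrow> of_real (2 * pi * k $ i) * \<i>)"

definition block :: "(real^3 \<Rightarrow> real) \<Rightarrow> (real^3 \<Rightarrow> real^3) \<Rightarrow> nat \<Rightarrow> 3 \<times> 3 option \<Rightarrow> real^3 \<Rightarrow> complex" where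
  "block \<theta> f j = (\<lambda>(l, d). trig_poly (low_freq j)
      (\<lambda>k. of_real (dyadic \<theta> j k) * (deriv_symbol d k * complex_coeff (\<lambda>x. f x $ l) k)))"

text \<open>On the \<open>j\<close>-th block Bernstein's inequality costs a factor \<open>8\<pi> 2 ^ j\<close> for a derivative, against the decay
\<open>2 powr (- s j)\<close> from the Besov norm.\<close>

lemma integral_block_cube:
  assumes \<theta>: "lp_cutoff \<theta>" and f: "f \<in> besov_space \<theta> s 3"
  shows "(LINT x|torus. norm (block \<theta> f j q x) ^ 3)
    \<le> (1 + (8 * pi) ^ 3) * besov_norm \<theta> s 3 f ^ 3 * (2 powr (1 - s)) ^ (3 * j)"
proof -
  obtain l d where q: "q = (l, d)" by (cases q)
  let ?b = "besov_norm \<theta> s 3 f"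
  have fi: "integrable torus f" using f Lp_space_1_integrable unfolding besov_space_def by blast
  have bdd: "bdd_above (range (\<lambda>j. 2 powr (s * real j) * Lp_norm 3 (lp_block \<theta> j f)))"
    using f by (simp add: besov_space_def)
  have b: "2 powr (s * real j) * Lp_norm 3 (lp_block \<theta> j f) \<le> ?b"
    unfolding besov_norm_def by (rule cSUP_upper[OF _ bdd]) simp
  have L0: "0 \<le> Lp_norm 3 (lp_block \<theta> j f)" by (simp add: Lp_norm_def)
  define B where "B = block \<theta> f j (l, None)"
  have Bnth: "B x = lp_block \<theta> j f x $ l" for x
    unfolding B_def block_def lp_block_nth[OF \<theta> fi] by (simp add: deriv_symbol_def)
  have lpc: "continuous_on UNIV (lp_block \<theta> j f)"
  proof -
    have "continuous_on UNIV (\<lambda>x. lp_block \<theta> j f x $ i)" for i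
      unfolding lp_block_nth[OF \<theta> fi] by (rule continuous_trig_poly)
    then show ?thesis using continuous_on_vec_lambda[of UNIV "\<lambda>i x. lp_block \<theta> j f x $ i"] by simp
  qed
  have "(LINT x|torus. norm (B x) ^ 3) \<le> (LINT x|torus. norm (lp_block \<theta> j f x) ^ 3)"
  proof (rule integral_mono)
    show "integrable torus (\<lambda>x. norm (B x) ^ 3)"
      unfolding B_def block_def prod.case by (intro continuous_integrable_torus continuous_intros continuous_trig_poly)
    show "integrable torus (\<lambda>x. norm (lp_block \<theta> j f x) ^ 3)"
      by (intro continuous_integrable_torus continuous_intros lpc)
    show "norm (B x) ^ 3 \<le> norm (lp_block \<theta> j f x) ^ 3" for x
      unfolding Bnth by (intro power_mono Finite_Cartesian_Product.norm_nth_le norm_ge_zero)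
  qed
  also have "\<dots> = Lp_norm 3 (lp_block \<theta> j f) ^ 3" by (rule Lp_norm_3_cube[symmetric])
  also have "\<dots> \<le> (2 powr (- s * real j) * ?b) ^ 3"
  proof (rule power_mono[OF _ L0])
    have "Lp_norm 3 (lp_block \<theta> j f) = 2 powr (- s * real j) * (2 powr (s * real j) * Lp_norm 3 (lp_block \<theta> j f))"
      by (simp add: powr_minus)
    also have "\<dots> \<le> 2 powr (- s * real j) * ?b" by (rule mult_left_mono[OF b]) simp
    finally show "Lp_norm 3 (lp_block \<theta> j f) \<le> 2 powr (- s * real j) * ?b" .
  qed
  finally have B3: "(LINT x|torus. norm (B x) ^ 3) \<le> (2 powr (- s * real j) * ?b) ^ 3" .
  have B0: "0 \<le> (LINT x|torus. norm (B x) ^ 3)" by simp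
  have two: "(2 ^ j) ^ 3 * (2 powr (- s * real j) * ?b) ^ 3 = ?b ^ 3 * (2 powr (1 - s)) ^ (3 * j)"
  proof -
    have "2 ^ j * 2 powr (- s * real j) = (2::real) powr ((1 - s) * real j)"
      by (simp add: powr_realpow[symmetric] powr_add[symmetric] algebra_simps)
    also have "\<dots> = (2 powr (1 - s)) ^ j" by (simp add: powr_powr[symmetric] powr_realpow)
    finally have e: "2 ^ j * 2 powr (- s * real j) = (2 powr (1 - s)) ^ j" .
    have "(2 ^ j) ^ 3 * (2 powr (- s * real j) * ?b) ^ 3 = (2 ^ j * 2 powr (- s * real j)) ^ 3 * ?b ^ 3"
      by (simp only: power_mult_distrib mult.assoc)
    also have "\<dots> = ?b ^ 3 * (2 powr (1 - s)) ^ (3 * j)"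
      unfolding e by (simp add: mult.commute flip: power_mult)
    finally show ?thesis .
  qed
  have "(LINT x|torus. norm (block \<theta> f j q x) ^ 3) \<le> (1 + (8 * pi) ^ 3) * ((2 ^ j) ^ 3 * (LINT x|torus. norm (B x) ^ 3))"
  proof (cases d)
    case None
    have "(1::real) * 1 \<le> (1 + (8 * pi) ^ 3) * (2 ^ j) ^ 3"
      by (intro mult_mono) auto
    then have "1 * (LINT x|torus. norm (B x) ^ 3) \<le> (1 + (8 * pi) ^ 3) * (2 ^ j) ^ 3 * (LINT x|torus. norm (B x) ^ 3)"
      by (intro mult_right_mono B0) simp
    then show ?thesis by (simp add: q None B_def)
  next
    case (Some i)
    let ?N = "2 ^ (j + 1) :: nat"
    have "(LINT x|torus. norm (trig_poly (low_freq j) (\<lambda>k. (2 * pi * k $ i) * \<i> * (of_real (dyadic \<theta> j k) * complex_coeff (\<lambda>x. f x $ l) k)) x) ^ 3)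
      \<le> (4 * pi * real ?N) ^ 3 * (LINT x|torus. norm (trig_poly (low_freq j) (\<lambda>k. of_real (dyadic \<theta> j k) * complex_coeff (\<lambda>x. f x $ l) k) x) ^ 3)"
      by (rule bernstein_L3[OF finite_low_freq]) (auto simp: low_freq_def)
    moreover have "trig_poly (low_freq j) (\<lambda>k. (2 * pi * k $ i) * \<i> * (of_real (dyadic \<theta> j k) * complex_coeff (\<lambda>x. f x $ l) k)) = block \<theta> f j q"
      by (simp add: q Some block_def deriv_symbol_def mult_ac)
    moreover have "trig_poly (low_freq j) (\<lambda>k. of_real (dyadic \<theta> j k) * complex_coeff (\<lambda>x. f x $ l) k) = B"
      by (simp add: B_def block_def deriv_symbol_def)
    ultimately have "(LINT x|torus. norm (block \<theta> f j q x) ^ 3) \<le> (4 * pi * real ?N) ^ 3 * (LINT x|torus. norm (B x) ^ 3)"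
      by (simp only:)
    also have "4 * pi * real ?N = (8 * pi) * 2 ^ j" by simp
    also have "((8 * pi) * 2 ^ j) ^ 3 * (LINT x|torus. norm (B x) ^ 3) \<le> (1 + (8 * pi) ^ 3) * ((2 ^ j) ^ 3 * (LINT x|torus. norm (B x) ^ 3))"
      unfolding power_mult_distrib[of "8 * pi" "2 ^ j"] mult.assoc[of "(8 * pi) ^ 3"] by (intro mult_right_mono) (use B0 in auto)
    finally show ?thesis .
  qed
  also have "\<dots> \<le> (1 + (8 * pi) ^ 3) * ((2 ^ j) ^ 3 * (2 powr (- s * real j) * ?b) ^ 3)"
    by (intro mult_left_mono B3) auto
  finally show ?thesis unfolding two by (simp only: mult.assoc)
qed

text \<open>There are \<open>12 = 3 \<cdot> 4\<close> blocks per level, one for each component and each of the four choices of derivative;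
the denominator sums the geometric series over the levels.\<close>

definition W13_const :: "real \<Rightarrow> real" where
  "W13_const s = 12 ^ 3 * (1 + (8 * pi) ^ 3) / (1 - 2 powr (1 - s)) ^ 3"

text \<open>All blocks of \<open>f\<close> and of its first derivatives enter one series \<open>\<Sum>j. a j\<close>, so that one majorant \<open>M\<close> serves
all components, all derivatives and all levels \<open>J\<close>. Absolute convergence of the blocks gives convergence of
the sums almost everywhere, and \<open>trig_poly_limit\<close> identifies the limits.\<close>

theorem besov_W13_approximation:
  fixes f :: "real^3 \<Rightarrow> real^3"
  assumes \<theta>: "lp_cutoff \<theta>" and s: "s > 1" and f: "f \<in> besov_space \<theta> s 3"
    and D: "\<And>i. has_weak_deriv i f (D i)"
  obtains M where "M \<in> borel_measurable torus" "integrable torus (\<lambda>x. M x ^ 3)"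
    "(LINT x|torus. M x ^ 3) \<le> W13_const s * besov_norm \<theta> s 3 f ^ 3"
    "\<And>l. AE x in torus. (\<forall>J. \<bar>lp_sum \<theta> J (\<lambda>x. f x $ l) x\<bar> \<le> M x) \<and> (\<lambda>J. lp_sum \<theta> J (\<lambda>x. f x $ l) x) \<longlonglongrightarrow> f x $ l"
    "\<And>l i. AE x in torus. (\<forall>J. \<bar>pd i (lp_sum \<theta> J (\<lambda>x. f x $ l)) x\<bar> \<le> M x) \<and>
       (\<lambda>J. pd i (lp_sum \<theta> J (\<lambda>x. f x $ l)) x) \<longlonglongrightarrow> D i x $ l"
proof -
  define a where "a j x = (\<Sum>q\<in>UNIV. norm (block \<theta> f j q x))" for j x
  define \<rho> where "\<rho> = 2 powr (1 - s)"
  have \<rho>: "0 < \<rho>" "\<rho> < 1" using s by (auto simp: \<rho>_def powr_less_one)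
  have fi: "integrable torus f" using f Lp_space_1_integrable unfolding besov_space_def by blast
  have bc: "continuous_on S (block \<theta> f j q)" for j q S
    by (cases q) (simp add: block_def continuous_trig_poly)
  have a0: "0 \<le> a j x" for j x by (simp add: a_def sum_nonneg)
  have ac: "continuous_on UNIV (a j)" for j unfolding a_def[abs_def] by (intro continuous_intros bc)
  have am: "a j \<in> borel_measurable torus" for j
    by (intro measurable_torus borel_measurable_continuous_onI ac)
  have ai: "integrable torus (\<lambda>x. a j x ^ 3)" for j
    by (intro continuous_integrable_torus continuous_intros ac)
  let ?K = "12 ^ 3 * (1 + (8 * pi) ^ 3) * besov_norm \<theta> s 3 f ^ 3"
  have aB: "(LINT x|torus. a j x ^ 3) \<le> ?K * \<rho> ^ (3 * j)" for j
  proof -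
    have card: "card (UNIV :: (3 \<times> 3 option) set) = 12"
      by simp
    have bi: "integrable torus (\<lambda>x. norm (block \<theta> f j q x) ^ 3)" for q
      by (intro continuous_integrable_torus continuous_intros bc)
    have pw: "a j x ^ 3 \<le> 12\<^sup>2 * (\<Sum>q\<in>UNIV. norm (block \<theta> f j q x) ^ 3)" for x
      using sum_cube_jensen[of "UNIV :: (3 \<times> 3 option) set" "\<lambda>_. 1" "\<lambda>q. norm (block \<theta> f j q x)"]
      by (simp add: a_def card)
    have "(LINT x|torus. a j x ^ 3) \<le> (LINT x|torus. 12\<^sup>2 * (\<Sum>q\<in>UNIV. norm (block \<theta> f j q x) ^ 3))"
      by (rule integral_mono[OF ai _ pw]) (intro integrable_mult_right Bochner_Integration.integrable_sum bi)
    also have "\<dots> = 12\<^sup>2 * (\<Sum>q\<in>UNIV. LINT x|torus. norm (block \<theta> f j q x) ^ 3)"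
      unfolding integral_mult_right_zero Bochner_Integration.integral_sum[OF bi] ..
    also have "\<dots> \<le> 12\<^sup>2 * (\<Sum>q\<in>(UNIV :: (3 \<times> 3 option) set). (1 + (8 * pi) ^ 3) * besov_norm \<theta> s 3 f ^ 3 * \<rho> ^ (3 * j))"
      unfolding \<rho>_def by (intro mult_left_mono sum_mono integral_block_cube[OF \<theta> f]) simp
    also have "\<dots> = ?K * \<rho> ^ (3 * j)" by (simp add: card)
    finally show ?thesis .
  qed
  define M where "M x = (\<Sum>j. a j x)" for x
  note sc = summable_cube_bound[of a torus ?K \<rho>, OF am a0 ai aB \<rho>]
  have Mm: "M \<in> borel_measurable torus" unfolding M_def[abs_def] by (rule borel_measurable_suminf[OF am])
  have M3: "integrable torus (\<lambda>x. M x ^ 3)" unfolding M_def by (rule sc(2))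
  have M3b: "(LINT x|torus. M x ^ 3) \<le> W13_const s * besov_norm \<theta> s 3 f ^ 3"
    using sc(3) unfolding M_def W13_const_def \<rho>_def by (simp add: mult_ac)
  have Mi: "integrable torus M"
  proof (rule Bochner_Integration.integrable_bound)
    show "integrable torus (\<lambda>x. 1 + \<bar>M x ^ 3\<bar>)"
      by (intro Bochner_Integration.integrable_add integrable_abs M3 continuous_integrable_torus continuous_intros)
    have "\<bar>m\<bar> \<le> 1 + \<bar>m ^ 3\<bar>" for m :: real
    proof (cases "\<bar>m\<bar> \<le> 1")
      case False
      then have "\<bar>m\<bar> ^ 1 \<le> \<bar>m\<bar> ^ 3" by (intro power_increasing) auto
      then show ?thesis by (simp add: power_abs)
    qed auto
    then show "AE x in torus. norm (M x) \<le> norm (1 + \<bar>M x ^ 3\<bar>)"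
      by (intro AE_I2) (simp only: real_norm_def, meson abs_ge_self order_trans)
  qed (rule Mm)
  have conv: "AE x in torus. convergent (\<lambda>J. trig_poly (low_freq J) (\<lambda>k. of_real (\<theta> (k /\<^sub>R 2 ^ J)) * (deriv_symbol d k * complex_coeff (\<lambda>x. f x $ l) k)) x) \<and>
       (\<forall>J. norm (trig_poly (low_freq J) (\<lambda>k. of_real (\<theta> (k /\<^sub>R 2 ^ J)) * (deriv_symbol d k * complex_coeff (\<lambda>x. f x $ l) k)) x) \<le> M x)" for l d
    using sc(1)
  proof eventually_elim
    case (elim x)
    have P: "trig_poly (low_freq J) (\<lambda>k. of_real (\<theta> (k /\<^sub>R 2 ^ J)) * (deriv_symbol d k * complex_coeff (\<lambda>x. f x $ l) k)) x
      = (\<Sum>j\<le>J. block \<theta> f j (l, d) x)" for J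
      unfolding block_def prod.case by (rule sum_trig_poly_blocks[OF \<theta>, symmetric])
    have ba: "norm (block \<theta> f j (l, d) x) \<le> a j x" for j
      unfolding a_def by (rule member_le_sum) auto
    have "summable (\<lambda>j. block \<theta> f j (l, d) x)"
      by (rule summable_comparison_test'[OF elim, of 0]) (rule ba)
    then have "convergent (\<lambda>J. \<Sum>j\<le>J. block \<theta> f j (l, d) x)"
      unfolding convergent_def using summable_LIMSEQ' by blast
    moreover have "norm (\<Sum>j\<le>J. block \<theta> f j (l, d) x) \<le> M x" for J
    proof -
      have "norm (\<Sum>j\<le>J. block \<theta> f j (l, d) x) \<le> (\<Sum>j\<le>J. a j x)"
        by (rule sum_norm_le) (rule ba)
      also have "\<dots> \<le> M x" unfolding M_def by (rule sum_le_suminf[OF elim]) (auto simp: a0)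
      finally show ?thesis .
    qed
    ultimately show ?case unfolding P by blast
  qed
  have real_part: "AE x in torus. (\<forall>J. \<bar>Re (P J x)\<bar> \<le> M x) \<and> (\<lambda>J. Re (P J x)) \<longlonglongrightarrow> g x"
    if "AE x in torus. convergent (\<lambda>J. P J x) \<and> (\<forall>J. norm (P J x) \<le> M x)"
      and "AE x in torus. (\<lambda>J. P J x) \<longlonglongrightarrow> of_real (g x)" for P and g :: "real^3 \<Rightarrow> real"
    using that
  proof eventually_elim
    case (elim x)
    have "\<bar>Re (P J x)\<bar> \<le> M x" for J using elim(1) abs_Re_le_cmod[of "P J x"] order_trans by blast
    moreover have "(\<lambda>J. Re (P J x)) \<longlonglongrightarrow> g x" using tendsto_Re[OF elim(2)] by simp
    ultimately show ?case by blast
  qed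
  show ?thesis
  proof (rule that[OF Mm M3 M3b])
    fix l
    have c0: "deriv_symbol None k * complex_coeff (\<lambda>x. f x $ l) k = complex_coeff (\<lambda>x. f x $ l) k" for k
      by (simp add: deriv_symbol_def)
    note conv0 = conv[of None l, unfolded c0]
    show "AE x in torus. (\<forall>J. \<bar>lp_sum \<theta> J (\<lambda>x. f x $ l) x\<bar> \<le> M x) \<and> (\<lambda>J. lp_sum \<theta> J (\<lambda>x. f x $ l) x) \<longlonglongrightarrow> f x $ l"
      unfolding lp_sum_eq_Re
      by (rule real_part[OF conv0 trig_poly_limit[OF \<theta> integrable_vec_nth[OF fi] refl Mi conv0]])
    fix i
    have c1: "deriv_symbol (Some i) k * complex_coeff (\<lambda>x. f x $ l) k = ((2 * pi * k $ i) * \<i>) * complex_coeff (\<lambda>x. f x $ l) k" for k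
      by (simp add: deriv_symbol_def)
    note conv1 = conv[of "Some i" l, unfolded c1]
    have Di: "integrable torus (D i)" using D[of i] Lp_space_1_integrable unfolding has_weak_deriv_def by blast
    show "AE x in torus. (\<forall>J. \<bar>pd i (lp_sum \<theta> J (\<lambda>x. f x $ l)) x\<bar> \<le> M x) \<and>
       (\<lambda>J. pd i (lp_sum \<theta> J (\<lambda>x. f x $ l)) x) \<longlonglongrightarrow> D i x $ l"
      unfolding dir_deriv_lp_sum_eq_Re
      by (rule real_part[OF conv1 trig_poly_limit[OF \<theta> integrable_vec_nth[OF Di] complex_coeff_weak_deriv[OF D] Mi conv1]])
  qed
qed

section \<open>Weak derivatives in time\<close>

definition time_bump :: "real \<Rightarrow> (real \<Rightarrow> real) set" where
  "time_bump T = {\<eta>. smooth \<eta> \<and> (\<exists>a b. 0 < a \<and> b < T \<and> (\<forall>t. t \<notin> {a..b} \<longrightarrow> \<eta> t = 0))}"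

lemma smooth_has_real_derivative:
  assumes "smooth (\<eta> :: real \<Rightarrow> real)"
  shows "(\<eta> has_real_derivative dir_deriv 1 \<eta> t) (at t)"
proof -
  have d: "(\<eta> has_derivative frechet_derivative \<eta> (at t)) (at t)" by (rule smooth_has_derivative[OF assms])
  have "frechet_derivative \<eta> (at t) h = dir_deriv 1 \<eta> t * h" for h
    using linear_scale[OF has_derivative_linear[OF d], of h 1] by (simp add: dir_deriv_def mult.commute)
  then have "frechet_derivative \<eta> (at t) = (*) (dir_deriv 1 \<eta> t)" by (rule ext)
  then show ?thesis using d by (simp only: has_field_derivative_def)
qed

lemma dir_deriv_1_eq: "(\<eta> has_real_derivative d) (at t) \<Longrightarrow> dir_deriv 1 \<eta> t = d"
  unfolding has_field_derivative_def by (drule dir_deriv_eqI[of _ _ _ 1]) simp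

lemma smooth_antiderivative:
  assumes "smooth (f :: real \<Rightarrow> real)"
  obtains F where "smooth F" "\<And>t. (F has_real_derivative f t) (at t)"
proof -
  have "isCont f x" for x
    using smooth_imp_continuous[OF assms, of UNIV] by (simp add: continuous_on_eq_continuous_at)
  then obtain F where "\<forall>x. (F has_vector_derivative f x) (at x)"
    using einterval_antiderivative[of "-\<infinity>" "\<infinity>" f] by auto
  then have "(F has_real_derivative f t) (at t)" for t
    by (simp add: has_real_derivative_iff_has_vector_derivative)
  then show ?thesis using that smooth_primitive[OF assms] by blast
qed

lemma primitive_constant_outside:
  fixes F \<xi> :: "real \<Rightarrow> real"
  assumes F: "\<And>t. (F has_real_derivative \<xi> t) (at t)" and supp: "\<And>t. t \<notin> {a..b} \<Longrightarrow> \<xi> t = 0"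
  shows "t \<le> a \<Longrightarrow> F t = F a" "b \<le> t \<Longrightarrow> F t = F b"
proof -
  show "F t = F a" if "t \<le> a"
  proof (cases "t = a")
    case False
    then have "t < a" using that by simp
    from MVT2[OF this F] obtain r where "r < a" "F a - F t = (a - t) * \<xi> r" by auto
    then show ?thesis using supp[of r] by simp
  qed simp
  show "F t = F b" if "b \<le> t"
  proof (cases "t = b")
    case False
    then have "b < t" using that by simp
    from MVT2[OF this F] obtain r where "b < r" "F t - F b = (t - b) * \<xi> r" by auto
    then show ?thesis using supp[of r] by simp
  qed simp
qed

text \<open>A cut-off for frequencies yields the cut-offs in time: the restriction of \<open>\<theta>\<^sup>2\<close> to a line is a smooth
nonnegative bump, and its normalised primitive is a step.\<close>

lemma smooth_step_function:
  assumes "lp_cutoff \<theta>"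
  obtains \<sigma> :: "real \<Rightarrow> real" where "smooth \<sigma>" "\<And>t. t \<le> -1 \<Longrightarrow> \<sigma> t = 0" "\<And>t. 1 \<le> t \<Longrightarrow> \<sigma> t = 1"
    "\<And>t. 0 \<le> \<sigma> t" "\<And>t. \<sigma> t \<le> 1"
proof -
  define e :: "real^3" where "e = 2 *\<^sub>R axis 1 1"
  define \<beta> where "\<beta> t = \<theta> (t *\<^sub>R e + 0) * \<theta> (t *\<^sub>R e + 0)" for t :: real
  have "smooth \<theta>" using assms by (simp add: lp_cutoff_def)
  have s0: "smooth (\<lambda>t::real. \<theta> (t *\<^sub>R e + 0))"
  proof -
    have "bounded_linear (\<lambda>t::real. t *\<^sub>R e)" by (rule bounded_linear_scaleR_left)
    from smooth_affine[OF this \<open>smooth \<theta>\<close>, of 0] show ?thesis .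
  qed
  have s\<beta>: "smooth \<beta>" unfolding \<beta>_def[abs_def] by (rule smooth_mult[OF s0 s0])
  have ne: "norm (t *\<^sub>R e + 0) = 2 * \<bar>t\<bar>" for t by (simp add: e_def norm_axis_1)
  have \<beta>0: "0 \<le> \<beta> t" for t by (simp add: \<beta>_def)
  have \<beta>1: "\<beta> t = 1" if "\<bar>t\<bar> \<le> 1/2" for t
  proof -
    have "norm (t *\<^sub>R e + 0) \<le> 1" unfolding ne using that by simp
    then have "\<theta> (t *\<^sub>R e + 0) = 1" using assms unfolding lp_cutoff_def by blast
    then show ?thesis by (simp only: \<beta>_def mult_1_left)
  qed
  have \<beta>z: "\<beta> t = 0" if "1 \<le> \<bar>t\<bar>" for t
  proof -
    have "3/2 \<le> norm (t *\<^sub>R e + 0)" unfolding ne using that by simp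
    then have "\<theta> (t *\<^sub>R e + 0) = 0" using assms unfolding lp_cutoff_def by blast
    then show ?thesis by (simp only: \<beta>_def mult_zero_left)
  qed
  obtain F where F: "smooth F" "\<And>t. (F has_real_derivative \<beta> t) (at t)"
    using smooth_antiderivative[OF s\<beta>] by blast
  have mono: "F s \<le> F t" if "s \<le> t" for s t
    by (rule DERIV_nonneg_imp_nondecreasing[OF that]) (use F(2) \<beta>0 in blast)
  have supp: "\<beta> t = 0" if "t \<notin> {-1..1}" for t using that by (intro \<beta>z) auto
  note const = primitive_constant_outside[where F=F and \<xi>=\<beta> and a="-1" and b=1, OF F(2) supp]
  have left: "F t = F (-1)" if "t \<le> -1" for t by (rule const(1)[OF _ that])
  have right: "F t = F 1" if "1 \<le> t" for t by (rule const(2)[OF _ that])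
  have "F (-1/2) < F (1/2)"
  proof -
    obtain z where "-1/2 < z" "z < 1/2" "F (1/2) - F (-1/2) = (1/2 - (-1/2)) * \<beta> z"
      using MVT2[of "-1/2" "1/2" F \<beta>] F(2) by auto
    moreover have "\<beta> z = 1" using \<open>-1/2 < z\<close> \<open>z < 1/2\<close> by (intro \<beta>1) simp
    ultimately show ?thesis by simp
  qed
  then have pos: "0 < F 1 - F (-1)" using mono[of "-1" "-1/2"] mono[of "1/2" 1] by simp
  define \<sigma> where "\<sigma> t = (1 / (F 1 - F (-1))) * (F t + (- F (-1)))" for t
  show ?thesis
  proof (rule that[of \<sigma>])
    show "smooth \<sigma>" unfolding \<sigma>_def[abs_def] by (rule smooth_mult[OF smooth_const smooth_add[OF F(1) smooth_const]])
    show "\<sigma> t = 0" if "t \<le> -1" for t using left[OF that] by (simp add: \<sigma>_def)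
    show "\<sigma> t = 1" if "1 \<le> t" for t using right[OF that] pos by (simp add: \<sigma>_def)
    have "F (-1) \<le> F t" "F t \<le> F 1" for t
      using mono[of t 1] mono[of "-1" t] left[of t] right[of t] pos by linarith+
    then show "0 \<le> \<sigma> t" "\<sigma> t \<le> 1" for t using pos by (auto simp: \<sigma>_def field_simps)
  qed
qed

lemma time_bump_integrable:
  assumes h: "integrable (time T) h" and \<xi>: "smooth (\<xi> :: real \<Rightarrow> real)"
  shows "integrable (time T) (\<lambda>t. \<xi> t * h t)"
proof -
  have c: "continuous_on S \<xi>" for S using smooth_imp_continuous[OF \<xi>] .
  have "bounded (\<xi> ` {0..T})" by (intro compact_imp_bounded compact_continuous_image c compact_Icc)
  then have "\<exists>B. \<forall>t\<in>{0..T}. \<bar>\<xi> t\<bar> \<le> B" by (simp add: bounded_iff)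
  then obtain B where B: "\<And>t. t \<in> {0..T} \<Longrightarrow> \<bar>\<xi> t\<bar> \<le> B" by blast
  show ?thesis
  proof (rule Bochner_Integration.integrable_bound)
    show "integrable (time T) (\<lambda>t. B * \<bar>h t\<bar>)" using h by simp
    have "\<xi> \<in> borel_measurable (time T)"
      by (rule continuous_imp_measurable_on_sets_lebesgue[OF c]) simp
    then show "(\<lambda>t. \<xi> t * h t) \<in> borel_measurable (time T)"
      by (rule borel_measurable_times[OF _ borel_measurable_integrable[OF h]])
    show "AE t in time T. norm (\<xi> t * h t) \<le> norm (B * \<bar>h t\<bar>)"
    proof (intro AE_I2)
      fix t assume "t \<in> space (time T)"
      then have "\<bar>\<xi> t\<bar> \<le> B" by (intro B) auto
      then have "\<bar>\<xi> t\<bar> * \<bar>h t\<bar> \<le> B * \<bar>h t\<bar>" by (rule mult_right_mono) simp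
      also have "\<dots> \<le> norm (B * \<bar>h t\<bar>)" unfolding real_norm_def by (rule abs_ge_self)
      finally show "norm (\<xi> t * h t) \<le> norm (B * \<bar>h t\<bar>)" by (simp only: abs_mult real_norm_def)
    qed
  qed
qed

text \<open>The difference of two steeper and steeper steps tends boundedly to the indicator of an interval, so \<open>h\<close>
has integral zero over every interval.\<close>

lemma fundamental_lemma:
  assumes \<theta>: "lp_cutoff \<theta>" and h: "integrable (time T) h"
    and z: "\<And>\<xi>. \<xi> \<in> time_bump T \<Longrightarrow> (LINT t|time T. \<xi> t * h t) = 0"
  shows "AE t in time T. h t = 0"
proof -
  obtain \<sigma> :: "real \<Rightarrow> real" where \<sigma>: "smooth \<sigma>" "\<And>t. t \<le> -1 \<Longrightarrow> \<sigma> t = 0" "\<And>t. 1 \<le> t \<Longrightarrow> \<sigma> t = 1"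
    "\<And>t. 0 \<le> \<sigma> t" "\<And>t. \<sigma> t \<le> 1" using smooth_step_function[OF \<theta>] by metis
  have zero: "(LINT t|time T. indicator {a<..<b} t * h t) = 0" if ab: "0 \<le> a" "b \<le> T" "a < b" for a b
  proof -
    obtain N where N: "4 / (b - a) < real N" using reals_Archimedean2 by blast
    have N0: "0 < N" using N ab by (cases N) (auto simp: field_simps)
    \<comment> \<open>The steps are moved inwards by \<open>2/(n + N)\<close> so that the support is compact in \<open>(0, T)\<close> even if \<open>(a, b)\<close>
      reaches the ends.\<close>
    define \<xi> where "\<xi> n t = \<sigma> (real (n + N) * t + (- real (n + N) * a - 2)) + (-1) * \<sigma> (real (n + N) * t + (- real (n + N) * b + 2))" for n t
    have sm: "smooth (\<xi> n)" for n
    proof -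
      have "smooth (\<lambda>t. \<sigma> (c * t + d))" for c d by (rule smooth_affine[OF bounded_linear_mult_right \<sigma>(1)])
      then show ?thesis unfolding \<xi>_def[abs_def] by (intro smooth_add smooth_mult smooth_const)
    qed
    have big: "4 < real (n + N) * (b - a)" for n
    proof -
      have "4 < real N * (b - a)" using N ab by (simp add: field_simps)
      also have "\<dots> \<le> real (n + N) * (b - a)" using ab by (intro mult_right_mono) auto
      finally show ?thesis .
    qed
    have supp: "\<xi> n t = 0" if out: "t \<notin> {a + 1 / real (n + N)..b - 1 / real (n + N)}" for n t
    proof -
      let ?m = "real (n + N)"
      have m: "0 < ?m" using N0 by simp
      consider "t < a + 1 / ?m" | "b - 1 / ?m < t" using out by fastforce
      then show ?thesis
      proof cases
        case 1
        then have "?m * t < ?m * a + 1" using m by (simp add: field_simps)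
        then have "?m * t + (- ?m * a - 2) \<le> -1" "?m * t + (- ?m * b + 2) \<le> -1"
          using big[of n] by (simp_all add: algebra_simps)
        then show ?thesis using \<sigma>(2) unfolding \<xi>_def by simp
      next
        case 2
        then have "?m * b - 1 < ?m * t" using m by (simp add: field_simps)
        then have "1 \<le> ?m * t + (- ?m * a - 2)" "1 \<le> ?m * t + (- ?m * b + 2)"
          using big[of n] by (simp_all add: algebra_simps)
        then show ?thesis using \<sigma>(3) unfolding \<xi>_def by simp
      qed
    qed
    have bump: "\<xi> n \<in> time_bump T" for n
    proof -
      have "0 < a + 1 / real (n + N)" "b - 1 / real (n + N) < T" using ab N0 by (auto intro: add_nonneg_pos) (smt (verit) divide_pos_pos of_nat_0_less_iff add_gr_0 of_nat_add)
      then show ?thesis using sm supp unfolding time_bump_def mem_Collect_eq by blast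
    qed
    have lim: "(\<lambda>n. \<xi> n t) \<longlonglongrightarrow> indicator {a<..<b} t" for t
    proof (cases "t \<in> {a<..<b}")
      case False
      have "t \<notin> {a + 1 / real (n + N)..b - 1 / real (n + N)}" for n
      proof -
        have "0 < 1 / real (n + N)" using N0 by simp
        then show ?thesis using False unfolding atLeastAtMost_iff greaterThanLessThan_iff by linarith
      qed
      then show ?thesis using False supp by simp
    next
      case True
      obtain k where k: "max (3 / (t - a)) (3 / (b - t)) < real k" using reals_Archimedean2 by blast
      have "\<xi> n t = 1" if "k \<le> n" for n
      proof -
        let ?m = "real (n + N)"
        have "3 / (t - a) < ?m" "3 / (b - t) < ?m" using k that by auto
        then have "3 < ?m * (t - a)" "3 < ?m * (b - t)" using True by (auto simp: field_simps)
        then have "1 \<le> ?m * t + (- ?m * a - 2)" "?m * t + (- ?m * b + 2) \<le> -1" by (simp_all add: algebra_simps)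
        then show ?thesis using \<sigma>(2,3) unfolding \<xi>_def by simp
      qed
      then have "\<forall>\<^sub>F n in sequentially. \<xi> n t = 1" unfolding eventually_sequentially by blast
      then show ?thesis using True by (simp add: tendsto_eventually)
    qed
    have bd: "\<bar>\<xi> n t\<bar> \<le> 1" for n t
      using \<sigma>(4,5)[of "real (n + N) * t + (- real (n + N) * a - 2)"] \<sigma>(4,5)[of "real (n + N) * t + (- real (n + N) * b + 2)"]
      unfolding \<xi>_def by linarith
    have "(\<lambda>n. LINT t|time T. \<xi> n t * h t) \<longlonglongrightarrow> (LINT t|time T. indicator {a<..<b} t * h t)"
    proof (rule integral_dominated_convergence[where w="\<lambda>t. \<bar>h t\<bar>"])
      have hm: "h \<in> borel_measurable (time T)" using h by (rule borel_measurable_integrable)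
      have "indicat_real {a<..<b} \<in> borel_measurable (time T)"
        by (rule measurable_restrict_space1, rule measurable_completion) simp
      then show "(\<lambda>t. indicator {a<..<b} t * h t) \<in> borel_measurable (time T)"
        by (rule borel_measurable_times[OF _ hm])
      show "(\<lambda>t. \<xi> n t * h t) \<in> borel_measurable (time T)" for n
        by (rule borel_measurable_integrable[OF time_bump_integrable[OF h sm]])
      show "integrable (time T) (\<lambda>t. \<bar>h t\<bar>)" using h by (rule integrable_abs)
      show "AE t in time T. (\<lambda>n. \<xi> n t * h t) \<longlonglongrightarrow> indicator {a<..<b} t * h t"
        by (intro AE_I2 tendsto_mult lim tendsto_const)
      show "AE t in time T. norm (\<xi> n t * h t) \<le> \<bar>h t\<bar>" for n
        by (intro AE_I2) (use bd[of n] in \<open>simp add: abs_mult mult_left_le_one_le\<close>)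
    qed
    then have "(\<lambda>n::nat. 0) \<longlonglongrightarrow> (LINT t|time T. indicator {a<..<b} t * h t)" by (simp only: z[OF bump])
    then show ?thesis by (simp only: LIMSEQ_const_iff)
  qed
  define F where "F t = indicator {0<..<T} t *\<^sub>R h t" for t
  have "integrable lebesgue F" unfolding F_def using h by (simp add: integrable_restrict_space)
  moreover have "(LINT t:box c d|lebesgue. F t) = 0" for c d
  proof -
    have "(LINT t:box c d|lebesgue. F t) = (LINT t|lebesgue. indicator {0<..<T} t *\<^sub>R (indicator {max 0 c<..<min T d} t * h t))"
      unfolding set_lebesgue_integral_def F_def by (rule Bochner_Integration.integral_cong) (auto simp: indicator_def box_real)
    also have "\<dots> = (LINT t|time T. indicator {max 0 c<..<min T d} t * h t)"
      by (simp add: integral_restrict_space)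
    also have "\<dots> = 0"
    proof (cases "max 0 c < min T d")
      case True then show ?thesis by (intro zero) auto
    next
      case False
      then have "{max 0 c<..<min T d} = {}" by (simp only: greaterThanLessThan_empty_iff not_less)
      then show ?thesis by simp
    qed
    finally show ?thesis .
  qed
  ultimately have "AE t in lebesgue. F t = 0" by (rule AE_zero_if_box_integrals_zero)
  then show ?thesis unfolding F_def by (auto simp: AE_restrict_space_iff elim: AE_mp)
qed

lemma bounded_measurable_integrable:
  fixes g :: "real \<Rightarrow> real"
  assumes "g \<in> borel_measurable lebesgue" "\<And>t. \<bar>g t\<bar> \<le> B"
  shows "g absolutely_integrable_on {s..t}"
  by (rule measurable_bounded_by_integrable_imp_absolutely_integrable[where g="\<lambda>_. B"])
    (use assms in \<open>auto intro: measurable_restrict_space1\<close>)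

lemma constant_if_quadratic_increments:
  fixes H :: "real \<Rightarrow> real"
  assumes H: "\<And>s t. a \<le> s \<Longrightarrow> s \<le> t \<Longrightarrow> t \<le> b \<Longrightarrow> \<bar>H t - H s\<bar> \<le> C * (t - s)\<^sup>2"
    and st: "a \<le> s" "s \<le> t" "t \<le> b"
  shows "H s = H t"
proof -
  have H': "\<bar>H y - H x\<bar> \<le> C * (y - x)\<^sup>2" if "x \<in> {a..b}" "y \<in> {a..b}" for x y
  proof (cases "x \<le> y")
    case True then show ?thesis using H[of x y] that by simp
  next
    case False then show ?thesis using H[of y x] that by (simp add: abs_minus_commute power2_commute)
  qed
  have "(H has_field_derivative 0) (at x within {a..b})" if x: "x \<in> {a..b}" for x
    unfolding has_field_derivative_iff
  proof (rule Lim_null_comparison[where g="\<lambda>y. C * \<bar>y - x\<bar>"])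
    show "\<forall>\<^sub>F y in at x within {a..b}. norm ((H y - H x) / (y - x)) \<le> C * \<bar>y - x\<bar>"
      unfolding eventually_at_filter
    proof (intro always_eventually allI impI)
      fix y assume y: "y \<noteq> x" "y \<in> {a..b}"
      have "\<bar>H y - H x\<bar> \<le> (C * \<bar>y - x\<bar>) * \<bar>y - x\<bar>" using H'[OF x y(2)] by (simp add: power2_eq_square mult.assoc)
      then show "norm ((H y - H x) / (y - x)) \<le> C * \<bar>y - x\<bar>"
        using y by (simp add: pos_divide_le_eq)
    qed
    have "((\<lambda>y. C * \<bar>y - x\<bar>) \<longlongrightarrow> C * \<bar>x - x\<bar>) (at x within {a..b})" by (intro tendsto_intros)
    then show "((\<lambda>y. C * \<bar>y - x\<bar>) \<longlongrightarrow> 0) (at x within {a..b})" by simp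
  qed
  then obtain c where "\<forall>x\<in>{a..b}. H x = c"
    using has_field_derivative_zero_constant[of "{a..b}" H] by (auto simp: convex_real_interval)
  then show ?thesis using st by simp
qed

text \<open>Integration by parts for Lipschitz functions given as primitives of bounded measurable functions. Over a short
interval the increment of \<open>F1 F2\<close> is \<open>F1(t) (F2(t) - F2(s)) + F2(s) (F1(t) - F1(s))\<close>, which differs
from the integral on the right by \<open>O((t - s)\<^sup>2)\<close>; errors of this order do not add up.\<close>

lemma primitive_product:
  fixes F1 F2 g1 g2 :: "real \<Rightarrow> real"
  assumes m: "g1 \<in> borel_measurable lebesgue" "g2 \<in> borel_measurable lebesgue"
    and B: "\<And>t. \<bar>g1 t\<bar> \<le> B" "\<And>t. \<bar>g2 t\<bar> \<le> B"
    and F: "\<And>s t. a \<le> s \<Longrightarrow> s \<le> t \<Longrightarrow> t \<le> b \<Longrightarrow> F1 t - F1 s = integral {s..t} g1"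
      "\<And>s t. a \<le> s \<Longrightarrow> s \<le> t \<Longrightarrow> t \<le> b \<Longrightarrow> F2 t - F2 s = integral {s..t} g2"
    and st: "a \<le> s" "s \<le> t" "t \<le> b"
  shows "F1 t * F2 t - F1 s * F2 s = integral {s..t} (\<lambda>\<tau>. F1 \<tau> * g2 \<tau> + g1 \<tau> * F2 \<tau>)"
proof -
  have gi: "g absolutely_integrable_on {s..t}"
    if "g \<in> borel_measurable lebesgue" "\<And>t. \<bar>g t\<bar> \<le> B" for g :: "real \<Rightarrow> real" and s t
    by (rule bounded_measurable_integrable[OF that])
  have cont: "continuous_on {a..b} F"
    if "g absolutely_integrable_on {a..b}" "\<And>s t. a \<le> s \<Longrightarrow> s \<le> t \<Longrightarrow> t \<le> b \<Longrightarrow> F t - F s = integral {s..t} g"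
    for F g :: "real \<Rightarrow> real"
  proof -
    have "g integrable_on {a..b}" using that(1) by (rule set_lebesgue_integral_eq_integral(1))
    then have "continuous_on {a..b} (\<lambda>x. F a + integral {a..x} g)"
      by (intro continuous_on_add continuous_on_const indefinite_integral_continuous_1)
    then show ?thesis
      by (rule continuous_on_cong[THEN iffD1, OF refl, rotated]) (use that(2)[of a] in force)
  qed
  have Fg: "(\<lambda>\<tau>. F \<tau> * g \<tau>) integrable_on {s..t}"
    if "continuous_on {a..b} F" "g absolutely_integrable_on {s..t}" "a \<le> s" "t \<le> b" for F g :: "real \<Rightarrow> real" and s t
  proof -
    have c: "continuous_on {s..t} F" using that by (elim continuous_on_subset) auto
    have "(\<lambda>\<tau>. F \<tau> * g \<tau>) absolutely_integrable_on {s..t}"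
      by (rule absolutely_integrable_bounded_measurable_product_real[OF continuous_imp_measurable_on_sets_lebesgue[OF c] _ _ that(2)])
        (auto intro: compact_imp_bounded compact_continuous_image c)
    then show ?thesis by (rule set_lebesgue_integral_eq_integral(1))
  qed
  have c1: "continuous_on {a..b} F1" and c2: "continuous_on {a..b} F2"
    by (rule cont[OF gi[OF m(1) B(1)] F(1)]; assumption) (rule cont[OF gi[OF m(2) B(2)] F(2)]; assumption)
  let ?q = "\<lambda>\<tau>. F1 \<tau> * g2 \<tau> + g1 \<tau> * F2 \<tau>"
  have qi: "?q integrable_on {s..t}" if "a \<le> s" "t \<le> b" for s t
  proof -
    have "(\<lambda>\<tau>. F2 \<tau> * g1 \<tau>) integrable_on {s..t}" by (rule Fg[OF c2 gi[OF m(1) B(1)] that])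
    then have "(\<lambda>\<tau>. g1 \<tau> * F2 \<tau>) integrable_on {s..t}" by (simp only: mult.commute)
    then show ?thesis by (intro integrable_add Fg[OF c1 gi[OF m(2) B(2)] that])
  qed
  have B0: "0 \<le> B" using B(1)[of 0] by linarith
  have lip: "\<bar>F t - F s\<bar> \<le> B * (t - s)"
    if "\<And>s t. a \<le> s \<Longrightarrow> s \<le> t \<Longrightarrow> t \<le> b \<Longrightarrow> F t - F s = integral {s..t} g"
      "g \<in> borel_measurable lebesgue" "\<And>t. \<bar>g t\<bar> \<le> B" "a \<le> s" "s \<le> t" "t \<le> b" for F g :: "real \<Rightarrow> real" and s t
  proof -
    have "norm (integral {s..t} g) \<le> integral {s..t} (\<lambda>_. B)"
      by (rule integral_norm_bound_integral) (use that gi[OF that(2,3)] in \<open>auto intro: set_lebesgue_integral_eq_integral(1)\<close>)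
    then show ?thesis using that by (simp add: mult.commute)
  qed
  define H where "H t = F1 t * F2 t - integral {a..t} ?q" for t
  have "H s = H t"
  proof (rule constant_if_quadratic_increments[OF _ st])
    fix s t assume st: "a \<le> s" "s \<le> t" "t \<le> b"
    let ?r = "\<lambda>\<tau>. F1 t * g2 \<tau> + F2 s * g1 \<tau>"
    have g1i: "g1 integrable_on {s..t}" and g2i: "g2 integrable_on {s..t}"
      using gi[OF m(1) B(1)] gi[OF m(2) B(2)] by (blast intro: set_lebesgue_integral_eq_integral(1))+
    have ri: "?r integrable_on {s..t}"
      by (intro integrable_add integrable_on_mult_right g1i g2i)
    have "integral {a..s} ?q + integral {s..t} ?q = integral {a..t} ?q"
      by (rule Henstock_Kurzweil_Integration.integral_combine) (use st qi in auto)
    moreover have "F1 t * F2 t - F1 s * F2 s = integral {s..t} ?r"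
    proof -
      have "integral {s..t} ?r = F1 t * integral {s..t} g2 + F2 s * integral {s..t} g1"
        by (subst Henstock_Kurzweil_Integration.integral_add) (auto intro: integrable_on_mult_right g1i g2i)
      also have "\<dots> = F1 t * (F2 t - F2 s) + F2 s * (F1 t - F1 s)" using F st by simp
      finally show ?thesis by (simp add: algebra_simps)
    qed
    ultimately have "H t - H s = integral {s..t} ?r - integral {s..t} ?q" by (simp add: H_def)
    also have "\<dots> = integral {s..t} (\<lambda>\<tau>. ?r \<tau> - ?q \<tau>)"
      by (rule Henstock_Kurzweil_Integration.integral_diff[symmetric, OF ri qi]) (use st in auto)
    finally have "H t - H s = integral {s..t} (\<lambda>\<tau>. ?r \<tau> - ?q \<tau>)" .
    moreover have "norm (integral {s..t} (\<lambda>\<tau>. ?r \<tau> - ?q \<tau>)) \<le> integral {s..t} (\<lambda>_. 2 * B\<^sup>2 * (t - s))"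
    proof (rule integral_norm_bound_integral)
      show "(\<lambda>\<tau>. ?r \<tau> - ?q \<tau>) integrable_on {s..t}" by (rule integrable_diff[OF ri qi]) (use st in auto)
      fix \<tau> assume \<tau>: "\<tau> \<in> {s..t}"
      have "\<bar>F1 t - F1 \<tau>\<bar> \<le> B * (t - s)"
        using lip[OF F(1) m(1) B(1), of \<tau> t] \<tau> st B0 mult_left_mono[of "t - \<tau>" "t - s" B] by simp
      moreover have "\<bar>F2 s - F2 \<tau>\<bar> \<le> B * (t - s)"
        using lip[OF F(2) m(2) B(2), of s \<tau>] \<tau> st B0 mult_left_mono[of "\<tau> - s" "t - s" B] by (simp add: abs_minus_commute)
      ultimately have "\<bar>F1 t - F1 \<tau>\<bar> * \<bar>g2 \<tau>\<bar> \<le> (B * (t - s)) * B" "\<bar>F2 s - F2 \<tau>\<bar> * \<bar>g1 \<tau>\<bar> \<le> (B * (t - s)) * B"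
        using B[of \<tau>] B0 st by (auto intro!: mult_mono)
      moreover have "?r \<tau> - ?q \<tau> = (F1 t - F1 \<tau>) * g2 \<tau> + (F2 s - F2 \<tau>) * g1 \<tau>" by (simp add: algebra_simps)
      moreover have "\<bar>(F1 t - F1 \<tau>) * g2 \<tau> + (F2 s - F2 \<tau>) * g1 \<tau>\<bar> \<le> \<bar>F1 t - F1 \<tau>\<bar> * \<bar>g2 \<tau>\<bar> + \<bar>F2 s - F2 \<tau>\<bar> * \<bar>g1 \<tau>\<bar>"
        using abs_triangle_ineq by (simp add: abs_mult[symmetric])
      ultimately show "norm (?r \<tau> - ?q \<tau>) \<le> 2 * B\<^sup>2 * (t - s)" by (simp add: power2_eq_square algebra_simps)
    qed auto
    ultimately show "\<bar>H t - H s\<bar> \<le> 2 * B\<^sup>2 * (t - s)\<^sup>2" using st by (simp add: power2_eq_square mult_ac)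
  qed
  moreover have "integral {a..s} ?q + integral {s..t} ?q = integral {a..t} ?q"
    by (rule Henstock_Kurzweil_Integration.integral_combine) (use st qi in auto)
  ultimately show ?thesis by (simp add: H_def)
qed

lemma integrable_time_const: "integrable (time T) (\<lambda>_. c :: real)"
proof -
  have "finite_measure (time T)" by (rule finite_measure_lebesgue_on) simp
  then show ?thesis by (rule finite_measure.integrable_const)
qed

lemma time_integral_eq:
  fixes f :: "real \<Rightarrow> real"
  shows "integrable (time T) f \<Longrightarrow> (LINT t|time T. f t) = integral {0..T} f"
  by (simp add: lebesgue_integral_eq_integral integral_open_interval_real)

lemma time_bump_primitive:
  assumes T: "T > 0" and \<xi>: "\<xi> \<in> time_bump T" and z: "(LINT t|time T. \<xi> t) = 0"
  obtains \<eta> where "\<eta> \<in> time_bump T" "dir_deriv 1 \<eta> = \<xi>"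
proof -
  have sm: "smooth \<xi>" using \<xi> by (simp add: time_bump_def)
  have "\<exists>a b. 0 < a \<and> a \<le> b \<and> b < T \<and> (\<forall>t. t \<notin> {a..b} \<longrightarrow> \<xi> t = 0)"
  proof -
    obtain a b where ab: "0 < a" "b < T" "\<And>t. t \<notin> {a..b} \<Longrightarrow> \<xi> t = 0" using \<xi> unfolding time_bump_def by blast
    show ?thesis
    proof (cases "a \<le> b")
      case True then show ?thesis using ab by blast
    next
      case False
      then have "\<xi> t = 0" for t using ab(3)[of t] by auto
      then show ?thesis using T by (intro exI[of _ "T/2"]) auto
    qed
  qed
  then obtain a b where ab: "0 < a" "a \<le> b" "b < T" and supp: "\<And>t. t \<notin> {a..b} \<Longrightarrow> \<xi> t = 0" by blast
  obtain F where F: "smooth F" "\<And>t. (F has_real_derivative \<xi> t) (at t)"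
    using smooth_antiderivative[OF sm] by blast
  note const = primitive_constant_outside[where F=F and \<xi>=\<xi> and a=a and b=b, OF F(2) supp]
  have left: "F t = F a" if "t \<le> a" for t by (rule const(1)[OF _ that])
  have right: "F t = F b" if "b \<le> t" for t by (rule const(2)[OF _ that])
  have "(\<xi> has_integral (F T - F 0)) {0..T}"
    by (rule fundamental_theorem_of_calculus)
      (use T F(2) in \<open>auto simp: has_real_derivative_iff_has_vector_derivative[symmetric] intro: has_field_derivative_at_within\<close>)
  then have "F T - F 0 = integral {0..T} \<xi>" by (rule integral_unique[symmetric])
  also have "\<dots> = (LINT t|time T. \<xi> t)"
    using time_integral_eq[of T \<xi>] time_bump_integrable[OF integrable_time_const[of T 1] sm] by simp
  finally have "F T = F 0" using z by simp
  then have Fab: "F b = F a" using left[of 0] right[of T] ab by simp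
  define \<eta> where "\<eta> t = F t + (- F a)" for t
  have "dir_deriv 1 \<eta> = \<xi>"
  proof
    fix t
    have "(\<eta> has_real_derivative \<xi> t + 0) (at t)" unfolding \<eta>_def[abs_def] by (intro DERIV_add F(2) DERIV_const)
    then show "dir_deriv 1 \<eta> t = \<xi> t" using dir_deriv_1_eq by simp
  qed
  moreover have "\<eta> t = 0" if "t \<notin> {a..b}" for t
    using that left[of t] right[of t] Fab by (auto simp: \<eta>_def not_le)
  then have "\<eta> \<in> time_bump T"
    unfolding time_bump_def mem_Collect_eq using ab smooth_add[OF F(1) smooth_const[of "- F a"]] by (auto simp: \<eta>_def[abs_def])
  ultimately show ?thesis using that by blast
qed

text \<open>Subtracting a multiple of a fixed bump \<open>\<rho>\<close> from \<open>\<xi>\<close> makes its integral zero, so it is the derivative of a test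
function and the hypothesis applies. Thus \<open>h\<close> minus its \<open>\<rho>\<close>-average is orthogonal to all \<open>\<xi>\<close>.\<close>

lemma du_bois_reymond:
  assumes \<theta>: "lp_cutoff \<theta>" and T: "T > 0" and h: "integrable (time T) h"
    and z: "\<And>\<eta>. \<eta> \<in> time_bump T \<Longrightarrow> (LINT t|time T. dir_deriv 1 \<eta> t * h t) = 0"
  obtains c where "AE t in time T. h t = c"
proof -
  have bi: "integrable (time T) \<xi>" "integrable (time T) (\<lambda>t. \<xi> t * h t)" if "\<xi> \<in> time_bump T" for \<xi>
    using time_bump_integrable[OF integrable_time_const[of T 1], of \<xi>] time_bump_integrable[OF h, of \<xi>] that
    by (simp_all add: time_bump_def)
  have "\<exists>\<rho>\<in>time_bump T. (LINT t|time T. \<rho> t) \<noteq> 0"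
  proof (rule ccontr)
    assume "\<not> ?thesis"
    then have "AE t in time T. (1::real) = 0"
      by (intro fundamental_lemma[OF \<theta> integrable_time_const]) simp
    then have "emeasure (time T) {0<..<T} = 0"
      by (subst AE_iff_measurable[of "{0<..<T}" "time T" "\<lambda>_. False", symmetric]) auto
    then show False using T by (simp add: emeasure_restrict_space)
  qed
  then obtain \<rho> where \<rho>: "\<rho> \<in> time_bump T" "(LINT t|time T. \<rho> t) \<noteq> 0" by blast
  define r where "r = (LINT t|time T. \<rho> t)"
  define c where "c = (LINT t|time T. \<rho> t * h t) / r"
  have hc: "integrable (time T) (\<lambda>t. h t - c)" by (intro Bochner_Integration.integrable_diff h integrable_time_const)
  have "AE t in time T. h t - c = 0"
  proof (rule fundamental_lemma[OF \<theta> hc])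
    fix \<xi> assume \<xi>: "\<xi> \<in> time_bump T"
    define q where "q = (LINT t|time T. \<xi> t) / r"
    define \<zeta> where "\<zeta> t = \<xi> t + (- q) * \<rho> t" for t
    have \<zeta>b: "\<zeta> \<in> time_bump T"
    proof -
      obtain a b where ab: "0 < a" "b < T" "\<And>t. t \<notin> {a..b} \<Longrightarrow> \<xi> t = 0" using \<xi> unfolding time_bump_def by blast
      obtain a' b' where ab': "0 < a'" "b' < T" "\<And>t. t \<notin> {a'..b'} \<Longrightarrow> \<rho> t = 0" using \<rho>(1) unfolding time_bump_def by blast
      have "smooth \<zeta>" unfolding \<zeta>_def[abs_def] using \<xi> \<rho>(1) by (intro smooth_add smooth_mult smooth_const) (auto simp: time_bump_def)
      moreover have "\<zeta> t = 0" if "t \<notin> {min a a'..max b b'}" for t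
      proof -
        have "t \<notin> {a..b}" "t \<notin> {a'..b'}" using that by auto
        then show ?thesis using ab(3)[of t] ab'(3)[of t] by (simp add: \<zeta>_def)
      qed
      moreover have "0 < min a a'" "max b b' < T" using ab ab' by auto
      ultimately show ?thesis unfolding time_bump_def by blast
    qed
    have "(LINT t|time T. \<zeta> t) = (LINT t|time T. \<xi> t) - q * r"
      unfolding \<zeta>_def r_def using bi(1)[OF \<xi>] bi(1)[OF \<rho>(1)] by simp
    also have "\<dots> = 0" using \<rho>(2) by (simp add: q_def r_def)
    finally obtain \<eta> where \<eta>: "\<eta> \<in> time_bump T" "dir_deriv 1 \<eta> = \<zeta>"
      using time_bump_primitive[OF T \<zeta>b] by blast
    have "0 = (LINT t|time T. \<zeta> t * h t)" using z[OF \<eta>(1)] \<eta>(2) by simp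
    also have "\<dots> = (LINT t|time T. \<xi> t * h t + (- q) * (\<rho> t * h t))" by (simp add: \<zeta>_def algebra_simps)
    also have "\<dots> = (LINT t|time T. \<xi> t * h t) - q * (LINT t|time T. \<rho> t * h t)"
      using bi(2)[OF \<xi>] bi(2)[OF \<rho>(1)] by simp
    also have "\<dots> = (LINT t|time T. \<xi> t * h t) - c * (LINT t|time T. \<xi> t)"
      by (simp add: q_def c_def)
    also have "\<dots> = (LINT t|time T. \<xi> t * h t - c * \<xi> t)"
      using bi(2)[OF \<xi>] bi(1)[OF \<xi>] by simp
    finally show "(LINT t|time T. \<xi> t * (h t - c)) = 0" by (simp add: algebra_simps)
  qed
  then have "AE t in time T. h t = c" by eventually_elim simp
  then show ?thesis by (rule that)
qed

lemma AE_time_subinterval: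
  assumes "AE t in time T. P t" "0 < a" "b < T"
  shows "AE t in lebesgue_on {a..b}. P t"
proof -
  have sub: "{a..b} \<subseteq> {0<..<T}" using assms by auto
  have "AE t in lebesgue. t \<in> {0<..<T} \<longrightarrow> P t" using assms(1) by (simp add: AE_restrict_space_iff)
  then have "AE t in lebesgue. t \<in> {a..b} \<longrightarrow> P t"
  proof eventually_elim
    case (elim t) then show ?case using sub by blast
  qed
  then show ?thesis by (simp add: AE_restrict_space_iff)
qed

text \<open>The chain rule for \<open>a\<^sup>2\<close>, where \<open>a\<close> has the bounded weak derivative \<open>g\<close>: up to a null set \<open>a\<close> is the sum \<open>F\<close>
of a primitive of \<open>g\<close> and a constant, by \<open>du_bois_reymond\<close>, and \<open>primitive_product\<close> applies to \<open>F\<close>.\<close>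

lemma square_of_weak_primitive:
  assumes \<theta>: "lp_cutoff \<theta>" and T: "T > 0"
    and a: "integrable (time T) a" and g: "g \<in> borel_measurable (time T)" "AE t in time T. \<bar>g t\<bar> \<le> B"
    and weak: "\<And>\<eta>. \<eta> \<in> time_bump T \<Longrightarrow> (LINT t|time T. dir_deriv 1 \<eta> t * a t + \<eta> t * g t) = 0"
  obtains F where "AE t in time T. a t = F t"
    "\<And>s t. 0 < s \<Longrightarrow> s \<le> t \<Longrightarrow> t < T \<Longrightarrow> (F t)\<^sup>2 - (F s)\<^sup>2 = 2 * (LINT \<tau>|lebesgue_on {s..t}. a \<tau> * g \<tau>)"
    "\<And>s t. 0 < s \<Longrightarrow> s \<le> t \<Longrightarrow> t < T \<Longrightarrow> integrable (lebesgue_on {s..t}) (\<lambda>\<tau>. a \<tau> * g \<tau>)"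
proof -
  define C where "C = max 0 B"
  \<comment> \<open>A version of \<open>g\<close> that is bounded and measurable on the whole line.\<close>
  define g0 where "g0 t = (if t \<in> {0<..<T} then max (- C) (min C (g t)) else 0)" for t
  have gc: "(\<lambda>t. max (- C) (min C (g t))) \<in> borel_measurable (time T)"
    by (intro borel_measurable_max borel_measurable_min g borel_measurable_const)
  have g0m: "g0 \<in> borel_measurable lebesgue"
    unfolding g0_def[abs_def] by (rule borel_measurable_if_I[OF gc]) simp
  have g0B: "\<bar>g0 t\<bar> \<le> C" for t by (auto simp: g0_def C_def indicator_def)
  have g0g: "AE t in time T. g0 t = g t"
    using g(2) AE_space[of "time T"]
    by eventually_elim (auto simp: g0_def C_def)
  define G where "G t = integral {0..t} g0" for t
  have g0i: "g0 integrable_on {s..t}" for s t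
    using bounded_measurable_integrable[OF g0m g0B] by (rule set_lebesgue_integral_eq_integral(1))
  have G: "G t - G s = integral {s..t} g0" if "0 \<le> s" "s \<le> t" "t \<le> T" for s t
    using Henstock_Kurzweil_Integration.integral_combine[OF that(1,2) g0i] by (simp add: G_def)
  have "continuous_on {0..T} G" unfolding G_def[abs_def] by (rule indefinite_integral_continuous_1[OF g0i])
  then have Gc: "continuous_on {0<..<T} G" by (rule continuous_on_subset) auto
  have Gb: "\<bar>G t\<bar> \<le> C * T" if "t \<in> {0<..<T}" for t
  proof -
    have "norm (integral {0..t} g0) \<le> integral {0..t} (\<lambda>_. C)"
      by (rule integral_norm_bound_integral) (use g0B g0i in auto)
    also have "\<dots> \<le> C * T" using that by (simp add: C_def mult.commute mult_mono)
    finally show ?thesis by (simp add: G_def)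
  qed
  have Gi: "integrable (time T) G"
  proof (rule Bochner_Integration.integrable_bound[OF integrable_time_const[of T "C * T"]])
    show "G \<in> borel_measurable (time T)" by (rule continuous_imp_measurable_on_sets_lebesgue[OF Gc]) simp
    show "AE t in time T. norm (G t) \<le> norm (C * T)"
      using Gb by (intro AE_I2) (auto intro: order_trans[OF _ abs_ge_self])
  qed
  have g0ti: "integrable (time T) g0"
  proof (rule Bochner_Integration.integrable_bound[OF integrable_time_const[of T C]])
    show "g0 \<in> borel_measurable (time T)" by (rule measurable_restrict_space1[OF g0m])
    show "AE t in time T. norm (g0 t) \<le> norm C"
      using g0B by (intro AE_I2) (auto intro: order_trans[OF _ abs_ge_self])
  qed
  have gi: "integrable (time T) g"
    using g0ti g0g g(1) integrable_cong_AE[of g0 "time T" g] borel_measurable_integrable by blast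
  have "(LINT t|time T. dir_deriv 1 \<eta> t * (a t - G t)) = 0" if \<eta>: "\<eta> \<in> time_bump T" for \<eta>
  proof -
    have sm: "smooth \<eta>" "smooth (dir_deriv 1 \<eta>)" using \<eta> smooth_dir_deriv[of \<eta> 1] by (auto simp: time_bump_def)
    let ?d = "dir_deriv 1 \<eta>"
    have "bounded (?d ` {0..T})"
      by (intro compact_imp_bounded compact_continuous_image smooth_imp_continuous sm compact_Icc)
    then have "\<exists>D. \<forall>t\<in>{0..T}. \<bar>?d t\<bar> \<le> D" by (simp add: bounded_iff)
    then obtain D where D: "\<And>t. t \<in> {0..T} \<Longrightarrow> \<bar>?d t\<bar> \<le> D" by blast
    define d0 where "d0 t = (if t \<in> {0..T} then ?d t else 0)" for t
    have d0m: "d0 \<in> borel_measurable lebesgue"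
      unfolding d0_def[abs_def]
      by (rule borel_measurable_if_I[OF continuous_imp_measurable_on_sets_lebesgue[OF smooth_imp_continuous[OF sm(2)]]]) auto
    have d0B: "\<bar>d0 t\<bar> \<le> max C D" for t using D[of t] by (auto simp: d0_def C_def)
    have \<eta>F: "\<eta> t - \<eta> s = integral {s..t} d0" if "0 \<le> s" "s \<le> t" "t \<le> T" for s t
    proof -
      have "(?d has_integral (\<eta> t - \<eta> s)) {s..t}"
        by (rule fundamental_theorem_of_calculus)
          (use that smooth_has_real_derivative[OF sm(1)] in \<open>auto simp: has_real_derivative_iff_has_vector_derivative[symmetric] intro: has_field_derivative_at_within\<close>)
      then have "\<eta> t - \<eta> s = integral {s..t} ?d" by (rule integral_unique[symmetric])
      also have "\<dots> = integral {s..t} d0" by (rule Henstock_Kurzweil_Integration.integral_cong) (use that in \<open>auto simp: d0_def\<close>)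
      finally show ?thesis .
    qed
    have "G T * \<eta> T - G 0 * \<eta> 0 = integral {0..T} (\<lambda>t. G t * d0 t + g0 t * \<eta> t)"
      by (rule primitive_product[OF g0m d0m _ d0B G \<eta>F]) (use T order_trans[OF g0B max.cobounded1[of C D]] in auto)
    moreover have "\<eta> T = 0" "\<eta> 0 = 0" using \<eta> by (auto simp: time_bump_def)
    ultimately have "0 = integral {0..T} (\<lambda>t. G t * d0 t + g0 t * \<eta> t)" by simp
    also have "\<dots> = integral {0..T} (\<lambda>t. ?d t * G t + \<eta> t * g0 t)"
      by (rule Henstock_Kurzweil_Integration.integral_cong) (simp add: d0_def mult.commute)
    also have "\<dots> = (LINT t|time T. ?d t * G t + \<eta> t * g0 t)"
      by (rule time_integral_eq[symmetric]) (intro Bochner_Integration.integrable_add time_bump_integrable Gi g0ti sm)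
    also have "\<dots> = (LINT t|time T. ?d t * G t) + (LINT t|time T. \<eta> t * g0 t)"
      by (rule Bochner_Integration.integral_add[OF time_bump_integrable[OF Gi sm(2)] time_bump_integrable[OF g0ti sm(1)]])
    also have "(LINT t|time T. \<eta> t * g0 t) = (LINT t|time T. \<eta> t * g t)"
    proof (rule integral_cong_AE)
      show "AE t in time T. \<eta> t * g0 t = \<eta> t * g t" using g0g by eventually_elim simp
    qed (rule borel_measurable_integrable[OF time_bump_integrable[OF _ sm(1)]], rule g0ti gi)+
    finally have 1: "(LINT t|time T. ?d t * G t) = - (LINT t|time T. \<eta> t * g t)" by simp
    have "(LINT t|time T. ?d t * a t) + (LINT t|time T. \<eta> t * g t) = 0"
      using weak[OF \<eta>] Bochner_Integration.integral_add[OF time_bump_integrable[OF a sm(2)] time_bump_integrable[OF gi sm(1)]] by simp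
    then show ?thesis
      using 1 Bochner_Integration.integral_diff[OF time_bump_integrable[OF a sm(2)] time_bump_integrable[OF Gi sm(2)]]
      by (simp add: right_diff_distrib)
  qed
  then obtain c where c: "AE t in time T. a t - G t = c"
    using du_bois_reymond[OF \<theta> T Bochner_Integration.integrable_diff[OF a Gi]] by blast
  define F where "F t = G t + c" for t
  have aF: "AE t in time T. a t = F t" using c by eventually_elim (simp add: F_def)
  have Fdiff: "F t - F s = integral {s..t} g0" if "0 \<le> s" "s \<le> t" "t \<le> T" for s t
    using G[OF that] by (simp add: F_def)
  have agF: "AE \<tau> in lebesgue_on {s..t}. F \<tau> * g0 \<tau> = a \<tau> * g \<tau>" if "0 < s" "t < T" for s t
    using AE_time_subinterval[OF aF that] AE_time_subinterval[OF g0g that] by eventually_elim simp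
  have Fg0i: "integrable (lebesgue_on {s..t}) (\<lambda>\<tau>. F \<tau> * g0 \<tau>)" if "0 < s" "t < T" for s t
  proof -
    have c: "continuous_on {s..t} F" unfolding F_def[abs_def]
      by (intro continuous_on_add continuous_on_const continuous_on_subset[OF Gc]) (use that in auto)
    have "(\<lambda>\<tau>. F \<tau> * g0 \<tau>) absolutely_integrable_on {s..t}"
      by (rule absolutely_integrable_bounded_measurable_product_real[OF continuous_imp_measurable_on_sets_lebesgue[OF c] _ _ bounded_measurable_integrable[OF g0m g0B]])
        (auto intro: compact_imp_bounded compact_continuous_image c)
    then show ?thesis by (simp add: integrable_restrict_space set_integrable_def)
  qed
  have agm: "(\<lambda>\<tau>. a \<tau> * g \<tau>) \<in> borel_measurable (lebesgue_on {s..t})" if "0 < s" "t < T" for s t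
  proof -
    have "(\<lambda>\<tau>. a \<tau> * g \<tau>) \<in> borel_measurable (time T)" using a g(1) by (intro borel_measurable_times) auto
    then show ?thesis by (rule measurable_restrict_mono) (use that in auto)
  qed
  show ?thesis
  proof (rule that[OF aF])
    fix s t assume st: "0 < s" "s \<le> t" "t < T"
    have "F t * F t - F s * F s = integral {s..t} (\<lambda>\<tau>. F \<tau> * g0 \<tau> + g0 \<tau> * F \<tau>)"
      by (rule primitive_product[OF g0m g0m g0B g0B Fdiff Fdiff, where a=0 and b=T]) (use st in auto)
    also have "\<dots> = integral {s..t} (\<lambda>\<tau>. 2 * (F \<tau> * g0 \<tau>))" by (simp add: mult.commute)
    also have "\<dots> = 2 * integral {s..t} (\<lambda>\<tau>. F \<tau> * g0 \<tau>)" by simp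
    also have "integral {s..t} (\<lambda>\<tau>. F \<tau> * g0 \<tau>) = (LINT \<tau>|lebesgue_on {s..t}. F \<tau> * g0 \<tau>)"
      by (rule lebesgue_integral_eq_integral[symmetric]) (use st Fg0i in auto)
    also have "\<dots> = (LINT \<tau>|lebesgue_on {s..t}. a \<tau> * g \<tau>)"
      by (rule integral_cong_AE[OF borel_measurable_integrable[OF Fg0i] agm agF]) (use st in auto)
    finally show "(F t)\<^sup>2 - (F s)\<^sup>2 = 2 * (LINT \<tau>|lebesgue_on {s..t}. a \<tau> * g \<tau>)" by (simp add: power2_eq_square)
    show "integrable (lebesgue_on {s..t}) (\<lambda>\<tau>. a \<tau> * g \<tau>)"
    proof -
      have "integrable (lebesgue_on {s..t}) (\<lambda>\<tau>. F \<tau> * g0 \<tau>) \<longleftrightarrow> integrable (lebesgue_on {s..t}) (\<lambda>\<tau>. a \<tau> * g \<tau>)"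
        by (rule integrable_cong_AE[OF borel_measurable_integrable[OF Fg0i] agm agF]) (use st in auto)
      then show ?thesis using Fg0i st by simp
    qed
  qed
qed

section \<open>The flux of energy\<close>

definition I3 :: "(real^3 \<Rightarrow> real) \<Rightarrow> (real^3 \<Rightarrow> real) \<Rightarrow> (real^3 \<Rightarrow> real) \<Rightarrow> real" where
  "I3 a b c = (LINT x|torus. a x * b x * c x)"

text \<open>The transport terms of the weak formulation for the test function \<open>\<phi>\<close> times the \<open>l\<close>-th unit vector; \<open>D k\<close>
stands for \<open>\<partial>\<^sub>k f\<close>.\<close>

definition flux :: "real \<Rightarrow> (real^3 \<Rightarrow> real^3) \<Rightarrow> (3 \<Rightarrow> real^3 \<Rightarrow> real^3) \<Rightarrow> 3 \<Rightarrow> (real^3 \<Rightarrow> real) \<Rightarrow> real" where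
  "flux \<alpha> f D l \<phi> = (\<Sum>i\<in>UNIV. I3 (\<lambda>x. f x $ i) (\<lambda>x. f x $ l) (pd i \<phi>))
     + \<alpha>\<^sup>2 * (\<Sum>i\<in>UNIV. \<Sum>k\<in>UNIV. I3 (\<lambda>x. D k x $ i) (\<lambda>x. D k x $ l) (pd i \<phi>)
                                 + I3 (\<lambda>x. D k x $ i) (\<lambda>x. f x $ l) (pd i (pd k \<phi>)))"

text \<open>With \<open>M\<close> in \<open>L\<^sup>3\<close>, three sequences that converge in this sense can be multiplied under the integral.\<close>

definition dominated_conv :: "(real^3 \<Rightarrow> real) \<Rightarrow> (nat \<Rightarrow> real^3 \<Rightarrow> real) \<Rightarrow> (real^3 \<Rightarrow> real) \<Rightarrow> bool" where
  "dominated_conv M a A \<longleftrightarrow> (\<forall>J. a J \<in> borel_measurable torus) \<and> A \<in> borel_measurable torus \<and>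
     (AE x in torus. (\<forall>J. \<bar>a J x\<bar> \<le> M x) \<and> (\<lambda>J. a J x) \<longlonglongrightarrow> A x)"

lemma dominated_conv_mono:
  assumes "dominated_conv M a A" "\<And>x. M x \<le> M' x"
  shows "dominated_conv M' a A"
proof -
  have "AE x in torus. (\<forall>J. \<bar>a J x\<bar> \<le> M' x) \<and> (\<lambda>J. a J x) \<longlonglongrightarrow> A x"
  proof -
    have "AE x in torus. (\<forall>J. \<bar>a J x\<bar> \<le> M x) \<and> (\<lambda>J. a J x) \<longlonglongrightarrow> A x" using assms(1) by (simp add: dominated_conv_def)
    then show ?thesis
    proof eventually_elim
      case (elim x) then show ?case using assms(2)[of x] order_trans by blast
    qed
  qed
  then show ?thesis using assms(1) by (simp add: dominated_conv_def)
qed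

lemma dominated_conv_bound:
  assumes "dominated_conv M a A"
  shows "AE x in torus. \<bar>A x\<bar> \<le> M x"
proof -
  have "AE x in torus. (\<forall>J. \<bar>a J x\<bar> \<le> M x) \<and> (\<lambda>J. a J x) \<longlonglongrightarrow> A x" using assms by (simp add: dominated_conv_def)
  then show ?thesis
  proof eventually_elim
    case (elim x)
    have "(\<lambda>J. \<bar>a J x\<bar>) \<longlonglongrightarrow> \<bar>A x\<bar>" using elim by (intro tendsto_rabs) blast
    then show ?case by (rule LIMSEQ_le_const2) (use elim in blast)
  qed
qed

lemma dominated_conv_limit: "dominated_conv M a A \<Longrightarrow> dominated_conv M (\<lambda>_. A) A"
  using dominated_conv_bound[of M a A] unfolding dominated_conv_def by simp

lemma I3_integrable:
  assumes M: "integrable torus (\<lambda>x. M x ^ 3)"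
    and a: "a \<in> borel_measurable torus" "AE x in torus. \<bar>a x\<bar> \<le> M x"
    and b: "b \<in> borel_measurable torus" "AE x in torus. \<bar>b x\<bar> \<le> M x"
    and c: "c \<in> borel_measurable torus" "AE x in torus. \<bar>c x\<bar> \<le> M x"
  shows "integrable torus (\<lambda>x. a x * b x * c x)" "\<bar>I3 a b c\<bar> \<le> (LINT x|torus. M x ^ 3)"
proof -
  have AE: "AE x in torus. \<bar>a x * b x * c x\<bar> \<le> M x ^ 3"
    using a(2) b(2) c(2)
  proof eventually_elim
    case (elim x)
    have "\<bar>a x\<bar> * \<bar>b x\<bar> * \<bar>c x\<bar> \<le> M x * M x * M x"
      using elim by (intro mult_mono) (auto intro: order_trans[OF abs_ge_zero] mult_nonneg_nonneg)
    then show ?case by (simp add: abs_mult power3_eq_cube)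
  qed
  show i: "integrable torus (\<lambda>x. a x * b x * c x)"
  proof (rule Bochner_Integration.integrable_bound[OF M])
    show "AE x in torus. norm (a x * b x * c x) \<le> norm (M x ^ 3)"
      using AE
    proof eventually_elim
      case (elim x) then show ?case using abs_ge_self[of "M x ^ 3"] by simp
    qed
  qed (intro borel_measurable_times a b c)
  have "norm (I3 a b c) \<le> (LINT x|torus. norm (a x * b x * c x))"
    unfolding I3_def by (rule integral_norm_bound)
  also have "\<dots> \<le> (LINT x|torus. M x ^ 3)"
    by (rule integral_mono_AE) (use i M AE in auto)
  finally show "\<bar>I3 a b c\<bar> \<le> (LINT x|torus. M x ^ 3)" by simp
qed

lemma dominated_convD:
  assumes "dominated_conv M a A"
  shows "a J \<in> borel_measurable torus" "A \<in> borel_measurable torus" "AE x in torus. \<bar>a J x\<bar> \<le> M x"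
    "AE x in torus. (\<lambda>J. a J x) \<longlonglongrightarrow> A x"
proof -
  have AE: "AE x in torus. (\<forall>J. \<bar>a J x\<bar> \<le> M x) \<and> (\<lambda>J. a J x) \<longlonglongrightarrow> A x" using assms by (simp add: dominated_conv_def)
  then show "AE x in torus. \<bar>a J x\<bar> \<le> M x" by eventually_elim blast
  from AE show "AE x in torus. (\<lambda>J. a J x) \<longlonglongrightarrow> A x" by eventually_elim blast
qed (use assms in \<open>simp_all add: dominated_conv_def\<close>)

lemma I3_tendsto:
  assumes M: "integrable torus (\<lambda>x. M x ^ 3)"
    and a: "dominated_conv M a A" and b: "dominated_conv M b B" and c: "dominated_conv M c C"
  shows "(\<lambda>J. I3 (a J) (b J) (c J)) \<longlonglongrightarrow> I3 A B C"
  unfolding I3_def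
proof (rule integral_dominated_convergence[OF _ _ M])
  show "(\<lambda>x. A x * B x * C x) \<in> borel_measurable torus"
    by (intro borel_measurable_times dominated_convD(2)[OF a] dominated_convD(2)[OF b] dominated_convD(2)[OF c])
  show "(\<lambda>x. a J x * b J x * c J x) \<in> borel_measurable torus" for J
    by (intro borel_measurable_times dominated_convD(1)[OF a] dominated_convD(1)[OF b] dominated_convD(1)[OF c])
  show "AE x in torus. (\<lambda>J. a J x * b J x * c J x) \<longlonglongrightarrow> A x * B x * C x"
    using dominated_convD(4)[OF a] dominated_convD(4)[OF b] dominated_convD(4)[OF c]
    by eventually_elim (intro tendsto_mult)
  show "AE x in torus. norm (a J x * b J x * c J x) \<le> M x ^ 3" for J
    using dominated_convD(3)[OF a, of J] dominated_convD(3)[OF b, of J] dominated_convD(3)[OF c, of J]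
  proof eventually_elim
    case (elim x)
    have "\<bar>a J x\<bar> * \<bar>b J x\<bar> * \<bar>c J x\<bar> \<le> M x * M x * M x"
      using elim by (intro mult_mono) (auto intro: order_trans[OF abs_ge_zero] mult_nonneg_nonneg)
    then show ?case by (simp add: abs_mult power3_eq_cube)
  qed
qed

text \<open>What the cancellation in the flux requires of the approximations of \<open>f\<close>; the Littlewood-Paley sums provide it.\<close>

locale divergence_free_approximation =
  fixes f :: "real^3 \<Rightarrow> real^3" and D :: "3 \<Rightarrow> real^3 \<Rightarrow> real^3"
    and W :: "nat \<Rightarrow> 3 \<Rightarrow> real^3 \<Rightarrow> real" and M :: "real^3 \<Rightarrow> real"
  assumes M3: "integrable torus (\<lambda>x. M x ^ 3)" and Mm: "M \<in> borel_measurable torus"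
    and W: "\<And>l. dominated_conv M (\<lambda>J. W J l) (\<lambda>x. f x $ l)"
    and dW: "\<And>i l. dominated_conv M (\<lambda>J. pd i (W J l)) (\<lambda>x. D i x $ l)"
    and smooth_W: "\<And>J l. smooth (W J l)" and periodic_W: "\<And>J l. periodic (W J l)"
    and div_W: "\<And>J x. (\<Sum>i\<in>UNIV. pd i (W J i) x) = 0"
    and div_dW: "\<And>J k x. (\<Sum>i\<in>UNIV. pd i (pd k (W J i)) x) = 0"
    and wd: "\<And>i. has_weak_deriv i f (D i)"
begin

lemma f_integrable: "integrable torus f"
  using wd Lp_space_1_integrable unfolding has_weak_deriv_def by blast

text \<open>Room for a bounded factor: with a constant added to the majorant, a fixed smooth function is dominated by it as well.\<close>

lemma enlarged_majorant:
  fixes K :: real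
  assumes "0 \<le> K"
  shows "integrable torus (\<lambda>x. (\<bar>M x\<bar> + K) ^ 3)"
proof (rule Bochner_Integration.integrable_bound)
  have c: "integrable torus (\<lambda>_. 4 * K ^ 3)" by (intro continuous_integrable_torus continuous_on_const)
  show "integrable torus (\<lambda>x. 4 * \<bar>M x ^ 3\<bar> + 4 * K ^ 3)"
    by (rule Bochner_Integration.integrable_add[OF integrable_mult_right[OF integrable_abs[OF M3]] c])
  show "(\<lambda>x. (\<bar>M x\<bar> + K) ^ 3) \<in> borel_measurable torus" using Mm by measurable
  have "(m + K) ^ 3 \<le> 4 * m ^ 3 + 4 * K ^ 3" if "0 \<le> m" for m :: real
  proof -
    have "(\<Sum>q\<in>{True, False}. 1 * (if q then m else K)) ^ 3 \<le> (\<Sum>q\<in>{True, False}. 1)\<^sup>2 * (\<Sum>q\<in>{True, False}. 1 * (if q then m else K) ^ 3)"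
      by (rule sum_cube_jensen) (use that assms in auto)
    then show ?thesis by simp
  qed
  from this[OF abs_ge_zero] show "AE x in torus. norm ((\<bar>M x\<bar> + K) ^ 3) \<le> norm (4 * \<bar>M x ^ 3\<bar> + 4 * K ^ 3)"
    using assms by (intro AE_I2) (simp add: power_abs)
qed

lemma dominated_conv_enlarge: "0 \<le> K \<Longrightarrow> dominated_conv M a A \<Longrightarrow> dominated_conv (\<lambda>x. \<bar>M x\<bar> + K) a A"
  by (erule dominated_conv_mono) (simp add: abs_ge_self add_increasing2)

lemma dominated_conv_smooth:
  assumes "smooth q" "\<And>x. x \<in> cbox 0 1 \<Longrightarrow> \<bar>q x\<bar> \<le> K"
  shows "dominated_conv (\<lambda>x. \<bar>M x\<bar> + K) (\<lambda>_. q) q"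
proof -
  have "\<bar>q x\<bar> \<le> \<bar>M x\<bar> + K" if "x \<in> space torus" for x
    using assms(2)[of x] that by (simp add: add_increasing)
  then have "AE x in torus. \<bar>q x\<bar> \<le> \<bar>M x\<bar> + K" by (rule AE_I2)
  then show ?thesis unfolding dominated_conv_def using smooth_measurable_torus[OF assms(1)] by simp
qed

text \<open>The weak derivatives of \<open>f\<^sub>j\<close> are tested with the products \<open>g\<^sub>i q\<close>; the terms with \<open>\<partial>\<^sub>i g\<^sub>i\<close> add up to zero.\<close>

lemma weak_product_rule:
  assumes g: "\<And>i. smooth (g i)" "\<And>i. periodic (g i)" and div: "\<And>x. (\<Sum>i\<in>UNIV. pd i (g i) x) = 0"
    and q: "smooth q" "periodic q"
  shows "(\<Sum>i\<in>UNIV. I3 (g i) (\<lambda>x. f x $ j) (pd i q)) = - (\<Sum>i\<in>UNIV. I3 (g i) (\<lambda>x. D i x $ j) q)"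
proof -
  have fj: "integrable torus (\<lambda>x. f x $ j)" by (rule integrable_vec_nth[OF f_integrable])
  have eq: "(LINT x|torus. (g i x * pd i q x + pd i (g i) x * q x) * f x $ j) = - I3 (g i) (\<lambda>x. D i x $ j) q" for i
  proof -
    have sm: "smooth (\<lambda>x. g i x * q x)" by (rule smooth_mult[OF g(1) q(1)])
    have "periodic (\<lambda>x. g i x * q x)" using g(2)[of i] q(2) by (simp add: periodic_def)
    from weak_deriv_nth[OF wd sm this, of i j]
    have "(LINT x|torus. pd i (\<lambda>x. g i x * q x) x * f x $ j) = - (LINT x|torus. g i x * q x * D i x $ j)" .
    moreover have "(LINT x|torus. g i x * q x * D i x $ j) = I3 (g i) (\<lambda>x. D i x $ j) q"
      unfolding I3_def by (rule Bochner_Integration.integral_cong[OF refl]) simp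
    ultimately show ?thesis unfolding dir_deriv_mult[OF g(1) q(1)] by simp
  qed
  have i1: "integrable torus (\<lambda>x. g i x * f x $ j * pd i q x)" for i
    using integrable_mult_smooth[OF integrable_mult_smooth[OF fj g(1)[of i]] smooth_pd[OF q(1)]] by (simp add: mult.commute)
  have i2: "integrable torus (\<lambda>x. pd i (g i) x * (q x * f x $ j))" for i
    using integrable_mult_smooth[OF integrable_mult_smooth[OF fj q(1)] smooth_pd[OF g(1)[of i]]] by (simp add: mult_ac)
  have "(LINT x|torus. (g i x * pd i q x + pd i (g i) x * q x) * f x $ j)
      = I3 (g i) (\<lambda>x. f x $ j) (pd i q) + (LINT x|torus. pd i (g i) x * (q x * f x $ j))" for i
    unfolding I3_def Bochner_Integration.integral_add[OF i1 i2, symmetric]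
    by (rule Bochner_Integration.integral_cong[OF refl]) (simp add: algebra_simps)
  then have "I3 (g i) (\<lambda>x. f x $ j) (pd i q) + (LINT x|torus. pd i (g i) x * (q x * f x $ j)) = - I3 (g i) (\<lambda>x. D i x $ j) q" for i
    using eq[of i] by simp
  then have "(\<Sum>i\<in>UNIV. I3 (g i) (\<lambda>x. f x $ j) (pd i q)) + (\<Sum>i\<in>UNIV. LINT x|torus. pd i (g i) x * (q x * f x $ j))
    = - (\<Sum>i\<in>UNIV. I3 (g i) (\<lambda>x. D i x $ j) q)"
    by (simp add: sum.distrib[symmetric] sum_negf[symmetric])
  moreover have "(\<Sum>i\<in>UNIV. LINT x|torus. pd i (g i) x * (q x * f x $ j)) = 0"
    unfolding Bochner_Integration.integral_sum[OF i2, symmetric] sum_distrib_right[symmetric] div by simp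
  ultimately show ?thesis by simp
qed

text \<open>This step saves a derivative. It is the weak product rule with the divergence-free field \<open>\<partial>\<^sub>k f\<close> as weight, which is not smooth
and is therefore replaced by \<open>\<partial>\<^sub>k W\<close> first.\<close>

lemma second_derivative_term:
  assumes w: "smooth w" "periodic w"
  shows "(\<Sum>i\<in>UNIV. I3 (\<lambda>x. D k x $ i) (\<lambda>x. f x $ j) (pd i (pd k w))) = - (\<Sum>i\<in>UNIV. I3 (\<lambda>x. D k x $ i) (\<lambda>x. D i x $ j) (pd k w))"
proof -
  have sq: "smooth (pd k w)" "smooth (pd i (pd k w))" for i by (intro smooth_pd w)+
  have lim: "(\<lambda>L. I3 (a L) (b L) q) \<longlonglongrightarrow> I3 A B q"
    if ab: "dominated_conv M a A" "dominated_conv M b B" and q: "smooth q" for a b A B q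
  proof -
    obtain K where K: "0 \<le> K" "\<And>x. x \<in> cbox 0 1 \<Longrightarrow> \<bar>q x\<bar> \<le> K" using smooth_bounded_cube[OF q] by blast
    show ?thesis
      by (rule I3_tendsto[OF enlarged_majorant[OF K(1)] dominated_conv_enlarge[OF K(1) ab(1)] dominated_conv_enlarge[OF K(1) ab(2)] dominated_conv_smooth[OF q K(2)]])
  qed
  have l1: "(\<lambda>L. \<Sum>i\<in>UNIV. I3 (pd k (W L i)) (\<lambda>x. f x $ j) (pd i (pd k w))) \<longlonglongrightarrow> (\<Sum>i\<in>UNIV. I3 (\<lambda>x. D k x $ i) (\<lambda>x. f x $ j) (pd i (pd k w)))"
    by (intro tendsto_sum lim[OF dW dominated_conv_limit[OF W]] sq)
  have l2: "(\<lambda>L. - (\<Sum>i\<in>UNIV. I3 (pd k (W L i)) (\<lambda>x. D i x $ j) (pd k w))) \<longlonglongrightarrow> - (\<Sum>i\<in>UNIV. I3 (\<lambda>x. D k x $ i) (\<lambda>x. D i x $ j) (pd k w))"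
    by (intro tendsto_minus tendsto_sum lim[OF dW dominated_conv_limit[OF dW]] sq)
  have "(\<Sum>i\<in>UNIV. I3 (pd k (W L i)) (\<lambda>x. f x $ j) (pd i (pd k w))) = - (\<Sum>i\<in>UNIV. I3 (pd k (W L i)) (\<lambda>x. D i x $ j) (pd k w))" for L
    by (rule weak_product_rule) (intro smooth_pd periodic_pd smooth_W periodic_W w div_dW)+
  with l1 l2 show ?thesis by (simp only: LIMSEQ_unique)
qed

text \<open>Transport by a divergence-free field is antisymmetric: the weak product rule with weight \<open>W\<close> and \<open>q = W\<^sub>j\<close>
gives, in the limit, that the sum equals its own negative.\<close>

lemma transport_term_zero:
  "(\<Sum>i\<in>UNIV. I3 (\<lambda>x. f x $ i) (\<lambda>x. f x $ j) (\<lambda>x. D i x $ j)) = 0"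
proof -
  have l1: "(\<lambda>L. \<Sum>i\<in>UNIV. I3 (W L i) (\<lambda>x. f x $ j) (pd i (W L j))) \<longlonglongrightarrow> (\<Sum>i\<in>UNIV. I3 (\<lambda>x. f x $ i) (\<lambda>x. f x $ j) (\<lambda>x. D i x $ j))"
    by (intro tendsto_sum I3_tendsto[OF M3 W dominated_conv_limit[OF W] dW])
  have l2: "(\<lambda>L. - (\<Sum>i\<in>UNIV. I3 (W L i) (\<lambda>x. D i x $ j) (W L j))) \<longlonglongrightarrow> - (\<Sum>i\<in>UNIV. I3 (\<lambda>x. f x $ i) (\<lambda>x. D i x $ j) (\<lambda>x. f x $ j))"
    by (intro tendsto_minus tendsto_sum I3_tendsto[OF M3 W dominated_conv_limit[OF dW] W])
  have "(\<Sum>i\<in>UNIV. I3 (W L i) (\<lambda>x. f x $ j) (pd i (W L j))) = - (\<Sum>i\<in>UNIV. I3 (W L i) (\<lambda>x. D i x $ j) (W L j))" for L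
    by (rule weak_product_rule) (intro smooth_W periodic_W div_W)+
  then have "(\<Sum>i\<in>UNIV. I3 (\<lambda>x. f x $ i) (\<lambda>x. f x $ j) (\<lambda>x. D i x $ j)) = - (\<Sum>i\<in>UNIV. I3 (\<lambda>x. f x $ i) (\<lambda>x. D i x $ j) (\<lambda>x. f x $ j))"
    using l1 l2 LIMSEQ_unique by (simp only:) blast
  moreover have "I3 (\<lambda>x. f x $ i) (\<lambda>x. D i x $ j) (\<lambda>x. f x $ j) = I3 (\<lambda>x. f x $ i) (\<lambda>x. f x $ j) (\<lambda>x. D i x $ j)" for i
    unfolding I3_def by (rule Bochner_Integration.integral_cong[OF refl]) simp
  ultimately show ?thesis by simp
qed

definition reduced_flux :: "real \<Rightarrow> 3 \<Rightarrow> (3 \<Rightarrow> real^3 \<Rightarrow> real) \<Rightarrow> real" where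
  "reduced_flux \<alpha> l h = (\<Sum>i\<in>UNIV. I3 (\<lambda>x. f x $ i) (\<lambda>x. f x $ l) (h i))
     + \<alpha>\<^sup>2 * (\<Sum>i\<in>UNIV. \<Sum>k\<in>UNIV. I3 (\<lambda>x. D k x $ i) (\<lambda>x. D k x $ l) (h i)
                                 - I3 (\<lambda>x. D k x $ i) (\<lambda>x. D i x $ l) (h k))"

lemma flux_eq_reduced:
  assumes w: "smooth w" "periodic w"
  shows "flux \<alpha> f D l w = reduced_flux \<alpha> l (\<lambda>i. pd i w)"
proof -
  have "(\<Sum>i\<in>UNIV. \<Sum>k\<in>UNIV. I3 (\<lambda>x. D k x $ i) (\<lambda>x. f x $ l) (pd i (pd k w)))
    = (\<Sum>k\<in>UNIV. \<Sum>i\<in>UNIV. I3 (\<lambda>x. D k x $ i) (\<lambda>x. f x $ l) (pd i (pd k w)))" by (rule sum.swap)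
  also have "\<dots> = (\<Sum>k\<in>UNIV. - (\<Sum>i\<in>UNIV. I3 (\<lambda>x. D k x $ i) (\<lambda>x. D i x $ l) (pd k w)))"
    by (rule sum.cong[OF refl]) (rule second_derivative_term[OF w])
  also have "\<dots> = - (\<Sum>k\<in>UNIV. \<Sum>i\<in>UNIV. I3 (\<lambda>x. D k x $ i) (\<lambda>x. D i x $ l) (pd k w))" by (rule sum_negf)
  also have "(\<Sum>k\<in>UNIV. \<Sum>i\<in>UNIV. I3 (\<lambda>x. D k x $ i) (\<lambda>x. D i x $ l) (pd k w))
    = (\<Sum>i\<in>UNIV. \<Sum>k\<in>UNIV. I3 (\<lambda>x. D k x $ i) (\<lambda>x. D i x $ l) (pd k w))" by (rule sum.swap)
  finally show ?thesis unfolding flux_def reduced_flux_def sum.distrib sum_subtractf by simp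
qed

lemma flux_bound: "\<bar>flux \<alpha> f D l (W J l)\<bar> \<le> (3 + 18 * \<alpha>\<^sup>2) * (LINT x|torus. M x ^ 3)"
proof -
  note fb = dominated_convD(2)[OF W] dominated_conv_bound[OF W]
  note Db = dominated_convD(2)[OF dW] dominated_conv_bound[OF dW]
  note wb = dominated_convD(1)[OF dW] dominated_convD(3)[OF dW]
  let ?m = "LINT x|torus. M x ^ 3"
  have 1: "\<bar>I3 (\<lambda>x. f x $ i) (\<lambda>x. f x $ l) (pd i (W J l))\<bar> \<le> ?m" for i
    by (rule I3_integrable(2)[OF M3 fb fb wb])
  have 2: "\<bar>I3 (\<lambda>x. D k x $ i) (\<lambda>x. D k' x $ l) (pd i' (W J l))\<bar> \<le> ?m" for i i' k k'
    by (rule I3_integrable(2)[OF M3 Db Db wb])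
  have "\<bar>\<Sum>i\<in>UNIV. I3 (\<lambda>x. f x $ i) (\<lambda>x. f x $ l) (pd i (W J l))\<bar> \<le> (\<Sum>i\<in>(UNIV::3 set). ?m)"
    by (rule order_trans[OF sum_abs sum_mono]) (rule 1)
  then have A: "\<bar>\<Sum>i\<in>UNIV. I3 (\<lambda>x. f x $ i) (\<lambda>x. f x $ l) (pd i (W J l))\<bar> \<le> 3 * ?m" by simp
  have "\<bar>\<Sum>i\<in>UNIV. \<Sum>k\<in>UNIV. I3 (\<lambda>x. D k x $ i) (\<lambda>x. D k x $ l) (pd i (W J l)) - I3 (\<lambda>x. D k x $ i) (\<lambda>x. D i x $ l) (pd k (W J l))\<bar>
    \<le> (\<Sum>i\<in>(UNIV::3 set). \<Sum>k\<in>(UNIV::3 set). 2 * ?m)"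
  proof (rule order_trans[OF sum_abs sum_mono], rule order_trans[OF sum_abs sum_mono])
    fix i k :: 3
    show "\<bar>I3 (\<lambda>x. D k x $ i) (\<lambda>x. D k x $ l) (pd i (W J l)) - I3 (\<lambda>x. D k x $ i) (\<lambda>x. D i x $ l) (pd k (W J l))\<bar> \<le> 2 * ?m"
      using 2[of k i k i] 2[of k i i k] by linarith
  qed
  then have B: "\<bar>\<Sum>i\<in>UNIV. \<Sum>k\<in>UNIV. I3 (\<lambda>x. D k x $ i) (\<lambda>x. D k x $ l) (pd i (W J l)) - I3 (\<lambda>x. D k x $ i) (\<lambda>x. D i x $ l) (pd k (W J l))\<bar> \<le> 18 * ?m"
    by simp
  have "\<bar>reduced_flux \<alpha> l (\<lambda>i. pd i (W J l))\<bar> \<le> 3 * ?m + \<alpha>\<^sup>2 * (18 * ?m)"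
    unfolding reduced_flux_def
    by (rule order_trans[OF abs_triangle_ineq add_mono[OF A]]) (simp only: abs_mult abs_power2, rule mult_left_mono[OF B zero_le_power2])
  then show ?thesis unfolding flux_eq_reduced[OF smooth_W periodic_W] by (simp add: algebra_simps)
qed

text \<open>In the reduced form the limit \<open>\<partial>\<^sub>i W \<rightarrow> D i\<close> can be taken. On the diagonal the two products with factor
\<open>\<alpha>\<^sup>2\<close> have the same integrand.\<close>

lemma flux_tendsto_zero: "(\<lambda>J. \<Sum>l\<in>UNIV. flux \<alpha> f D l (W J l)) \<longlonglongrightarrow> 0"
proof -
  note fc = dominated_conv_limit[OF W] and Dc = dominated_conv_limit[OF dW]
  have "(\<lambda>J. \<Sum>l\<in>UNIV. reduced_flux \<alpha> l (\<lambda>i. pd i (W J l))) \<longlonglongrightarrow> (\<Sum>l\<in>UNIV. reduced_flux \<alpha> l (\<lambda>i x. D i x $ l))"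
    unfolding reduced_flux_def
    by (intro tendsto_sum tendsto_add tendsto_mult tendsto_const tendsto_diff I3_tendsto[OF M3 fc fc dW] I3_tendsto[OF M3 Dc Dc dW])
  moreover have "(\<Sum>l\<in>UNIV. reduced_flux \<alpha> l (\<lambda>i x. D i x $ l)) = 0"
  proof -
    have e: "I3 (\<lambda>x. D k x $ i) (\<lambda>x. D i x $ l) (\<lambda>x. D k x $ l) = I3 (\<lambda>x. D k x $ i) (\<lambda>x. D k x $ l) (\<lambda>x. D i x $ l)" for i k l
      unfolding I3_def by (rule Bochner_Integration.integral_cong[OF refl]) simp
    have "I3 (\<lambda>x. D k x $ i) (\<lambda>x. D k x $ l) (\<lambda>x. D i x $ l) - I3 (\<lambda>x. D k x $ i) (\<lambda>x. D i x $ l) (\<lambda>x. D k x $ l) = 0" for i k l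
      unfolding e[of k i l] by simp
    then show ?thesis unfolding reduced_flux_def transport_term_zero by (simp only: sum.neutral_const mult_zero_right add_0_right)
  qed
  ultimately show ?thesis unfolding flux_eq_reduced[OF smooth_W periodic_W] by simp
qed

lemma energy_tendsto:
  "(\<lambda>J. \<Sum>l\<in>UNIV. (LINT x|torus. f x $ l * W J l x) + \<alpha>\<^sup>2 * (\<Sum>k\<in>UNIV. LINT x|torus. D k x $ l * pd k (W J l) x))
    \<longlonglongrightarrow> (\<Sum>l\<in>UNIV. (LINT x|torus. (f x $ l)\<^sup>2) + \<alpha>\<^sup>2 * (\<Sum>k\<in>UNIV. LINT x|torus. (D k x $ l)\<^sup>2))"
proof -
  have lim: "(\<lambda>J. LINT x|torus. A x * a J x) \<longlonglongrightarrow> (LINT x|torus. (A x)\<^sup>2)" if a: "dominated_conv M a A" for a A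
  proof -
    have "(\<lambda>J. I3 A (a J) (\<lambda>_. 1)) \<longlonglongrightarrow> I3 A A (\<lambda>_. 1)"
      by (rule I3_tendsto[OF enlarged_majorant[of 1] dominated_conv_enlarge[OF _ dominated_conv_limit[OF a]] dominated_conv_enlarge[OF _ a] dominated_conv_smooth[OF smooth_const]]) auto
    then show ?thesis by (simp add: I3_def power2_eq_square)
  qed
  show ?thesis
    by (intro tendsto_sum tendsto_add tendsto_mult tendsto_const lim W dW)
qed

end

section \<open>Flux and energy of Littlewood-Paley sums\<close>

text \<open>Incompressibility on the Fourier side, which passes to Littlewood-Paley sums frequency by frequency.\<close>

definition divergence_free :: "(real^3 \<Rightarrow> real^3) \<Rightarrow> bool" where
  "divergence_free f \<longleftrightarrow> (\<forall>k\<in>frequencies. \<forall>c\<in>{0, pi/2}. (\<Sum>i\<in>UNIV. k $ i * trig_coeff (\<lambda>x. f x $ i) k c) = 0)"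

lemma low_freq_frequencies: "k \<in> low_freq J \<Longrightarrow> k \<in> frequencies"
  by (simp add: low_freq_def)

lemma div_lp_sum:
  assumes "divergence_free f"
  shows "(\<Sum>i\<in>UNIV. pd i (lp_sum \<theta> J (\<lambda>x. f x $ i)) x) = 0"
proof -
  have "(\<Sum>i\<in>UNIV. pd i (lp_sum \<theta> J (\<lambda>x. f x $ i)) x)
    = (\<Sum>i\<in>UNIV. \<Sum>k\<in>low_freq J. \<Sum>c\<in>{0, pi/2}. (\<theta> (k /\<^sub>R 2 ^ J) * (2 * pi * wave k (c + pi/2) x)) * (k $ i * trig_coeff (\<lambda>x. f x $ i) k c))"
    unfolding dir_deriv_lp_sum by (intro sum.cong refl) (simp only: mult_ac)
  also have "\<dots> = (\<Sum>k\<in>low_freq J. \<Sum>i\<in>UNIV. \<Sum>c\<in>{0, pi/2}. (\<theta> (k /\<^sub>R 2 ^ J) * (2 * pi * wave k (c + pi/2) x)) * (k $ i * trig_coeff (\<lambda>x. f x $ i) k c))"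
    by (rule sum.swap)
  also have "\<dots> = (\<Sum>k\<in>low_freq J. \<Sum>c\<in>{0, pi/2}. \<Sum>i\<in>UNIV. (\<theta> (k /\<^sub>R 2 ^ J) * (2 * pi * wave k (c + pi/2) x)) * (k $ i * trig_coeff (\<lambda>x. f x $ i) k c))"
    by (rule sum.cong[OF refl]) (rule sum.swap)
  also have "\<dots> = (\<Sum>k\<in>low_freq J. \<Sum>c\<in>{0, pi/2}. (\<theta> (k /\<^sub>R 2 ^ J) * (2 * pi * wave k (c + pi/2) x)) * (\<Sum>i\<in>UNIV. k $ i * trig_coeff (\<lambda>x. f x $ i) k c))"
    by (simp only: sum_distrib_left)
  also have "\<dots> = 0"
  proof (intro sum.neutral ballI)
    fix k c assume "k \<in> low_freq J" "c \<in> {0, pi/2}"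
    then have "(\<Sum>i\<in>UNIV. k $ i * trig_coeff (\<lambda>x. f x $ i) k c) = 0"
      using assms low_freq_frequencies unfolding divergence_free_def by blast
    then show "(\<theta> (k /\<^sub>R 2 ^ J) * (2 * pi * wave k (c + pi/2) x)) * (\<Sum>i\<in>UNIV. k $ i * trig_coeff (\<lambda>x. f x $ i) k c) = 0"
      by (simp only: mult_zero_right)
  qed
  finally show ?thesis .
qed

lemma pd_pd_lp_sum:
  "pd i (pd j (lp_sum \<theta> J g)) x =
     (\<Sum>k\<in>low_freq J. \<Sum>c\<in>{0, pi/2}. (\<theta> (k /\<^sub>R 2 ^ J) * trig_coeff g k c) * (2 * pi * k $ j * (2 * pi * k $ i * wave k (c + pi/2 + pi/2) x)))"
proof -
  have e: "pd j (lp_sum \<theta> J g) = (\<lambda>x. \<Sum>k\<in>low_freq J. \<Sum>c\<in>{0, pi/2}. (\<theta> (k /\<^sub>R 2 ^ J) * trig_coeff g k c * (2 * pi * k $ j)) * wave k (c + pi/2) x)"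
    by (rule ext, unfold dir_deriv_lp_sum, intro sum.cong refl) (simp only: mult.assoc)
  have s1: "smooth (\<lambda>x. a * wave k c x)" for a k c by (rule smooth_mult[OF smooth_const smooth_wave])
  have s2: "smooth (\<lambda>x. \<Sum>c\<in>C. a c * wave k (b c) x)" for a b k C by (rule smooth_sum, rule s1)
  show ?thesis
    unfolding e dir_deriv_sum[OF s2] dir_deriv_sum[OF s1] dir_deriv_scale[OF smooth_wave] dir_deriv_wave
    by (intro sum.cong refl) (simp only: mult.assoc)
qed

lemma div_pd_lp_sum:
  assumes "divergence_free f"
  shows "(\<Sum>i\<in>UNIV. pd i (pd j (lp_sum \<theta> J (\<lambda>x. f x $ i))) x) = 0"
proof -
  let ?q = "\<lambda>k c. \<theta> (k /\<^sub>R 2 ^ J) * (2 * pi * (2 * pi * k $ j * wave k (c + pi/2 + pi/2) x))"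
  have "(\<Sum>i\<in>UNIV. pd i (pd j (lp_sum \<theta> J (\<lambda>x. f x $ i))) x)
    = (\<Sum>i\<in>UNIV. \<Sum>k\<in>low_freq J. \<Sum>c\<in>{0, pi/2}. ?q k c * (k $ i * trig_coeff (\<lambda>x. f x $ i) k c))"
    unfolding pd_pd_lp_sum by (intro sum.cong refl) (simp only: mult_ac)
  also have "\<dots> = (\<Sum>k\<in>low_freq J. \<Sum>i\<in>UNIV. \<Sum>c\<in>{0, pi/2}. ?q k c * (k $ i * trig_coeff (\<lambda>x. f x $ i) k c))"
    by (rule sum.swap)
  also have "\<dots> = (\<Sum>k\<in>low_freq J. \<Sum>c\<in>{0, pi/2}. \<Sum>i\<in>UNIV. ?q k c * (k $ i * trig_coeff (\<lambda>x. f x $ i) k c))"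
    by (rule sum.cong[OF refl]) (rule sum.swap)
  also have "\<dots> = (\<Sum>k\<in>low_freq J. \<Sum>c\<in>{0, pi/2}. ?q k c * (\<Sum>i\<in>UNIV. k $ i * trig_coeff (\<lambda>x. f x $ i) k c))"
    by (simp only: sum_distrib_left)
  also have "\<dots> = 0"
  proof (intro sum.neutral ballI)
    fix k c assume "k \<in> low_freq J" "c \<in> {0, pi/2}"
    then have "(\<Sum>i\<in>UNIV. k $ i * trig_coeff (\<lambda>x. f x $ i) k c) = 0"
      using assms low_freq_frequencies unfolding divergence_free_def by blast
    then show "?q k c * (\<Sum>i\<in>UNIV. k $ i * trig_coeff (\<lambda>x. f x $ i) k c) = 0"
      by (simp only: mult_zero_right)
  qed
  finally show ?thesis .
qed

theorem besov_divergence_free_approximation: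
  assumes \<theta>: "lp_cutoff \<theta>" and s: "s > 1" and f: "f \<in> besov_space \<theta> s 3"
    and D: "\<And>i. has_weak_deriv i f (D i)" and div: "divergence_free f"
  obtains M where "divergence_free_approximation f D (\<lambda>J l. lp_sum \<theta> J (\<lambda>x. f x $ l)) M"
    "(LINT x|torus. M x ^ 3) \<le> W13_const s * besov_norm \<theta> s 3 f ^ 3"
proof (rule besov_W13_approximation[where D=D, OF \<theta> s f D])
  fix M
  assume M: "M \<in> borel_measurable torus" "integrable torus (\<lambda>x. M x ^ 3)"
    "(LINT x|torus. M x ^ 3) \<le> W13_const s * besov_norm \<theta> s 3 f ^ 3"
    and W: "\<And>l. AE x in torus. (\<forall>J. \<bar>lp_sum \<theta> J (\<lambda>x. f x $ l) x\<bar> \<le> M x) \<and> (\<lambda>J. lp_sum \<theta> J (\<lambda>x. f x $ l) x) \<longlonglongrightarrow> f x $ l"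
    and dW: "\<And>l i. AE x in torus. (\<forall>J. \<bar>pd i (lp_sum \<theta> J (\<lambda>x. f x $ l)) x\<bar> \<le> M x) \<and>
       (\<lambda>J. pd i (lp_sum \<theta> J (\<lambda>x. f x $ l)) x) \<longlonglongrightarrow> D i x $ l"
  have fi: "integrable torus f" "integrable torus (D i)" for i
    using D[of i] Lp_space_1_integrable unfolding has_weak_deriv_def by blast+
  have "divergence_free_approximation f D (\<lambda>J l. lp_sum \<theta> J (\<lambda>x. f x $ l)) M"
  proof
    show "dominated_conv M (\<lambda>J. lp_sum \<theta> J (\<lambda>x. f x $ l)) (\<lambda>x. f x $ l)" for l
      unfolding dominated_conv_def
      by (intro conjI allI W smooth_measurable_torus[OF smooth_lp_sum] borel_measurable_integrable[OF integrable_vec_nth[OF fi(1)]])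
    show "dominated_conv M (\<lambda>J. pd i (lp_sum \<theta> J (\<lambda>x. f x $ l))) (\<lambda>x. D i x $ l)" for i l
      unfolding dominated_conv_def
      by (intro conjI allI dW smooth_measurable_torus[OF smooth_pd[OF smooth_lp_sum]] borel_measurable_integrable[OF integrable_vec_nth[OF fi(2)]])
  qed (rule M smooth_lp_sum periodic_lp_sum div_lp_sum[OF div] div_pd_lp_sum[OF div] D)+
  then show ?thesis using M(3) by (rule that)
qed

text \<open>The Fourier symbol of \<open>1 - \<alpha>\<^sup>2\<Delta>\<close>.\<close>

definition symbol :: "real \<Rightarrow> real^3 \<Rightarrow> real" where
  "symbol \<alpha> k = 1 + \<alpha>\<^sup>2 * (\<Sum>j\<in>UNIV. (2 * pi * k $ j)\<^sup>2)"

lemma symbol_pos: "symbol \<alpha> k > 0"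
proof -
  have "0 \<le> \<alpha>\<^sup>2 * (\<Sum>j\<in>UNIV. (2 * pi * k $ j)\<^sup>2)" by (intro mult_nonneg_nonneg sum_nonneg) auto
  then show ?thesis unfolding symbol_def by linarith
qed

lemma H1_pairing_wave:
  fixes f :: "real^3 \<Rightarrow> real^3"
  assumes D: "\<And>i. has_weak_deriv i f (D i)" and k: "k \<in> frequencies"
  shows "(LINT x|torus. f x $ l * wave k c x) + \<alpha>\<^sup>2 * (\<Sum>j\<in>UNIV. LINT x|torus. D j x $ l * pd j (wave k c) x)
    = symbol \<alpha> k * trig_coeff (\<lambda>x. f x $ l) k c"
proof -
  have shift: "trig_coeff (\<lambda>x. f x $ l) k (c + pi/2 + pi/2) = - trig_coeff (\<lambda>x. f x $ l) k c"
  proof -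
    have "c + pi/2 + pi/2 = c + pi" by simp
    then have "wave k (c + pi/2 + pi/2) x = - wave k c x" for x by (simp only: wave_add_pi)
    then show ?thesis unfolding trig_coeff_def by (simp only: mult_minus_right Bochner_Integration.integral_minus)
  qed
  have eq: "(LINT x|torus. D j x $ l * pd j (wave k c) x) = (2 * pi * k $ j)\<^sup>2 * trig_coeff (\<lambda>x. f x $ l) k c" for j
  proof -
    have "(LINT x|torus. D j x $ l * pd j (wave k c) x) = (LINT x|torus. (2 * pi * k $ j) * (D j x $ l * wave k (c + pi/2) x))"
      unfolding dir_deriv_wave by (rule Bochner_Integration.integral_cong[OF refl]) simp
    also have "\<dots> = (2 * pi * k $ j) * trig_coeff (\<lambda>x. D j x $ l) k (c + pi/2)"
      unfolding trig_coeff_def by (rule integral_mult_right_zero)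
    also have "\<dots> = (2 * pi * k $ j)\<^sup>2 * trig_coeff (\<lambda>x. f x $ l) k c"
      unfolding trig_coeff_weak_deriv[OF D k] shift by (simp add: power2_eq_square)
    finally show ?thesis .
  qed
  show ?thesis
    unfolding symbol_def eq sum_distrib_right[symmetric] trig_coeff_def[symmetric]
    by (simp only: distrib_right mult_1_left mult.assoc)
qed

lemma integral_lp_sum:
  assumes g: "integrable torus g"
  shows "(LINT x|torus. g x * lp_sum \<theta> J h x) = (\<Sum>k\<in>low_freq J. \<Sum>c\<in>{0, pi/2}. (\<theta> (k /\<^sub>R 2 ^ J) * trig_coeff h k c) * (LINT x|torus. g x * wave k c x))"
    "(LINT x|torus. g x * pd j (lp_sum \<theta> J h) x) = (\<Sum>k\<in>low_freq J. \<Sum>c\<in>{0, pi/2}. (\<theta> (k /\<^sub>R 2 ^ J) * trig_coeff h k c) * (LINT x|torus. g x * pd j (wave k c) x))"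
    "(LINT x|torus. g x * pd i (pd j (lp_sum \<theta> J h)) x) = (\<Sum>k\<in>low_freq J. \<Sum>c\<in>{0, pi/2}. (\<theta> (k /\<^sub>R 2 ^ J) * trig_coeff h k c) * (LINT x|torus. g x * pd i (pd j (wave k c)) x))"
proof -
  have gen: "(LINT x|torus. g x * (\<Sum>k\<in>low_freq J. \<Sum>c\<in>{0, pi/2}. a k c * \<phi> k c x)) = (\<Sum>k\<in>low_freq J. \<Sum>c\<in>{0, pi/2}. a k c * (LINT x|torus. g x * \<phi> k c x))"
    if sm: "\<And>k c. smooth (\<phi> k c)" for a \<phi>
  proof -
    have i: "integrable torus (\<lambda>x. a k c * (g x * \<phi> k c x))" for k c
      by (intro integrable_mult_right integrable_mult_smooth[OF g sm])
    have "(LINT x|torus. g x * (\<Sum>k\<in>low_freq J. \<Sum>c\<in>{0, pi/2}. a k c * \<phi> k c x)) = (LINT x|torus. (\<Sum>k\<in>low_freq J. \<Sum>c\<in>{0, pi/2}. a k c * (g x * \<phi> k c x)))"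
      unfolding sum_distrib_left by (intro Bochner_Integration.integral_cong[OF refl] sum.cong refl) (simp only: mult_ac)
    also have "\<dots> = (\<Sum>k\<in>low_freq J. LINT x|torus. (\<Sum>c\<in>{0, pi/2}. a k c * (g x * \<phi> k c x)))"
      by (rule Bochner_Integration.integral_sum, rule Bochner_Integration.integrable_sum, rule i)
    also have "\<dots> = (\<Sum>k\<in>low_freq J. \<Sum>c\<in>{0, pi/2}. LINT x|torus. a k c * (g x * \<phi> k c x))"
      by (rule sum.cong[OF refl], rule Bochner_Integration.integral_sum, rule i)
    finally show ?thesis unfolding integral_mult_right_zero .
  qed
  show "(LINT x|torus. g x * lp_sum \<theta> J h x) = (\<Sum>k\<in>low_freq J. \<Sum>c\<in>{0, pi/2}. (\<theta> (k /\<^sub>R 2 ^ J) * trig_coeff h k c) * (LINT x|torus. g x * wave k c x))"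
    unfolding lp_sum_def by (rule gen[OF smooth_wave])
  have e1: "pd j (lp_sum \<theta> J h) x = (\<Sum>k\<in>low_freq J. \<Sum>c\<in>{0, pi/2}. (\<theta> (k /\<^sub>R 2 ^ J) * trig_coeff h k c) * pd j (wave k c) x)" for x
    unfolding dir_deriv_lp_sum dir_deriv_wave ..
  show "(LINT x|torus. g x * pd j (lp_sum \<theta> J h) x) = (\<Sum>k\<in>low_freq J. \<Sum>c\<in>{0, pi/2}. (\<theta> (k /\<^sub>R 2 ^ J) * trig_coeff h k c) * (LINT x|torus. g x * pd j (wave k c) x))"
    unfolding e1 by (rule gen[OF smooth_pd[OF smooth_wave]])
  have pw: "pd j (wave k c) = (\<lambda>x. (2 * pi * k $ j) * wave k (c + pi/2) x)" for k c by (rule ext, rule dir_deriv_wave)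
  have e2: "pd i (pd j (lp_sum \<theta> J h)) x = (\<Sum>k\<in>low_freq J. \<Sum>c\<in>{0, pi/2}. (\<theta> (k /\<^sub>R 2 ^ J) * trig_coeff h k c) * pd i (pd j (wave k c)) x)" for x
    unfolding pd_pd_lp_sum pw dir_deriv_scale[OF smooth_wave] dir_deriv_wave ..
  show "(LINT x|torus. g x * pd i (pd j (lp_sum \<theta> J h)) x) = (\<Sum>k\<in>low_freq J. \<Sum>c\<in>{0, pi/2}. (\<theta> (k /\<^sub>R 2 ^ J) * trig_coeff h k c) * (LINT x|torus. g x * pd i (pd j (wave k c)) x))"
    unfolding e2 by (rule gen[OF smooth_pd[OF smooth_pd[OF smooth_wave]]])
qed

text \<open>The coefficients of the Littlewood-Paley sum are those of \<open>f\<close> itself, which makes the pairing a combination of squares.\<close>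

lemma H1_pairing_lp_sum:
  fixes f :: "real^3 \<Rightarrow> real^3"
  assumes D: "\<And>i. has_weak_deriv i f (D i)"
  shows "(LINT x|torus. f x $ l * lp_sum \<theta> J (\<lambda>x. f x $ l) x) + \<alpha>\<^sup>2 * (\<Sum>j\<in>UNIV. LINT x|torus. D j x $ l * pd j (lp_sum \<theta> J (\<lambda>x. f x $ l)) x)
    = (\<Sum>k\<in>low_freq J. \<Sum>c\<in>{0, pi/2}. \<theta> (k /\<^sub>R 2 ^ J) * symbol \<alpha> k * (trig_coeff (\<lambda>x. f x $ l) k c)\<^sup>2)"
proof -
  have fi: "integrable torus (\<lambda>x. f x $ l)" "integrable torus (\<lambda>x. D i x $ l)" for i
    using D[of i] Lp_space_1_integrable integrable_vec_nth unfolding has_weak_deriv_def by blast+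
  let ?b = "\<lambda>k c. \<theta> (k /\<^sub>R 2 ^ J) * trig_coeff (\<lambda>x. f x $ l) k c"
  have "(\<Sum>j\<in>UNIV. LINT x|torus. D j x $ l * pd j (lp_sum \<theta> J (\<lambda>x. f x $ l)) x)
    = (\<Sum>j\<in>UNIV. \<Sum>k\<in>low_freq J. \<Sum>c\<in>{0, pi/2}. ?b k c * (LINT x|torus. D j x $ l * pd j (wave k c) x))"
    unfolding integral_lp_sum(2)[OF fi(2)] ..
  also have "\<dots> = (\<Sum>k\<in>low_freq J. \<Sum>j\<in>UNIV. \<Sum>c\<in>{0, pi/2}. ?b k c * (LINT x|torus. D j x $ l * pd j (wave k c) x))"
    by (rule sum.swap)
  also have "\<dots> = (\<Sum>k\<in>low_freq J. \<Sum>c\<in>{0, pi/2}. \<Sum>j\<in>UNIV. ?b k c * (LINT x|torus. D j x $ l * pd j (wave k c) x))"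
    by (rule sum.cong[OF refl]) (rule sum.swap)
  also have "\<dots> = (\<Sum>k\<in>low_freq J. \<Sum>c\<in>{0, pi/2}. ?b k c * (\<Sum>j\<in>UNIV. LINT x|torus. D j x $ l * pd j (wave k c) x))"
    by (simp only: sum_distrib_left)
  finally have A: "(\<Sum>j\<in>UNIV. LINT x|torus. D j x $ l * pd j (lp_sum \<theta> J (\<lambda>x. f x $ l)) x)
    = (\<Sum>k\<in>low_freq J. \<Sum>c\<in>{0, pi/2}. ?b k c * (\<Sum>j\<in>UNIV. LINT x|torus. D j x $ l * pd j (wave k c) x))" .
  show ?thesis
    unfolding A integral_lp_sum(1)[OF fi(1)] sum_distrib_left sum.distrib[symmetric]
  proof (intro sum.cong refl)
    fix k c assume "k \<in> low_freq J"
    then have k: "k \<in> frequencies" by (rule low_freq_frequencies)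
    have "?b k c * (LINT x|torus. f x $ l * wave k c x) + \<alpha>\<^sup>2 * (?b k c * (\<Sum>j\<in>UNIV. LINT x|torus. D j x $ l * pd j (wave k c) x))
      = ?b k c * ((LINT x|torus. f x $ l * wave k c x) + \<alpha>\<^sup>2 * (\<Sum>j\<in>UNIV. LINT x|torus. D j x $ l * pd j (wave k c) x))"
      by (simp only: distrib_left mult.left_commute)
    also have "\<dots> = \<theta> (k /\<^sub>R 2 ^ J) * symbol \<alpha> k * (trig_coeff (\<lambda>x. f x $ l) k c)\<^sup>2"
      unfolding H1_pairing_wave[OF D k] by (simp add: power2_eq_square)
    finally show "?b k c * (LINT x|torus. f x $ l * wave k c x) + (\<Sum>j\<in>UNIV. \<alpha>\<^sup>2 * (?b k c * (LINT x|torus. D j x $ l * pd j (wave k c) x)))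
       = \<theta> (k /\<^sub>R 2 ^ J) * symbol \<alpha> k * (trig_coeff (\<lambda>x. f x $ l) k c)\<^sup>2"
      by (simp only: sum_distrib_left)
  qed
qed

definition square_integrable :: "(real^3 \<Rightarrow> real) \<Rightarrow> bool" where
  "square_integrable a \<longleftrightarrow> a \<in> borel_measurable torus \<and> integrable torus (\<lambda>x. (a x)\<^sup>2)"

lemma square_integrable_mult:
  assumes "square_integrable a" "square_integrable b"
  shows "integrable torus (\<lambda>x. a x * b x)"
proof (rule Bochner_Integration.integrable_bound)
  show "integrable torus (\<lambda>x. (a x)\<^sup>2 + (b x)\<^sup>2)" using assms by (simp add: square_integrable_def)
  show "(\<lambda>x. a x * b x) \<in> borel_measurable torus"
    using assms unfolding square_integrable_def by (intro borel_measurable_times) simp_all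
  show "AE x in torus. norm (a x * b x) \<le> norm ((a x)\<^sup>2 + (b x)\<^sup>2)"
  proof (intro AE_I2)
    fix x
    have "2 * (\<bar>a x\<bar> * \<bar>b x\<bar>) \<le> (a x)\<^sup>2 + (b x)\<^sup>2" using sum_squares_bound[of "\<bar>a x\<bar>" "\<bar>b x\<bar>"] by simp
    moreover have "0 \<le> \<bar>a x\<bar> * \<bar>b x\<bar>" by simp
    ultimately show "norm (a x * b x) \<le> norm ((a x)\<^sup>2 + (b x)\<^sup>2)" unfolding real_norm_def abs_mult by linarith
  qed
qed

lemma flux_lp_sum:
  assumes f: "\<And>i. square_integrable (\<lambda>x. f x $ i)" "\<And>i k. square_integrable (\<lambda>x. D k x $ i)"
  shows "flux \<alpha> f D l (lp_sum \<theta> J h) = (\<Sum>k\<in>low_freq J. \<Sum>c\<in>{0, pi/2}. (\<theta> (k /\<^sub>R 2 ^ J) * trig_coeff h k c) * flux \<alpha> f D l (wave k c))"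
proof -
  have sw: "(\<Sum>i\<in>UNIV. \<Sum>m\<in>low_freq J. \<Sum>c\<in>{0, pi/2}. F i m c) = (\<Sum>m\<in>low_freq J. \<Sum>c\<in>{0, pi/2}. \<Sum>i\<in>UNIV. F i m c)" for F :: "3 \<Rightarrow> real^3 \<Rightarrow> real \<Rightarrow> real"
  proof -
    have "(\<Sum>i\<in>UNIV. \<Sum>m\<in>low_freq J. \<Sum>c\<in>{0, pi/2}. F i m c) = (\<Sum>m\<in>low_freq J. \<Sum>i\<in>UNIV. \<Sum>c\<in>{0, pi/2}. F i m c)" by (rule sum.swap)
    also have "\<dots> = (\<Sum>m\<in>low_freq J. \<Sum>c\<in>{0, pi/2}. \<Sum>i\<in>UNIV. F i m c)" by (rule sum.cong[OF refl]) (rule sum.swap)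
    finally show ?thesis .
  qed
  let ?b = "\<lambda>m c. \<theta> (m /\<^sub>R 2 ^ J) * trig_coeff h m c"
  let ?T1 = "\<lambda>\<phi> i. I3 (\<lambda>x. f x $ i) (\<lambda>x. f x $ l) (pd i \<phi>)"
  let ?T2 = "\<lambda>\<phi> i k. I3 (\<lambda>x. D k x $ i) (\<lambda>x. D k x $ l) (pd i \<phi>) + I3 (\<lambda>x. D k x $ i) (\<lambda>x. f x $ l) (pd i (pd k \<phi>))"
  have 1: "?T1 (lp_sum \<theta> J h) i = (\<Sum>m\<in>low_freq J. \<Sum>c\<in>{0, pi/2}. ?b m c * ?T1 (wave m c) i)" for i
    unfolding I3_def by (rule integral_lp_sum(2)[OF square_integrable_mult[OF f(1) f(1)]])
  have 2: "?T2 (lp_sum \<theta> J h) i k = (\<Sum>m\<in>low_freq J. \<Sum>c\<in>{0, pi/2}. ?b m c * ?T2 (wave m c) i k)" for i k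
    unfolding I3_def integral_lp_sum(2)[OF square_integrable_mult[OF f(2) f(2)]] integral_lp_sum(3)[OF square_integrable_mult[OF f(2) f(1)]]
    by (simp only: sum.distrib distrib_left)
  have A: "(\<Sum>i\<in>UNIV. ?T1 (lp_sum \<theta> J h) i) = (\<Sum>m\<in>low_freq J. \<Sum>c\<in>{0, pi/2}. ?b m c * (\<Sum>i\<in>UNIV. ?T1 (wave m c) i))"
    unfolding 1 sw by (simp only: sum_distrib_left)
  have B: "(\<Sum>i\<in>UNIV. \<Sum>k\<in>UNIV. ?T2 (lp_sum \<theta> J h) i k) = (\<Sum>m\<in>low_freq J. \<Sum>c\<in>{0, pi/2}. ?b m c * (\<Sum>i\<in>UNIV. \<Sum>k\<in>UNIV. ?T2 (wave m c) i k))"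
    unfolding 2 sw by (simp only: sum_distrib_left)
  have "flux \<alpha> f D l (lp_sum \<theta> J h) = (\<Sum>m\<in>low_freq J. \<Sum>c\<in>{0, pi/2}. ?b m c * (\<Sum>i\<in>UNIV. ?T1 (wave m c) i))
     + \<alpha>\<^sup>2 * (\<Sum>m\<in>low_freq J. \<Sum>c\<in>{0, pi/2}. ?b m c * (\<Sum>i\<in>UNIV. \<Sum>k\<in>UNIV. ?T2 (wave m c) i k))"
    unfolding flux_def A B ..
  also have "\<dots> = (\<Sum>m\<in>low_freq J. \<Sum>c\<in>{0, pi/2}. ?b m c * (\<Sum>i\<in>UNIV. ?T1 (wave m c) i) + \<alpha>\<^sup>2 * (?b m c * (\<Sum>i\<in>UNIV. \<Sum>k\<in>UNIV. ?T2 (wave m c) i k)))"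
    unfolding sum_distrib_left[of "\<alpha>\<^sup>2"] sum.distrib ..
  also have "\<dots> = (\<Sum>m\<in>low_freq J. \<Sum>c\<in>{0, pi/2}. ?b m c * flux \<alpha> f D l (wave m c))"
  proof -
    have "b * S + \<alpha>\<^sup>2 * (b * T) = b * (S + \<alpha>\<^sup>2 * T)" for b S T :: real by (simp add: algebra_simps)
    then show ?thesis unfolding flux_def by (simp only:)
  qed
  finally show ?thesis .
qed

section \<open>The space \<open>H\<^sup>1\<close>\<close>

lemma complex_coeff_unique:
  assumes g: "integrable torus g" and h: "integrable torus h"
    and eq: "\<And>k. k \<in> frequencies \<Longrightarrow> complex_coeff g k = complex_coeff h k"
  shows "AE x in torus. g x = h x"
proof -
  have i: "integrable torus (\<lambda>x. complex_of_real (g x) - complex_of_real (h x))"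
    by (intro Bochner_Integration.integrable_diff integrable_of_real g h)
  have "AE x in torus. complex_of_real (g x) - complex_of_real (h x) = 0"
  proof (rule fourier_uniqueness[OF i])
    fix k assume k: "k \<in> frequencies"
    then have mk: "- k \<in> frequencies" by (auto simp: frequencies_def)
    have "(LINT x|torus. cis (2 * pi * ((- (- k)) \<bullet> x)) * (complex_of_real (g x) - complex_of_real (h x)))
      = (LINT x|torus. cis (2 * pi * ((- (- k)) \<bullet> x)) * complex_of_real (g x)) - (LINT x|torus. cis (2 * pi * ((- (- k)) \<bullet> x)) * complex_of_real (h x))"
      unfolding right_diff_distrib
      by (rule Bochner_Integration.integral_diff[OF integrable_cis_mult[OF integrable_of_real[OF g]] integrable_cis_mult[OF integrable_of_real[OF h]]])
    also have "\<dots> = 0" unfolding integral_cis_complex_coeff[OF g] integral_cis_complex_coeff[OF h] eq[OF mk] by (rule diff_self)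
    finally show "(LINT x|torus. cis (2 * pi * (k \<bullet> x)) * (complex_of_real (g x) - complex_of_real (h x))) = 0"
      unfolding minus_minus .
  qed
  then show ?thesis by eventually_elim simp
qed

text \<open>A weak derivative has its Fourier coefficients prescribed by those of the function.\<close>

lemma weak_deriv_unique:
  fixes f g h :: "real^3 \<Rightarrow> real^3"
  assumes g: "has_weak_deriv i f g" and h: "has_weak_deriv i f h"
  shows "AE x in torus. g x = h x"
proof -
  have gi: "integrable torus g" and hi: "integrable torus h"
    using g h Lp_space_1_integrable unfolding has_weak_deriv_def by blast+
  have "AE x in torus. \<forall>l. g x $ l = h x $ l"
    unfolding AE_all_countable
  proof
    fix l
    show "AE x in torus. g x $ l = h x $ l"
      by (rule complex_coeff_unique[OF integrable_vec_nth[OF gi] integrable_vec_nth[OF hi]])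
        (simp only: complex_coeff_weak_deriv[OF g] complex_coeff_weak_deriv[OF h])
  qed
  then show ?thesis by eventually_elim (simp add: vec_eq_iff)
qed

lemma Lp_space_1_iff: "f \<in> Lp_space 1 \<longleftrightarrow> periodic f \<and> integrable torus f"
  for f :: "real^3 \<Rightarrow> 'b::euclidean_space"
  unfolding Lp_space_def by (auto simp: integrable_norm_iff)

lemma Lp_space_2_iff: "f \<in> Lp_space 2 \<longleftrightarrow> periodic f \<and> f \<in> borel_measurable torus \<and> integrable torus (\<lambda>x. (norm (f x))\<^sup>2)"
  for f :: "real^3 \<Rightarrow> 'b::euclidean_space"
proof -
  have "norm (f x) powr 2 = (norm (f x))\<^sup>2" for x using powr_realpow'[of "norm (f x)" 2] by simp
  then show ?thesis unfolding Lp_space_def by simp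
qed

lemma Lp_space_2_diff:
  fixes f g :: "real^3 \<Rightarrow> real^3"
  assumes "f \<in> Lp_space 2" "g \<in> Lp_space 2"
  shows "f - g \<in> Lp_space 2"
proof -
  have m: "(f - g) \<in> borel_measurable torus"
    using assms unfolding Lp_space_2_iff fun_diff_def by (intro borel_measurable_diff) blast+
  have "integrable torus (\<lambda>x. (norm ((f - g) x))\<^sup>2)"
  proof (rule Bochner_Integration.integrable_bound)
    show "integrable torus (\<lambda>x. 2 * (norm (f x))\<^sup>2 + 2 * (norm (g x))\<^sup>2)" using assms by (simp add: Lp_space_2_iff)
    show "(\<lambda>x. (norm ((f - g) x))\<^sup>2) \<in> borel_measurable torus" by (rule borel_measurable_power[OF measurable_compose[OF m borel_measurable_norm]])
    show "AE x in torus. norm ((norm ((f - g) x))\<^sup>2) \<le> norm (2 * (norm (f x))\<^sup>2 + 2 * (norm (g x))\<^sup>2)"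
    proof (intro AE_I2)
      fix x
      have "(norm (f x - g x))\<^sup>2 \<le> (norm (f x) + norm (g x))\<^sup>2" by (intro power_mono norm_triangle_ineq4) simp
      also have "\<dots> \<le> 2 * (norm (f x))\<^sup>2 + 2 * (norm (g x))\<^sup>2"
        using sum_squares_bound[of "norm (f x)" "norm (g x)"] by (simp add: power2_sum)
      finally show "norm ((norm ((f - g) x))\<^sup>2) \<le> norm (2 * (norm (f x))\<^sup>2 + 2 * (norm (g x))\<^sup>2)"
        using zero_le_power2[of "norm (f x - g x)"] unfolding fun_diff_def real_norm_def by linarith
    qed
  qed
  then show ?thesis using m assms unfolding Lp_space_2_iff by (auto simp: periodic_def)
qed

lemma has_weak_deriv_diff:
  fixes f g f' g' :: "real^3 \<Rightarrow> real^3"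
  assumes f: "has_weak_deriv i f f'" and g: "has_weak_deriv i g g'"
  shows "has_weak_deriv i (f - g) (f' - g')"
proof -
  have i: "integrable torus f" "integrable torus f'" "integrable torus g" "integrable torus g'"
    using f g Lp_space_1_integrable unfolding has_weak_deriv_def by blast+
  have "(LINT x|torus. pd i \<phi> x *\<^sub>R (f - g) x) = - (LINT x|torus. \<phi> x *\<^sub>R (f' - g') x)" if \<phi>: "smooth \<phi>" "periodic \<phi>" for \<phi>
  proof -
    have e: "(LINT x|torus. pd i \<phi> x *\<^sub>R f x) = - (LINT x|torus. \<phi> x *\<^sub>R f' x)" "(LINT x|torus. pd i \<phi> x *\<^sub>R g x) = - (LINT x|torus. \<phi> x *\<^sub>R g' x)"
      using f g \<phi> unfolding has_weak_deriv_def by blast+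
    show ?thesis
      unfolding fun_diff_def scaleR_right_diff_distrib
        Bochner_Integration.integral_diff[OF integrable_smooth_scaleR[OF smooth_pd[OF \<phi>(1)] i(1)] integrable_smooth_scaleR[OF smooth_pd[OF \<phi>(1)] i(3)]]
        Bochner_Integration.integral_diff[OF integrable_smooth_scaleR[OF \<phi>(1) i(2)] integrable_smooth_scaleR[OF \<phi>(1) i(4)]] e
      by simp
  qed
  moreover have "f - g \<in> Lp_space 1" "f' - g' \<in> Lp_space 1"
  proof -
    have "integrable torus (f - g)" "integrable torus (f' - g')"
      unfolding fun_diff_def by (rule Bochner_Integration.integrable_diff[OF i(1) i(3)], rule Bochner_Integration.integrable_diff[OF i(2) i(4)])
    moreover have "periodic (f - g)" "periodic (f' - g')"
      using f g unfolding has_weak_deriv_def Lp_space_1_iff periodic_def fun_diff_def by simp_all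
    ultimately show "f - g \<in> Lp_space 1" "f' - g' \<in> Lp_space 1" unfolding Lp_space_1_iff by blast+
  qed
  ultimately show ?thesis unfolding has_weak_deriv_def by blast
qed

lemma Lp_space_2_square_integrable:
  fixes f :: "real^3 \<Rightarrow> real^3"
  assumes "f \<in> Lp_space 2"
  shows "square_integrable (\<lambda>x. f x $ l)" "(LINT x|torus. (f x $ l)\<^sup>2) \<le> (LINT x|torus. (norm (f x))\<^sup>2)"
proof -
  have m: "(\<lambda>x. f x $ l) \<in> borel_measurable torus" and n: "integrable torus (\<lambda>x. (norm (f x))\<^sup>2)"
  proof -
    have c: "(\<lambda>v::real^3. v $ l) \<in> borel_measurable borel"
      by (intro borel_measurable_continuous_onI continuous_intros)
    have fm: "f \<in> borel_measurable torus" using assms unfolding Lp_space_2_iff by blast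
    show "(\<lambda>x. f x $ l) \<in> borel_measurable torus" by (rule measurable_compose[OF fm c])
    show "integrable torus (\<lambda>x. (norm (f x))\<^sup>2)" using assms unfolding Lp_space_2_iff by simp
  qed
  have le: "(f x $ l)\<^sup>2 \<le> (norm (f x))\<^sup>2" for x
    using power_mono[OF component_le_norm_cart[of "f x" l] abs_ge_zero, of 2] by (simp only: power2_abs)
  have i: "integrable torus (\<lambda>x. (f x $ l)\<^sup>2)"
    by (rule Bochner_Integration.integrable_bound[OF n]) (use borel_measurable_power[OF m] le in simp_all)
  show "square_integrable (\<lambda>x. f x $ l)" using m i by (simp add: square_integrable_def)
  show "(LINT x|torus. (f x $ l)\<^sup>2) \<le> (LINT x|torus. (norm (f x))\<^sup>2)"
    by (rule integral_mono[OF i n le])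
qed

lemma Lp_space_2_cong_AE:
  fixes f g :: "real^3 \<Rightarrow> real^3"
  assumes f: "f \<in> Lp_space 2" and g: "g \<in> Lp_space 1" and eq: "AE x in torus. f x = g x"
  shows "g \<in> Lp_space 2"
proof -
  have gm: "g \<in> borel_measurable torus" and gp: "periodic g" using g by (auto simp: Lp_space_def)
  have "integrable torus (\<lambda>x. (norm (f x))\<^sup>2)" "f \<in> borel_measurable torus" using f by (auto simp: Lp_space_2_iff)
  moreover have "AE x in torus. (norm (f x))\<^sup>2 = (norm (g x))\<^sup>2" using eq by eventually_elim simp
  ultimately have "integrable torus (\<lambda>x. (norm (g x))\<^sup>2)"
    using integrable_cong_AE[of "\<lambda>x. (norm (f x))\<^sup>2" torus "\<lambda>x. (norm (g x))\<^sup>2"] gm by simp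
  then show ?thesis using gm gp by (simp add: Lp_space_2_iff)
qed

lemma H1_weak_deriv:
  fixes f :: "real^3 \<Rightarrow> real^3"
  assumes "f \<in> H1_space"
  shows "has_weak_deriv k f (weak_deriv k f)" "weak_deriv k f \<in> Lp_space 2" "f \<in> Lp_space 2"
proof -
  obtain g where g: "g \<in> Lp_space 2" "has_weak_deriv k f g" using assms unfolding H1_space_def by blast
  show w: "has_weak_deriv k f (weak_deriv k f)" unfolding weak_deriv_def by (rule someI[of _ g]) (rule g)
  show "weak_deriv k f \<in> Lp_space 2"
    by (rule Lp_space_2_cong_AE[OF g(1) _ weak_deriv_unique[OF g(2) w]]) (use w in \<open>simp add: has_weak_deriv_def\<close>)
  show "f \<in> Lp_space 2" using assms by (simp add: H1_space_def)
qed

lemma H1_norm_bounds: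
  fixes f :: "real^3 \<Rightarrow> real^3"
  assumes "f \<in> H1_space"
  shows "(LINT x|torus. (f x $ l)\<^sup>2) \<le> (H1_norm \<alpha> f)\<^sup>2"
    "\<alpha>\<^sup>2 * (LINT x|torus. (weak_deriv k f x $ l)\<^sup>2) \<le> (H1_norm \<alpha> f)\<^sup>2"
proof -
  note w = H1_weak_deriv[OF assms]
  have n: "integrable torus (\<lambda>x. (norm (weak_deriv k f x))\<^sup>2)" for k using w(2)[of k] by (simp add: Lp_space_2_iff)
  have s: "(LINT x|torus. (\<Sum>k\<in>UNIV. (norm (weak_deriv k f x))\<^sup>2)) = (\<Sum>k\<in>UNIV. LINT x|torus. (norm (weak_deriv k f x))\<^sup>2)"
    by (rule Bochner_Integration.integral_sum[OF n])
  have nn: "0 \<le> (LINT x|torus. (norm (f x))\<^sup>2)" "0 \<le> (LINT x|torus. (norm (weak_deriv k f x))\<^sup>2)" for k by simp_all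
  have sq: "(H1_norm \<alpha> f)\<^sup>2 = (LINT x|torus. (norm (f x))\<^sup>2) + \<alpha>\<^sup>2 * (\<Sum>k\<in>UNIV. LINT x|torus. (norm (weak_deriv k f x))\<^sup>2)"
    unfolding H1_norm_def s by (rule real_sqrt_pow2) (intro add_nonneg_nonneg mult_nonneg_nonneg sum_nonneg nn zero_le_power2)
  have p: "0 \<le> \<alpha>\<^sup>2 * (\<Sum>k\<in>UNIV. LINT x|torus. (norm (weak_deriv k f x))\<^sup>2)" by (intro mult_nonneg_nonneg sum_nonneg nn zero_le_power2)
  show "(LINT x|torus. (f x $ l)\<^sup>2) \<le> (H1_norm \<alpha> f)\<^sup>2"
    unfolding sq using Lp_space_2_square_integrable(2)[OF w(3), of l] p by linarith
  have "(LINT x|torus. (weak_deriv k f x $ l)\<^sup>2) \<le> (\<Sum>k\<in>UNIV. LINT x|torus. (norm (weak_deriv k f x))\<^sup>2)"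
    by (rule order_trans[OF Lp_space_2_square_integrable(2)[OF w(2)]]) (rule member_le_sum, auto)
  then have "\<alpha>\<^sup>2 * (LINT x|torus. (weak_deriv k f x $ l)\<^sup>2) \<le> \<alpha>\<^sup>2 * (\<Sum>k\<in>UNIV. LINT x|torus. (norm (weak_deriv k f x))\<^sup>2)"
    by (rule mult_left_mono) simp
  then show "\<alpha>\<^sup>2 * (LINT x|torus. (weak_deriv k f x $ l)\<^sup>2) \<le> (H1_norm \<alpha> f)\<^sup>2"
    unfolding sq using nn(1) by linarith
qed

lemma H1_norm_square_eq:
  fixes f :: "real^3 \<Rightarrow> real^3"
  assumes "f \<in> H1_space"
  shows "(H1_norm \<alpha> f)\<^sup>2 = (\<Sum>l\<in>UNIV. (LINT x|torus. (f x $ l)\<^sup>2) + \<alpha>\<^sup>2 * (\<Sum>k\<in>UNIV. LINT x|torus. (weak_deriv k f x $ l)\<^sup>2))"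
proof -
  note w = H1_weak_deriv[OF assms]
  have n: "integrable torus (\<lambda>x. (norm (weak_deriv k f x))\<^sup>2)" for k using w(2)[of k] by (simp add: Lp_space_2_iff)
  have s: "(LINT x|torus. (\<Sum>k\<in>UNIV. (norm (weak_deriv k f x))\<^sup>2)) = (\<Sum>k\<in>UNIV. LINT x|torus. (norm (weak_deriv k f x))\<^sup>2)"
    by (rule Bochner_Integration.integral_sum[OF n])
  have nn: "0 \<le> (LINT x|torus. (norm (f x))\<^sup>2)" "0 \<le> (LINT x|torus. (norm (weak_deriv k f x))\<^sup>2)" for k by simp_all
  have sq: "(H1_norm \<alpha> f)\<^sup>2 = (LINT x|torus. (norm (f x))\<^sup>2) + \<alpha>\<^sup>2 * (\<Sum>k\<in>UNIV. LINT x|torus. (norm (weak_deriv k f x))\<^sup>2)"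
    unfolding H1_norm_def s by (rule real_sqrt_pow2) (intro add_nonneg_nonneg mult_nonneg_nonneg sum_nonneg nn zero_le_power2)
  have comp: "(LINT x|torus. (norm (g x))\<^sup>2) = (\<Sum>l\<in>UNIV. LINT x|torus. (g x $ l)\<^sup>2)" if "g \<in> Lp_space 2" for g :: "real^3 \<Rightarrow> real^3"
  proof -
    have "(norm v)\<^sup>2 = (\<Sum>l\<in>UNIV. (v $ l)\<^sup>2)" for v :: "real^3"
      unfolding power2_norm_eq_inner inner_vec_def by (simp add: power2_eq_square)
    moreover have "integrable torus (\<lambda>x. (g x $ l)\<^sup>2)" for l
      using Lp_space_2_square_integrable(1)[OF that] by (simp add: square_integrable_def)
    ultimately show ?thesis by (simp only: Bochner_Integration.integral_sum)
  qed
  have "(\<Sum>k\<in>UNIV. LINT x|torus. (norm (weak_deriv k f x))\<^sup>2) = (\<Sum>l\<in>UNIV. \<Sum>k\<in>UNIV. LINT x|torus. (weak_deriv k f x $ l)\<^sup>2)"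
    unfolding comp[OF w(2)] by (rule sum.swap)
  then show ?thesis unfolding sq comp[OF w(3)] by (simp only: sum.distrib sum_distrib_left)
qed

lemma H1_norm_nonneg: "0 \<le> H1_norm \<alpha> f"
  unfolding H1_norm_def
  by (intro real_sqrt_ge_zero add_nonneg_nonneg mult_nonneg_nonneg zero_le_power2) (simp_all add: sum_nonneg)

text \<open>As \<open>weak_deriv\<close> chooses a representative, it is linear only almost everywhere, by uniqueness.\<close>

lemma H1_diff:
  fixes f g :: "real^3 \<Rightarrow> real^3"
  assumes f: "f \<in> H1_space" and g: "g \<in> H1_space"
  shows "f - g \<in> H1_space" "AE x in torus. weak_deriv k (f - g) x = weak_deriv k f x - weak_deriv k g x"
proof -
  have d: "has_weak_deriv k (f - g) (weak_deriv k f - weak_deriv k g)" for k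
    by (rule has_weak_deriv_diff[OF H1_weak_deriv(1)[OF f] H1_weak_deriv(1)[OF g]])
  show fg: "f - g \<in> H1_space"
    unfolding H1_space_def
    using d Lp_space_2_diff[OF H1_weak_deriv(2)[OF f] H1_weak_deriv(2)[OF g]] Lp_space_2_diff[OF H1_weak_deriv(3)[OF f] H1_weak_deriv(3)[OF g]]
    by blast
  show "AE x in torus. weak_deriv k (f - g) x = weak_deriv k f x - weak_deriv k g x"
    using weak_deriv_unique[OF H1_weak_deriv(1)[OF fg] d] by (simp add: fun_diff_def)
qed

lemma integral_cauchy_schwarz:
  assumes a: "square_integrable a" and b: "square_integrable b"
  shows "\<bar>LINT x|torus. a x * b x\<bar> \<le> sqrt (LINT x|torus. (a x)\<^sup>2) * sqrt (LINT x|torus. (b x)\<^sup>2)"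
proof -
  define A where "A = (LINT x|torus. (a x)\<^sup>2)"
  define B where "B = (LINT x|torus. (b x)\<^sup>2)"
  define c where "c = (LINT x|torus. a x * b x)"
  have ai: "integrable torus (\<lambda>x. (a x)\<^sup>2)" and bi: "integrable torus (\<lambda>x. (b x)\<^sup>2)" using a b by (auto simp: square_integrable_def)
  note ab = square_integrable_mult[OF a b]
  have AB: "0 \<le> A" "0 \<le> B" by (auto simp: A_def B_def)
  have q: "0 \<le> A * t\<^sup>2 + (-2 * c) * t + B" for t
  proof -
    have "0 \<le> (LINT x|torus. (t * a x - b x)\<^sup>2)" by simp
    also have "\<dots> = (LINT x|torus. t\<^sup>2 * (a x)\<^sup>2 + (-2 * t) * (a x * b x) + (b x)\<^sup>2)"
      by (rule Bochner_Integration.integral_cong[OF refl]) (simp add: power2_eq_square algebra_simps)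
    also have "\<dots> = t\<^sup>2 * A + (-2 * t) * c + B"
      unfolding A_def B_def c_def using ai bi ab by simp
    finally show ?thesis by (simp add: algebra_simps)
  qed
  have "c\<^sup>2 \<le> A * B"
  proof (cases "A = 0")
    case True
    have "c = 0"
    proof (rule ccontr)
      assume "c \<noteq> 0"
      then show False using q[of "(B + 1) / (2 * c)"] True by (simp add: field_simps)
    qed
    then show ?thesis using True by simp
  next
    case False
    then have A: "0 < A" using AB by simp
    have "0 \<le> A * (c / A)\<^sup>2 + (-2 * c) * (c / A) + B" by (rule q)
    also have "\<dots> = B - c\<^sup>2 / A" using A by (simp add: power2_eq_square field_simps)
    finally show ?thesis using A by (simp add: field_simps)
  qed
  then have "sqrt (c\<^sup>2) \<le> sqrt (A * B)" by (rule real_sqrt_le_mono)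
  then show ?thesis by (simp add: real_sqrt_mult A_def B_def c_def)
qed

lemma I3_cauchy_schwarz:
  assumes a: "square_integrable a" and b: "square_integrable b"
    and \<phi>: "smooth \<phi>" "\<And>x. x \<in> cbox 0 1 \<Longrightarrow> \<bar>\<phi> x\<bar> \<le> K"
  shows "\<bar>I3 a b \<phi>\<bar> \<le> K * (sqrt (LINT x|torus. (a x)\<^sup>2) * sqrt (LINT x|torus. (b x)\<^sup>2))"
proof -
  have ab: "integrable torus (\<lambda>x. \<bar>a x\<bar> * \<bar>b x\<bar>)"
    using integrable_abs[OF square_integrable_mult[OF a b]] by (simp add: abs_mult)
  have "0 \<le> K" using \<phi>(2)[of 0] by (auto simp: mem_box_cart)
  have "norm (I3 a b \<phi>) \<le> (LINT x|torus. norm (a x * b x * \<phi> x))" unfolding I3_def by (rule integral_norm_bound)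
  also have "\<dots> \<le> (LINT x|torus. K * (\<bar>a x\<bar> * \<bar>b x\<bar>))"
  proof (rule integral_mono)
    show "integrable torus (\<lambda>x. norm (a x * b x * \<phi> x))"
      by (intro integrable_norm integrable_mult_smooth square_integrable_mult a b \<phi>)
    show "integrable torus (\<lambda>x. K * (\<bar>a x\<bar> * \<bar>b x\<bar>))" using ab by simp
    show "norm (a x * b x * \<phi> x) \<le> K * (\<bar>a x\<bar> * \<bar>b x\<bar>)" if "x \<in> space torus" for x
      using mult_left_mono[OF \<phi>(2)[of x], of "\<bar>a x\<bar> * \<bar>b x\<bar>"] that by (simp add: abs_mult mult.commute)
  qed
  also have "\<dots> = K * (LINT x|torus. \<bar>a x\<bar> * \<bar>b x\<bar>)" by simp
  also have "\<dots> \<le> K * (sqrt (LINT x|torus. (a x)\<^sup>2) * sqrt (LINT x|torus. (b x)\<^sup>2))"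
  proof (rule mult_left_mono[OF _ \<open>0 \<le> K\<close>])
    have "square_integrable (\<lambda>x. \<bar>a x\<bar>)" "square_integrable (\<lambda>x. \<bar>b x\<bar>)" using a b by (auto simp: square_integrable_def)
    from integral_cauchy_schwarz[OF this] show "(LINT x|torus. \<bar>a x\<bar> * \<bar>b x\<bar>) \<le> sqrt (LINT x|torus. (a x)\<^sup>2) * sqrt (LINT x|torus. (b x)\<^sup>2)"
      by simp
  qed
  finally show ?thesis by simp
qed

definition L2_conv :: "(nat \<Rightarrow> real^3 \<Rightarrow> real) \<Rightarrow> (real^3 \<Rightarrow> real) \<Rightarrow> bool" where
  "L2_conv a A \<longleftrightarrow> (\<forall>n. square_integrable (a n)) \<and> square_integrable A \<and> (\<lambda>n. LINT x|torus. (a n x - A x)\<^sup>2) \<longlonglongrightarrow> 0"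

lemma square_integrable_diff:
  assumes a: "square_integrable a" and b: "square_integrable b"
  shows "square_integrable (\<lambda>x. a x - b x)"
proof -
  have "integrable torus (\<lambda>x. (a x)\<^sup>2 - 2 * (a x * b x) + (b x)\<^sup>2)"
    using a b square_integrable_mult[OF a b] by (simp add: square_integrable_def)
  moreover have "(\<lambda>x. (a x)\<^sup>2 - 2 * (a x * b x) + (b x)\<^sup>2) = (\<lambda>x. (a x - b x)\<^sup>2)"
    by (simp add: power2_eq_square algebra_simps)
  moreover have "(\<lambda>x. a x - b x) \<in> borel_measurable torus"
    using a b unfolding square_integrable_def by (intro borel_measurable_diff) blast+
  ultimately show ?thesis by (simp add: square_integrable_def)
qed

lemma I3_L2_tendsto:
  assumes a: "L2_conv a A" and b: "L2_conv b B" and \<phi>: "smooth \<phi>"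
  shows "(\<lambda>n. I3 (a n) (b n) \<phi>) \<longlonglongrightarrow> I3 A B \<phi>"
proof -
  obtain K where K: "0 \<le> K" "\<And>x. x \<in> cbox 0 1 \<Longrightarrow> \<bar>\<phi> x\<bar> \<le> K" using smooth_bounded_cube[OF \<phi>] by blast
  have sq: "square_integrable (a n)" "square_integrable (b n)" "square_integrable A" "square_integrable B" for n
    using a b by (auto simp: L2_conv_def)
  have d: "square_integrable (\<lambda>x. a n x - A x)" "square_integrable (\<lambda>x. b n x - B x)" for n
    by (intro square_integrable_diff sq)+
  let ?n = "\<lambda>g. sqrt (LINT x|torus. (g x)\<^sup>2)"
  have lim: "(\<lambda>n. ?n (\<lambda>x. a n x - A x)) \<longlonglongrightarrow> 0" "(\<lambda>n. ?n (\<lambda>x. b n x - B x)) \<longlonglongrightarrow> 0"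
    using tendsto_real_sqrt[of "\<lambda>n. LINT x|torus. (a n x - A x)\<^sup>2" 0] tendsto_real_sqrt[of "\<lambda>n. LINT x|torus. (b n x - B x)\<^sup>2" 0] a b
    by (simp_all add: L2_conv_def)
  have split: "I3 (a n) (b n) \<phi> = I3 (\<lambda>x. a n x - A x) (\<lambda>x. b n x - B x) \<phi> + I3 A (\<lambda>x. b n x - B x) \<phi> + I3 (\<lambda>x. a n x - A x) B \<phi> + I3 A B \<phi>" for n
    unfolding I3_def
      Bochner_Integration.integral_add[symmetric, OF integrable_mult_smooth[OF square_integrable_mult[OF d(1) d(2)] \<phi>] integrable_mult_smooth[OF square_integrable_mult[OF sq(3) d(2)] \<phi>]]
    by (subst Bochner_Integration.integral_add[symmetric], intro Bochner_Integration.integrable_add integrable_mult_smooth square_integrable_mult d sq \<phi>, intro integrable_mult_smooth square_integrable_mult d sq \<phi>)+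
      (rule Bochner_Integration.integral_cong[OF refl], simp add: algebra_simps)
  have null: "(\<lambda>n. I3 (g n) (h n) \<phi>) \<longlonglongrightarrow> 0"
    if "\<And>n. square_integrable (g n)" "\<And>n. square_integrable (h n)" "(\<lambda>n. K * (?n (g n) * ?n (h n))) \<longlonglongrightarrow> 0" for g h
    by (rule Lim_null_comparison[OF _ that(3)]) (use I3_cauchy_schwarz[OF that(1,2) \<phi> K(2)] in auto)
  have "(\<lambda>n. I3 (a n) (b n) \<phi>) \<longlonglongrightarrow> 0 + 0 + 0 + I3 A B \<phi>"
    unfolding split
  proof (intro tendsto_add tendsto_const null d sq)
    show "(\<lambda>n. K * (?n (\<lambda>x. a n x - A x) * ?n (\<lambda>x. b n x - B x))) \<longlonglongrightarrow> 0"
      using tendsto_mult[OF tendsto_const[of K] tendsto_mult[OF lim]] by simp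
    show "(\<lambda>n. K * (?n A * ?n (\<lambda>x. b n x - B x))) \<longlonglongrightarrow> 0"
      using tendsto_mult[OF tendsto_const[of K] tendsto_mult[OF tendsto_const[of "?n A"] lim(2)]] by simp
    show "(\<lambda>n. K * (?n (\<lambda>x. a n x - A x) * ?n B)) \<longlonglongrightarrow> 0"
      using tendsto_mult[OF tendsto_const[of K] tendsto_mult[OF lim(1) tendsto_const[of "?n B"]]] by simp
  qed
  then show ?thesis by simp
qed

section \<open>Functionals of the solution as functions of time\<close>

definition H1_conv :: "real \<Rightarrow> (nat \<Rightarrow> real^3 \<Rightarrow> real^3) \<Rightarrow> (real^3 \<Rightarrow> real^3) \<Rightarrow> bool" where
  "H1_conv \<alpha> F f \<longleftrightarrow> (\<forall>n. F n \<in> H1_space) \<and> f \<in> H1_space \<and> (\<lambda>n. H1_norm \<alpha> (F n - f)) \<longlonglongrightarrow> 0"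

text \<open>Maps from \<open>H\<^sup>1\<close> to \<open>L\<^sup>2\<close> with linear growth that preserve convergence: the factors of the quadratic terms in the equation.\<close>

definition admissible :: "real \<Rightarrow> ((real^3 \<Rightarrow> real^3) \<Rightarrow> real^3 \<Rightarrow> real) \<Rightarrow> bool" where
  "admissible \<alpha> A \<longleftrightarrow> (\<forall>f\<in>H1_space. square_integrable (A f)) \<and>
     (\<exists>C\<ge>0. \<forall>f\<in>H1_space. (LINT x|torus. (A f x)\<^sup>2) \<le> C * (1 + (H1_norm \<alpha> f)\<^sup>2)) \<and>
     (\<forall>F f. H1_conv \<alpha> F f \<longrightarrow> L2_conv (\<lambda>n. A (F n)) (A f))"

text \<open>Continuity makes such a functional of the solution measurable in time, since it transfers to the simple functions
that approximate the solution in \<open>H\<^sup>1\<close>; quadratic growth makes it bounded in time.\<close>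

definition controlled :: "real \<Rightarrow> ((real^3 \<Rightarrow> real^3) \<Rightarrow> real) \<Rightarrow> bool" where
  "controlled \<alpha> \<Phi> \<longleftrightarrow> (\<exists>C. \<forall>f\<in>H1_space. \<bar>\<Phi> f\<bar> \<le> C * (1 + (H1_norm \<alpha> f)\<^sup>2)) \<and>
     (\<forall>F f. H1_conv \<alpha> F f \<longrightarrow> (\<lambda>n. \<Phi> (F n)) \<longlonglongrightarrow> \<Phi> f)"

text \<open>The constant factor covers linear functionals as a case of the bilinear ones.\<close>

lemma admissible_one: "admissible \<alpha> (\<lambda>_ _. 1)"
proof -
  have s: "square_integrable (\<lambda>_. 1)"
    unfolding square_integrable_def by (auto intro: continuous_integrable_torus)
  have "(LINT x|torus. (1::real)\<^sup>2) \<le> 1 * (1 + (H1_norm \<alpha> f)\<^sup>2)" for f :: "real^3 \<Rightarrow> real^3"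
    using measure_torus by simp
  then have "\<exists>C\<ge>0. \<forall>f\<in>(H1_space :: (real^3 \<Rightarrow> real^3) set). (LINT x|torus. (1::real)\<^sup>2) \<le> C * (1 + (H1_norm \<alpha> f)\<^sup>2)"
    by (intro exI[of _ 1]) auto
  then show ?thesis unfolding admissible_def L2_conv_def using s by simp
qed

lemma admissible_component: "admissible \<alpha> (\<lambda>f x. f x $ l)"
proof -
  have c: "L2_conv (\<lambda>n x. F n x $ l) (\<lambda>x. f x $ l)" if F: "H1_conv \<alpha> F f" for F f
  proof -
    have h: "F n \<in> H1_space" "f \<in> H1_space" "(\<lambda>n. (H1_norm \<alpha> (F n - f))\<^sup>2) \<longlonglongrightarrow> 0" for n
      using F tendsto_power[of "\<lambda>n. H1_norm \<alpha> (F n - f)" 0 sequentially 2] by (auto simp: H1_conv_def)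
    have "(LINT x|torus. (F n x $ l - f x $ l)\<^sup>2) \<le> (H1_norm \<alpha> (F n - f))\<^sup>2" for n
      using H1_norm_bounds(1)[OF H1_diff(1)[OF h(1)[of n] h(2)], where l=l and \<alpha>=\<alpha>] by (simp add: fun_diff_def)
    then have "(\<lambda>n. LINT x|torus. (F n x $ l - f x $ l)\<^sup>2) \<longlonglongrightarrow> 0"
      by (intro Lim_null_comparison[OF _ h(3)]) (simp add: always_eventually)
    then show ?thesis unfolding L2_conv_def
      using Lp_space_2_square_integrable(1)[OF H1_weak_deriv(3)[OF h(1)]] Lp_space_2_square_integrable(1)[OF H1_weak_deriv(3)[OF h(2)]] by blast
  qed
  have b: "(LINT x|torus. (f x $ l)\<^sup>2) \<le> 1 * (1 + (H1_norm \<alpha> f)\<^sup>2)" if "f \<in> H1_space" for f :: "real^3 \<Rightarrow> real^3"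
    using H1_norm_bounds(1)[OF that, where l=l and \<alpha>=\<alpha>] by simp
  show ?thesis unfolding admissible_def
  proof (intro conjI ballI allI impI)
    show "\<exists>C\<ge>0. \<forall>f\<in>H1_space. (LINT x|torus. (f x $ l)\<^sup>2) \<le> C * (1 + (H1_norm \<alpha> f)\<^sup>2)"
      by (intro exI[of _ 1] conjI ballI b) simp
  qed (rule Lp_space_2_square_integrable(1)[OF H1_weak_deriv(3)], assumption, rule c)
qed

lemma admissible_weak_deriv:
  assumes \<alpha>: "\<alpha> > 0"
  shows "admissible \<alpha> (\<lambda>f x. weak_deriv k f x $ l)"
proof -
  have bound: "(LINT x|torus. (weak_deriv k f x $ l)\<^sup>2) \<le> (H1_norm \<alpha> f)\<^sup>2 / \<alpha>\<^sup>2" if "f \<in> H1_space" for f :: "real^3 \<Rightarrow> real^3"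
    using H1_norm_bounds(2)[OF that, where \<alpha>=\<alpha> and k=k and l=l] \<alpha> by (simp add: field_simps)
  have si: "square_integrable (\<lambda>x. weak_deriv k f x $ l)" if "f \<in> H1_space" for f :: "real^3 \<Rightarrow> real^3"
    by (rule Lp_space_2_square_integrable(1)[OF H1_weak_deriv(2)[OF that]])
  have c: "L2_conv (\<lambda>n x. weak_deriv k (F n) x $ l) (\<lambda>x. weak_deriv k f x $ l)" if F: "H1_conv \<alpha> F f" for F f
  proof -
    have h: "F n \<in> H1_space" "f \<in> H1_space" "(\<lambda>n. (H1_norm \<alpha> (F n - f))\<^sup>2 / \<alpha>\<^sup>2) \<longlonglongrightarrow> 0" for n
      using F tendsto_divide[OF tendsto_power[of "\<lambda>n. H1_norm \<alpha> (F n - f)" 0 sequentially 2] tendsto_const[of "\<alpha>\<^sup>2"]] \<alpha> by (auto simp: H1_conv_def)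
    have "(LINT x|torus. (weak_deriv k (F n) x $ l - weak_deriv k f x $ l)\<^sup>2) \<le> (H1_norm \<alpha> (F n - f))\<^sup>2 / \<alpha>\<^sup>2" for n
    proof -
      have "(LINT x|torus. (weak_deriv k (F n) x $ l - weak_deriv k f x $ l)\<^sup>2) = (LINT x|torus. (weak_deriv k (F n - f) x $ l)\<^sup>2)"
      proof (rule integral_cong_AE)
        show "(\<lambda>x. (weak_deriv k (F n) x $ l - weak_deriv k f x $ l)\<^sup>2) \<in> borel_measurable torus"
          using square_integrable_diff[OF si[OF h(1)] si[OF h(2)]] unfolding square_integrable_def by blast
        show "(\<lambda>x. (weak_deriv k (F n - f) x $ l)\<^sup>2) \<in> borel_measurable torus"
          using si[OF H1_diff(1)[OF h(1,2)]] unfolding square_integrable_def by blast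
        show "AE x in torus. (weak_deriv k (F n) x $ l - weak_deriv k f x $ l)\<^sup>2 = (weak_deriv k (F n - f) x $ l)\<^sup>2"
          using H1_diff(2)[OF h(1)[of n] h(2), of k] by eventually_elim simp
      qed
      then show ?thesis using bound[OF H1_diff(1)[OF h(1)[of n] h(2)]] by simp
    qed
    then have "(\<lambda>n. LINT x|torus. (weak_deriv k (F n) x $ l - weak_deriv k f x $ l)\<^sup>2) \<longlonglongrightarrow> 0"
      by (intro Lim_null_comparison[OF _ h(3)]) (simp add: always_eventually)
    then show ?thesis unfolding L2_conv_def using si[OF h(1)] si[OF h(2)] by blast
  qed
  have b: "(LINT x|torus. (weak_deriv k f x $ l)\<^sup>2) \<le> (1 / \<alpha>\<^sup>2) * (1 + (H1_norm \<alpha> f)\<^sup>2)" if "f \<in> H1_space" for f :: "real^3 \<Rightarrow> real^3"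
  proof -
    have "(H1_norm \<alpha> f)\<^sup>2 / \<alpha>\<^sup>2 \<le> (1 / \<alpha>\<^sup>2) * (1 + (H1_norm \<alpha> f)\<^sup>2)" by (simp add: divide_right_mono)
    then show ?thesis using bound[OF that] by linarith
  qed
  show ?thesis unfolding admissible_def
  proof (intro conjI ballI allI impI)
    show "\<exists>C\<ge>0. \<forall>f\<in>H1_space. (LINT x|torus. (weak_deriv k f x $ l)\<^sup>2) \<le> C * (1 + (H1_norm \<alpha> f)\<^sup>2)"
      by (intro exI[of _ "1 / \<alpha>\<^sup>2"] conjI ballI b) simp
  qed (rule si, assumption, rule c)
qed

text \<open>The Cauchy-Schwarz inequality, with the smooth factor bounded.\<close>

lemma controlled_I3:
  assumes A: "admissible \<alpha> A" and B: "admissible \<alpha> B" and \<phi>: "smooth \<phi>"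
  shows "controlled \<alpha> (\<lambda>f. I3 (A f) (B f) \<phi>)"
proof -
  obtain K where K: "0 \<le> K" "\<And>x. x \<in> cbox 0 1 \<Longrightarrow> \<bar>\<phi> x\<bar> \<le> K" using smooth_bounded_cube[OF \<phi>] by blast
  obtain C1 where C1: "0 \<le> C1" "\<And>f. f \<in> H1_space \<Longrightarrow> (LINT x|torus. (A f x)\<^sup>2) \<le> C1 * (1 + (H1_norm \<alpha> f)\<^sup>2)"
    using A unfolding admissible_def by blast
  obtain C2 where C2: "0 \<le> C2" "\<And>f. f \<in> H1_space \<Longrightarrow> (LINT x|torus. (B f x)\<^sup>2) \<le> C2 * (1 + (H1_norm \<alpha> f)\<^sup>2)"
    using B unfolding admissible_def by blast
  have "\<bar>I3 (A f) (B f) \<phi>\<bar> \<le> K * (sqrt C1 * sqrt C2) * (1 + (H1_norm \<alpha> f)\<^sup>2)" if f: "f \<in> H1_space" for f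
  proof -
    let ?N = "1 + (H1_norm \<alpha> f)\<^sup>2"
    have N: "0 \<le> ?N" by simp
    have sA: "square_integrable (A f)" and sB: "square_integrable (B f)" using A B f unfolding admissible_def by blast+
    have "\<bar>I3 (A f) (B f) \<phi>\<bar> \<le> K * (sqrt (LINT x|torus. (A f x)\<^sup>2) * sqrt (LINT x|torus. (B f x)\<^sup>2))"
      by (rule I3_cauchy_schwarz[OF sA sB \<phi> K(2)])
    also have "\<dots> \<le> K * (sqrt (C1 * ?N) * sqrt (C2 * ?N))"
      using C1 C2 N f K(1) by (intro mult_left_mono mult_mono real_sqrt_le_mono) auto
    also have "\<dots> = K * (sqrt C1 * sqrt C2) * (sqrt ?N * sqrt ?N)" by (simp add: real_sqrt_mult)
    also have "sqrt ?N * sqrt ?N = ?N" using N by simp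
    finally show ?thesis .
  qed
  moreover have "(\<lambda>n. I3 (A (F n)) (B (F n)) \<phi>) \<longlonglongrightarrow> I3 (A f) (B f) \<phi>" if "H1_conv \<alpha> F f" for F f
    by (rule I3_L2_tendsto[OF _ _ \<phi>]) (use that A B in \<open>simp_all add: admissible_def\<close>)
  ultimately show ?thesis unfolding controlled_def by blast
qed

lemma controlled_add:
  assumes "controlled \<alpha> \<Phi>" "controlled \<alpha> \<Psi>"
  shows "controlled \<alpha> (\<lambda>f. \<Phi> f + \<Psi> f)"
proof -
  obtain C1 where C1: "\<And>f. f \<in> H1_space \<Longrightarrow> \<bar>\<Phi> f\<bar> \<le> C1 * (1 + (H1_norm \<alpha> f)\<^sup>2)" using assms(1) unfolding controlled_def by blast
  obtain C2 where C2: "\<And>f. f \<in> H1_space \<Longrightarrow> \<bar>\<Psi> f\<bar> \<le> C2 * (1 + (H1_norm \<alpha> f)\<^sup>2)" using assms(2) unfolding controlled_def by blast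
  have "\<bar>\<Phi> f + \<Psi> f\<bar> \<le> (C1 + C2) * (1 + (H1_norm \<alpha> f)\<^sup>2)" if "f \<in> H1_space" for f
    using C1[OF that] C2[OF that] abs_triangle_ineq[of "\<Phi> f" "\<Psi> f"] unfolding distrib_right by linarith
  moreover have "(\<lambda>n. \<Phi> (F n) + \<Psi> (F n)) \<longlonglongrightarrow> \<Phi> f + \<Psi> f" if "H1_conv \<alpha> F f" for F f
    using assms that unfolding controlled_def by (intro tendsto_add) blast+
  ultimately show ?thesis unfolding controlled_def by blast
qed

lemma controlled_scale:
  assumes "controlled \<alpha> \<Phi>"
  shows "controlled \<alpha> (\<lambda>f. r * \<Phi> f)"
proof -
  obtain C where C: "\<And>f. f \<in> H1_space \<Longrightarrow> \<bar>\<Phi> f\<bar> \<le> C * (1 + (H1_norm \<alpha> f)\<^sup>2)" using assms unfolding controlled_def by blast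
  have "\<bar>r * \<Phi> f\<bar> \<le> (\<bar>r\<bar> * C) * (1 + (H1_norm \<alpha> f)\<^sup>2)" if "f \<in> H1_space" for f
    using mult_left_mono[OF C[OF that] abs_ge_zero[of r]] by (simp only: abs_mult mult.assoc)
  moreover have "(\<lambda>n. r * \<Phi> (F n)) \<longlonglongrightarrow> r * \<Phi> f" if "H1_conv \<alpha> F f" for F f
    using assms that unfolding controlled_def by (intro tendsto_mult tendsto_const) blast
  ultimately show ?thesis unfolding controlled_def by blast
qed

lemma controlled_sum:
  assumes "\<And>i. controlled \<alpha> (\<Phi> i)"
  shows "controlled \<alpha> (\<lambda>f. \<Sum>i\<in>I. \<Phi> i f)"
proof (induction I rule: infinite_finite_induct)
  case (insert i I)
  then show ?case using controlled_add[OF assms[of i] insert.IH] by simp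
next
  case empty
  have "controlled \<alpha> (\<lambda>f. 0 * \<Phi> undefined f)" by (rule controlled_scale[OF assms])
  then show ?case by simp
next
  case (infinite I)
  have "controlled \<alpha> (\<lambda>f. 0 * \<Phi> undefined f)" by (rule controlled_scale[OF assms])
  then show ?case using infinite by simp
qed

lemma controlled_flux:
  assumes \<alpha>: "\<alpha> > 0" and \<phi>: "smooth \<phi>"
  shows "controlled \<alpha> (\<lambda>f. flux \<beta> f (\<lambda>k. weak_deriv k f) l \<phi>)"
  unfolding flux_def
  by (intro controlled_add controlled_scale controlled_sum controlled_I3 admissible_component admissible_weak_deriv[OF \<alpha>] smooth_pd \<phi>)

lemma controlled_integral:
  assumes \<phi>: "smooth \<phi>"
  shows "controlled \<alpha> (\<lambda>f. LINT x|torus. f x $ l * \<phi> x)"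
  using controlled_I3[OF admissible_component admissible_one \<phi>, of \<alpha> l] by (simp add: I3_def)

lemma measurable_time_AE:
  fixes f g :: "real \<Rightarrow> real"
  assumes f: "f \<in> borel_measurable (time T)" and eq: "AE t in time T. f t = g t"
  shows "g \<in> borel_measurable (time T)"
proof -
  have "(\<lambda>t. if t \<in> {0<..<T} then f t else 0) \<in> borel_measurable lebesgue" by (rule borel_measurable_if_I[OF f]) simp
  moreover have "AE t in lebesgue. t \<in> {0<..<T} \<longrightarrow> f t = g t" using eq by (simp add: AE_restrict_space_iff)
  then have "AE t in lebesgue. (if t \<in> {0<..<T} then f t else 0) = (if t \<in> {0<..<T} then g t else 0)"
    by eventually_elim simp
  ultimately have "(\<lambda>t. if t \<in> {0<..<T} then g t else 0) \<in> borel_measurable lebesgue" by (rule borel_measurable_AE)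
  then show ?thesis by (rule borel_measurable_if_D)
qed

lemma strongly_measurable_functional:
  fixes u :: "real \<Rightarrow> real^3 \<Rightarrow> 'b::euclidean_space" and \<Phi> :: "(real^3 \<Rightarrow> 'b) \<Rightarrow> real"
  assumes u: "strongly_measurable T X N u"
    and cont: "\<And>F f. (\<And>n. F n \<in> X) \<Longrightarrow> f \<in> X \<Longrightarrow> (\<lambda>n. N (F n - f)) \<longlonglongrightarrow> 0 \<Longrightarrow> (\<lambda>n. \<Phi> (F n)) \<longlonglongrightarrow> \<Phi> f"
  shows "(\<lambda>t. \<Phi> (u t)) \<in> borel_measurable (time T)"
proof -
  obtain S where S: "\<And>n. simple_function (time T) (S n)" "\<And>n t. t \<in> {0<..<T} \<Longrightarrow> S n t \<in> X"
    and lim: "AE t in time T. (\<lambda>n. N (S n t - u t)) \<longlonglongrightarrow> 0" and X: "AE t in time T. u t \<in> X"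
    using u unfolding strongly_measurable_def by blast
  have m: "(\<lambda>t. \<Phi> (S n t)) \<in> borel_measurable (time T)" for n
    using simple_function_compose[OF S(1)[of n], of \<Phi>] by (intro borel_measurable_simple_function) (simp add: comp_def)
  have l: "AE t in time T. (\<lambda>n. \<Phi> (S n t)) \<longlonglongrightarrow> \<Phi> (u t)"
    using lim X AE_space[of "time T"]
  proof eventually_elim
    case (elim t)
    then show ?case by (intro cont S(2)) simp_all
  qed
  have "(\<lambda>t. lim (\<lambda>n. \<Phi> (S n t))) \<in> borel_measurable (time T)" by (rule borel_measurable_lim_metric[OF m])
  moreover have "AE t in time T. lim (\<lambda>n. \<Phi> (S n t)) = \<Phi> (u t)" using l by eventually_elim (rule limI)
  ultimately show ?thesis by (rule measurable_time_AE)
qed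

lemma controlled_time:
  assumes u: "u \<in> bochner_Linf T H1_space (H1_norm \<alpha>)" and \<Phi>: "controlled \<alpha> \<Phi>"
  shows "(\<lambda>t. \<Phi> (u t)) \<in> borel_measurable (time T)" "\<exists>B. AE t in time T. \<bar>\<Phi> (u t)\<bar> \<le> B"
proof -
  have s: "strongly_measurable T H1_space (H1_norm \<alpha>) u" and "\<exists>C. AE t in time T. H1_norm \<alpha> (u t) \<le> C"
    using u by (auto simp: bochner_Linf_def)
  then obtain C where C: "AE t in time T. H1_norm \<alpha> (u t) \<le> C" by blast
  show "(\<lambda>t. \<Phi> (u t)) \<in> borel_measurable (time T)"
    by (rule strongly_measurable_functional[OF s]) (use \<Phi> in \<open>simp add: controlled_def H1_conv_def\<close>)
  obtain D where D: "\<And>f. f \<in> H1_space \<Longrightarrow> \<bar>\<Phi> f\<bar> \<le> D * (1 + (H1_norm \<alpha> f)\<^sup>2)" using \<Phi> unfolding controlled_def by blast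
  have X: "AE t in time T. u t \<in> H1_space" using s by (simp add: strongly_measurable_def)
  have "AE t in time T. \<bar>\<Phi> (u t)\<bar> \<le> max 0 D * (1 + C\<^sup>2)"
    using C X
  proof eventually_elim
    case (elim t)
    have "\<bar>\<Phi> (u t)\<bar> \<le> D * (1 + (H1_norm \<alpha> (u t))\<^sup>2)" by (rule D) (rule elim)
    also have "\<dots> \<le> max 0 D * (1 + C\<^sup>2)"
      using elim H1_norm_nonneg[of \<alpha> "u t"] by (intro mult_mono add_left_mono power_mono) auto
    finally show ?case .
  qed
  then show "\<exists>B. AE t in time T. \<bar>\<Phi> (u t)\<bar> \<le> B" by blast
qed

lemma Lp_norm_1: "Lp_norm 1 q = (LINT x|torus. \<bar>q x\<bar>)" for q :: "real^3 \<Rightarrow> real"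
proof -
  have "0 \<le> (LINT x|torus. \<bar>q x\<bar>)" by simp
  then show ?thesis unfolding Lp_norm_def by simp
qed

lemma pressure_functional_bound:
  assumes q: "integrable torus q" and K: "\<And>x. x \<in> cbox 0 1 \<Longrightarrow> \<bar>\<phi> x\<bar> \<le> K" and \<phi>: "smooth \<phi>"
  shows "\<bar>LINT x|torus. q x * \<phi> x\<bar> \<le> K * Lp_norm 1 q"
proof -
  have "norm (LINT x|torus. q x * \<phi> x) \<le> (LINT x|torus. norm (q x * \<phi> x))" by (rule integral_norm_bound)
  also have "\<dots> \<le> (LINT x|torus. K * \<bar>q x\<bar>)"
  proof (rule integral_mono)
    show "integrable torus (\<lambda>x. norm (q x * \<phi> x))" by (intro integrable_norm integrable_mult_smooth q \<phi>)
    show "integrable torus (\<lambda>x. K * \<bar>q x\<bar>)" using q by simp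
    show "norm (q x * \<phi> x) \<le> K * \<bar>q x\<bar>" if "x \<in> space torus" for x
      using mult_left_mono[OF K[of x] abs_ge_zero[of "q x"]] that by (simp add: abs_mult mult.commute)
  qed
  finally show ?thesis unfolding Lp_norm_1 by simp
qed

text \<open>For the pressure the functional is linear and continuous in \<open>L\<^sup>1\<close>.\<close>

lemma pressure_time:
  fixes p :: "real \<Rightarrow> real^3 \<Rightarrow> real"
  assumes p: "p \<in> bochner_Linf T (Lp_space 1) (Lp_norm 1)" and \<phi>: "smooth \<phi>"
  shows "(\<lambda>t. LINT x|torus. p t x * \<phi> x) \<in> borel_measurable (time T)" "\<exists>B. AE t in time T. \<bar>LINT x|torus. p t x * \<phi> x\<bar> \<le> B"
proof -
  obtain K where K: "0 \<le> K" "\<And>x. x \<in> cbox 0 1 \<Longrightarrow> \<bar>\<phi> x\<bar> \<le> K" using smooth_bounded_cube[OF \<phi>] by blast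
  have s: "strongly_measurable T (Lp_space 1) (Lp_norm 1) p" and "\<exists>C. AE t in time T. Lp_norm 1 (p t) \<le> C"
    using p by (auto simp: bochner_Linf_def)
  then obtain C where C: "AE t in time T. Lp_norm 1 (p t) \<le> C" by blast
  have X: "AE t in time T. p t \<in> Lp_space 1" using s by (simp add: strongly_measurable_def)
  show "(\<lambda>t. LINT x|torus. p t x * \<phi> x) \<in> borel_measurable (time T)"
  proof (rule strongly_measurable_functional[OF s, where \<Phi>="\<lambda>q. LINT x|torus. q x * \<phi> x"])
    fix F :: "nat \<Rightarrow> real^3 \<Rightarrow> real" and f
    assume F: "\<And>n. F n \<in> Lp_space 1" and f: "f \<in> Lp_space 1" and lim: "(\<lambda>n. Lp_norm 1 (F n - f)) \<longlonglongrightarrow> 0"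
    note Fi = Lp_space_1_integrable[OF F] and fi = Lp_space_1_integrable[OF f]
    have d: "integrable torus (F n - f)" for n unfolding fun_diff_def by (rule Bochner_Integration.integrable_diff[OF Fi fi])
    have e: "(LINT x|torus. F n x * \<phi> x) - (LINT x|torus. f x * \<phi> x) = (LINT x|torus. (F n - f) x * \<phi> x)" for n
      unfolding fun_diff_def left_diff_distrib
      by (rule Bochner_Integration.integral_diff[symmetric, OF integrable_mult_smooth[OF Fi \<phi>] integrable_mult_smooth[OF fi \<phi>]])
    have "(\<lambda>n. (LINT x|torus. F n x * \<phi> x) - (LINT x|torus. f x * \<phi> x)) \<longlonglongrightarrow> 0"
    proof (rule Lim_null_comparison)
      show "\<forall>\<^sub>F n in sequentially. norm ((LINT x|torus. F n x * \<phi> x) - (LINT x|torus. f x * \<phi> x)) \<le> K * Lp_norm 1 (F n - f)"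
        unfolding e real_norm_def by (intro always_eventually allI pressure_functional_bound d K \<phi>)
      show "(\<lambda>n. K * Lp_norm 1 (F n - f)) \<longlonglongrightarrow> 0" using tendsto_mult[OF tendsto_const[of K] lim] by simp
    qed
    then show "(\<lambda>n. LINT x|torus. F n x * \<phi> x) \<longlonglongrightarrow> (LINT x|torus. f x * \<phi> x)" by (rule LIM_zero_cancel)
  qed
  have "AE t in time T. \<bar>LINT x|torus. p t x * \<phi> x\<bar> \<le> K * C"
    using C X
  proof eventually_elim
    case (elim t)
    have "\<bar>LINT x|torus. p t x * \<phi> x\<bar> \<le> K * Lp_norm 1 (p t)"
      by (intro pressure_functional_bound Lp_space_1_integrable elim K \<phi>)
    also have "\<dots> \<le> K * C" by (rule mult_left_mono[OF elim(1) K(1)])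
    finally show ?case .
  qed
  then show "\<exists>B. AE t in time T. \<bar>LINT x|torus. p t x * \<phi> x\<bar> \<le> B" by blast
qed

definition product_test :: "(real \<Rightarrow> real) \<Rightarrow> (real^3 \<Rightarrow> real) \<Rightarrow> 'b::real_normed_vector \<Rightarrow> (real^3) \<times> real \<Rightarrow> 'b" where
  "product_test \<eta> \<phi> v z = (\<eta> (snd z) * \<phi> (fst z)) *\<^sub>R v"

lemma
  assumes \<eta>: "smooth \<eta>" and \<phi>: "smooth \<phi>"
  shows smooth_product_test: "smooth (product_test \<eta> \<phi> v)"
    and dx_product_test: "dx i (product_test \<eta> \<phi> v) = product_test \<eta> (pd i \<phi>) v"
    and dt_product_test: "dt (product_test \<eta> \<phi> v) = product_test (dir_deriv 1 \<eta>) \<phi> v"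
proof -
  have s1: "smooth (\<lambda>z::(real^3) \<times> real. \<eta> (snd z))" using smooth_affine[OF bounded_linear_snd \<eta>, of 0] by simp
  have s2: "smooth (\<lambda>z::(real^3) \<times> real. \<phi> (fst z))" using smooth_affine[OF bounded_linear_fst \<phi>, of 0] by simp
  show "smooth (product_test \<eta> \<phi> v)"
    unfolding product_test_def[abs_def] by (intro smooth_scaleR smooth_mult s1 s2 smooth_const)
  have h: "(product_test \<eta> \<phi> v has_derivative
     (\<lambda>h. (\<eta> (snd z) * frechet_derivative \<phi> (at (fst z)) (fst h) + (dir_deriv 1 \<eta> (snd z) * snd h) * \<phi> (fst z)) *\<^sub>R v)) (at z)" for z
  proof -
    have e: "(\<eta> has_derivative (*) (dir_deriv 1 \<eta> (snd z))) (at (snd z))"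
      using smooth_has_real_derivative[OF \<eta>] by (simp add: has_field_derivative_def)
    show ?thesis unfolding product_test_def[abs_def]
      by (rule has_derivative_scaleR_left[OF has_derivative_mult[OF
            has_derivative_compose[OF bounded_linear_imp_has_derivative[OF bounded_linear_snd] e]
            has_derivative_compose[OF bounded_linear_imp_has_derivative[OF bounded_linear_fst] smooth_has_derivative[OF \<phi>]]]])
  qed
  have lin: "frechet_derivative \<phi> (at x) 0 = 0" for x
    using linear_0[OF has_derivative_linear[OF smooth_has_derivative[OF \<phi>]]] .
  show "dx i (product_test \<eta> \<phi> v) = product_test \<eta> (pd i \<phi>) v"
    by (rule ext, subst dir_deriv_eqI[OF h]) (simp add: product_test_def dir_deriv_def)
  show "dt (product_test \<eta> \<phi> v) = product_test (dir_deriv 1 \<eta>) \<phi> v"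
    by (rule ext, subst dir_deriv_eqI[OF h]) (simp add: product_test_def lin)
qed

lemma product_test_in_test_functions:
  assumes \<eta>: "\<eta> \<in> time_bump T" and \<phi>: "smooth \<phi>" "periodic \<phi>"
  shows "product_test \<eta> \<phi> v \<in> test_functions T"
proof -
  obtain a b where "0 < a" "b < T" "\<And>t. t \<notin> {a..b} \<Longrightarrow> \<eta> t = 0" and s: "smooth \<eta>"
    using \<eta> unfolding time_bump_def by blast
  then have "\<exists>a b. 0 < a \<and> b < T \<and> (\<forall>x t. t \<notin> {a..b} \<longrightarrow> product_test \<eta> \<phi> v (x, t) = 0)"
    unfolding product_test_def by (intro exI[of _ a] exI[of _ b]) simp
  moreover have "periodic (\<lambda>x. product_test \<eta> \<phi> v (x, t))" for t
    using \<phi>(2) by (simp add: periodic_def product_test_def)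
  ultimately show ?thesis unfolding test_functions_def using smooth_product_test[OF s \<phi>(1)] by blast
qed

section \<open>The equation for a Fourier coefficient\<close>

lemma sum_axis_eq:
  fixes X :: "3 \<Rightarrow> real"
  shows "(\<Sum>j\<in>UNIV. X j * (r *\<^sub>R axis l 1 :: real^3) $ j) = X l * r"
proof -
  have "(\<Sum>j\<in>UNIV. X j * (r *\<^sub>R axis l 1 :: real^3) $ j) = (\<Sum>j\<in>UNIV. if j = l then X j * r else 0)"
    by (rule sum.cong[OF refl]) (simp add: axis_def)
  then show ?thesis by simp
qed

text \<open>For test functions in the direction of the \<open>l\<close>-th unit vector, the weak formulation reduces to its \<open>l\<close>-th component. This is
pure algebra at a single point, so all functions are replaced by their values.\<close>

lemma weak_form_integrand:
  fixes U :: "real^3" and V :: "3 \<Rightarrow> real^3" and a P :: real and b d :: "3 \<Rightarrow> real" and e :: "3 \<Rightarrow> 3 \<Rightarrow> real" and l :: 3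
  defines "z \<equiv> axis l 1 :: real^3"
  shows "U \<bullet> (a *\<^sub>R z) + \<alpha>\<^sup>2 * (\<Sum>k\<in>UNIV. V k \<bullet> (b k *\<^sub>R z))
      + (\<Sum>i\<in>UNIV. \<Sum>j\<in>UNIV. U $ i * U $ j * (d i *\<^sub>R z) $ j)
      + \<alpha>\<^sup>2 * (\<Sum>i\<in>UNIV. \<Sum>j\<in>UNIV. \<Sum>k\<in>UNIV. V k $ i * V k $ j * (d i *\<^sub>R z) $ j)
      + \<alpha>\<^sup>2 * (\<Sum>i\<in>UNIV. \<Sum>j\<in>UNIV. \<Sum>k\<in>UNIV. V k $ i * U $ j * (e i k *\<^sub>R z) $ j)
      + P * (\<Sum>i\<in>UNIV. (d i *\<^sub>R z) $ i)
    = (U $ l * a + \<alpha>\<^sup>2 * (\<Sum>k\<in>UNIV. V k $ l * b k))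
      + ((\<Sum>i\<in>UNIV. U $ i * U $ l * d i) + \<alpha>\<^sup>2 * (\<Sum>i\<in>UNIV. \<Sum>k\<in>UNIV. V k $ i * V k $ l * d i + V k $ i * U $ l * e i k))
      + P * d l"
proof -
  have 1: "v \<bullet> (r *\<^sub>R z) = v $ l * r" for v r by (simp add: z_def inner_axis mult.commute)
  have 2: "(\<Sum>j\<in>UNIV. X j * (r *\<^sub>R z) $ j) = X l * r" for X r unfolding z_def by (rule sum_axis_eq)
  have 3: "(\<Sum>j\<in>UNIV. \<Sum>k\<in>UNIV. V k $ i * X k j * (r k *\<^sub>R z) $ j) = (\<Sum>k\<in>UNIV. V k $ i * X k l * r k)" for i X r
    by (subst sum.swap) (rule sum.cong[OF refl], rule 2)
  have 4: "(\<Sum>i\<in>UNIV. (d i *\<^sub>R z) $ i) = d l"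
  proof -
    have "(\<Sum>i\<in>UNIV. (d i *\<^sub>R z) $ i) = (\<Sum>i\<in>UNIV. d i * (1 *\<^sub>R z) $ i)" by simp
    then show ?thesis unfolding 2 by simp
  qed
  show ?thesis unfolding 1 2 3 4 sum.distrib by (simp add: algebra_simps)
qed

lemma inner_integral:
  fixes f :: "real^3 \<Rightarrow> real^3" and q :: "real^3 \<Rightarrow> real" and \<eta> :: "real \<Rightarrow> real"
    and k :: "real^3" and c t \<alpha> :: real and l :: 3
  assumes f: "f \<in> H1_space" and q: "q \<in> Lp_space 1" and \<eta>: "smooth \<eta>" and k: "k \<in> frequencies"
  defines "\<psi> \<equiv> product_test \<eta> (wave k c) (axis l 1 :: real^3)"
  shows "(LINT x|torus.
          f x \<bullet> dt \<psi> (x, t)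
          + \<alpha>\<^sup>2 * (\<Sum>k\<in>UNIV. weak_deriv k f x \<bullet> dx k (dt \<psi>) (x, t))
          + (\<Sum>i\<in>UNIV. \<Sum>j\<in>UNIV. f x $ i * f x $ j * dx i \<psi> (x, t) $ j)
          + \<alpha>\<^sup>2 * (\<Sum>i\<in>UNIV. \<Sum>j\<in>UNIV. \<Sum>k\<in>UNIV.
                weak_deriv k f x $ i * weak_deriv k f x $ j * dx i \<psi> (x, t) $ j)
          + \<alpha>\<^sup>2 * (\<Sum>i\<in>UNIV. \<Sum>j\<in>UNIV. \<Sum>k\<in>UNIV.
                weak_deriv k f x $ i * f x $ j * dx i (dx k \<psi>) (x, t) $ j)
          + q x * (\<Sum>i\<in>UNIV. dx i \<psi> (x, t) $ i))
    = dir_deriv 1 \<eta> t * (symbol \<alpha> k * trig_coeff (\<lambda>x. f x $ l) k c)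
      + \<eta> t * (flux \<alpha> f (\<lambda>j. weak_deriv j f) l (wave k c) + (LINT x|torus. q x * pd l (wave k c) x))"
    (is "(LINT x|torus. ?L x) = _")
proof -
  let ?\<phi> = "wave k c"
  define D where "D j = weak_deriv j f" for j
  have sm: "smooth ?\<phi>" "smooth (pd i ?\<phi>)" "smooth (pd i (pd j ?\<phi>))" for i j by (intro smooth_pd smooth_wave)+
  have d\<eta>: "smooth (dir_deriv 1 \<eta>)" by (rule smooth_dir_deriv[OF \<eta>]) simp
  have wd: "has_weak_deriv j f (D j)" for j unfolding D_def by (rule H1_weak_deriv(1)[OF f])
  have sq: "square_integrable (\<lambda>x. f x $ i)" "square_integrable (\<lambda>x. D j x $ i)" for i j
    unfolding D_def by (rule Lp_space_2_square_integrable(1)[OF H1_weak_deriv(3)[OF f]], rule Lp_space_2_square_integrable(1)[OF H1_weak_deriv(2)[OF f]])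
  have fi: "integrable torus (\<lambda>x. f x $ i)" "integrable torus (\<lambda>x. D j x $ i)" for i j
    using wd[of j] Lp_space_1_integrable integrable_vec_nth unfolding has_weak_deriv_def by blast+
  have qi: "integrable torus q" by (rule Lp_space_1_integrable[OF q])
  define A where "A x = f x $ l * ?\<phi> x + \<alpha>\<^sup>2 * (\<Sum>j\<in>UNIV. D j x $ l * pd j ?\<phi> x)" for x
  define B where "B x = (\<Sum>i\<in>UNIV. f x $ i * f x $ l * pd i ?\<phi> x)
     + \<alpha>\<^sup>2 * (\<Sum>i\<in>UNIV. \<Sum>j\<in>UNIV. D j x $ i * D j x $ l * pd i ?\<phi> x + D j x $ i * f x $ l * pd i (pd j ?\<phi>) x)" for x
  define C where "C x = q x * pd l ?\<phi> x" for x
  have Lx: "?L x = dir_deriv 1 \<eta> t * A x + \<eta> t * (B x + C x)" for x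
  proof -
    have 1: "dt \<psi> (x, t) = (dir_deriv 1 \<eta> t * ?\<phi> x) *\<^sub>R axis l 1"
      "dx j (dt \<psi>) (x, t) = (dir_deriv 1 \<eta> t * pd j ?\<phi> x) *\<^sub>R axis l 1"
      "dx i \<psi> (x, t) = (\<eta> t * pd i ?\<phi> x) *\<^sub>R axis l 1"
      "dx i (dx j \<psi>) (x, t) = (\<eta> t * pd i (pd j ?\<phi>) x) *\<^sub>R axis l 1" for i j
      unfolding \<psi>_def dt_product_test[OF \<eta> sm(1)] dx_product_test[OF \<eta> sm(1)] dx_product_test[OF d\<eta> sm(1)] dx_product_test[OF \<eta> sm(2)]
      by (simp_all add: product_test_def)
    show ?thesis
      unfolding 1 weak_form_integrand D_def[symmetric] A_def B_def C_def
      by (simp add: algebra_simps sum_distrib_left sum.distrib)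
  qed
  have Ai: "integrable torus A" unfolding A_def
    by (intro Bochner_Integration.integrable_add integrable_mult_right Bochner_Integration.integrable_sum integrable_mult_smooth fi sm)
  have Bi: "integrable torus B" unfolding B_def
    by (intro Bochner_Integration.integrable_add integrable_mult_right Bochner_Integration.integrable_sum integrable_mult_smooth square_integrable_mult sq sm)
  have Ci: "integrable torus C" unfolding C_def by (intro integrable_mult_smooth qi sm)
  have AI: "(LINT x|torus. A x) = symbol \<alpha> k * trig_coeff (\<lambda>x. f x $ l) k c"
  proof -
    have i: "integrable torus (\<lambda>x. f x $ l * ?\<phi> x)" "integrable torus (\<lambda>x. D j x $ l * pd j ?\<phi> x)" for j
      by (intro integrable_mult_smooth fi sm)+
    have "(LINT x|torus. A x) = (LINT x|torus. f x $ l * ?\<phi> x) + \<alpha>\<^sup>2 * (\<Sum>j\<in>UNIV. LINT x|torus. D j x $ l * pd j ?\<phi> x)"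
      unfolding A_def Bochner_Integration.integral_add[OF i(1) integrable_mult_right[OF Bochner_Integration.integrable_sum[OF i(2)]]]
        integral_mult_right_zero Bochner_Integration.integral_sum[OF i(2)] ..
    also have "\<dots> = symbol \<alpha> k * trig_coeff (\<lambda>x. f x $ l) k c" by (rule H1_pairing_wave[OF wd k])
    finally show ?thesis .
  qed
  have BI: "(LINT x|torus. B x) = flux \<alpha> f (\<lambda>j. weak_deriv j f) l ?\<phi>"
  proof -
    have i1: "integrable torus (\<lambda>x. f x $ i * f x $ l * pd i ?\<phi> x)" for i by (intro integrable_mult_smooth square_integrable_mult sq sm)
    have i2: "integrable torus (\<lambda>x. D j x $ i * D j x $ l * pd i ?\<phi> x)" for i j by (intro integrable_mult_smooth square_integrable_mult sq sm)
    have i3: "integrable torus (\<lambda>x. D j x $ i * f x $ l * pd i (pd j ?\<phi>) x)" for i j by (intro integrable_mult_smooth square_integrable_mult sq sm)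
    have i4: "integrable torus (\<lambda>x. D j x $ i * D j x $ l * pd i ?\<phi> x + D j x $ i * f x $ l * pd i (pd j ?\<phi>) x)" for i j
      by (rule Bochner_Integration.integrable_add[OF i2 i3])
    have i5: "(LINT x|torus. D j x $ i * D j x $ l * pd i ?\<phi> x + D j x $ i * f x $ l * pd i (pd j ?\<phi>) x)
      = I3 (\<lambda>x. D j x $ i) (\<lambda>x. D j x $ l) (pd i ?\<phi>) + I3 (\<lambda>x. D j x $ i) (\<lambda>x. f x $ l) (pd i (pd j ?\<phi>))" for i j
      unfolding I3_def by (rule Bochner_Integration.integral_add[OF i2 i3])
    have i6: "integrable torus (\<lambda>x. \<Sum>j\<in>UNIV. D j x $ i * D j x $ l * pd i ?\<phi> x + D j x $ i * f x $ l * pd i (pd j ?\<phi>) x)" for i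
      by (rule Bochner_Integration.integrable_sum, rule i4)
    have S1: "(LINT x|torus. (\<Sum>i\<in>UNIV. f x $ i * f x $ l * pd i ?\<phi> x)) = (\<Sum>i\<in>UNIV. I3 (\<lambda>x. f x $ i) (\<lambda>x. f x $ l) (pd i ?\<phi>))"
      unfolding I3_def by (rule Bochner_Integration.integral_sum, rule i1)
    have S2: "(LINT x|torus. (\<Sum>i\<in>UNIV. \<Sum>j\<in>UNIV. D j x $ i * D j x $ l * pd i ?\<phi> x + D j x $ i * f x $ l * pd i (pd j ?\<phi>) x))
      = (\<Sum>i\<in>UNIV. \<Sum>j\<in>UNIV. I3 (\<lambda>x. D j x $ i) (\<lambda>x. D j x $ l) (pd i ?\<phi>) + I3 (\<lambda>x. D j x $ i) (\<lambda>x. f x $ l) (pd i (pd j ?\<phi>)))"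
      unfolding Bochner_Integration.integral_sum[OF i6] Bochner_Integration.integral_sum[OF i4] i5 ..
    have "(LINT x|torus. B x) = (LINT x|torus. (\<Sum>i\<in>UNIV. f x $ i * f x $ l * pd i ?\<phi> x))
      + (LINT x|torus. \<alpha>\<^sup>2 * (\<Sum>i\<in>UNIV. \<Sum>j\<in>UNIV. D j x $ i * D j x $ l * pd i ?\<phi> x + D j x $ i * f x $ l * pd i (pd j ?\<phi>) x))"
      unfolding B_def
      by (rule Bochner_Integration.integral_add; (rule integrable_mult_right)?; rule Bochner_Integration.integrable_sum; rule i1 i6)
    then show ?thesis unfolding integral_mult_right_zero S1 S2 flux_def D_def[symmetric] .
  qed
  have "(LINT x|torus. ?L x) = (LINT x|torus. dir_deriv 1 \<eta> t * A x + \<eta> t * (B x + C x))" by (simp only: Lx)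
  also have "\<dots> = dir_deriv 1 \<eta> t * (LINT x|torus. A x) + \<eta> t * ((LINT x|torus. B x) + (LINT x|torus. C x))"
    unfolding Bochner_Integration.integral_add[OF integrable_mult_right[OF Ai] integrable_mult_right[OF Bochner_Integration.integrable_add[OF Bi Ci]]]
      integral_mult_right_zero Bochner_Integration.integral_add[OF Bi Ci] ..
  finally show ?thesis unfolding AI BI C_def .
qed

lemma bounded_measurable_integrable_time:
  fixes h :: "real \<Rightarrow> real"
  assumes "h \<in> borel_measurable (time T)" "\<exists>B. AE t in time T. \<bar>h t\<bar> \<le> B"
  shows "integrable (time T) h"
proof -
  obtain B where B: "AE t in time T. \<bar>h t\<bar> \<le> B" using assms(2) by blast
  show ?thesis
  proof (rule Bochner_Integration.integrable_bound[OF integrable_time_const[of T B] assms(1)])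
    show "AE t in time T. norm (h t) \<le> norm B" using B
    proof eventually_elim
      case (elim t) then show ?case by simp
    qed
  qed
qed

lemma integral_time_cong_AE:
  fixes f g :: "real \<Rightarrow> real"
  assumes "g \<in> borel_measurable (time T)" "AE t in time T. f t = g t"
  shows "(LINT t|time T. f t) = (LINT t|time T. g t)"
proof -
  have "AE t in time T. g t = f t" using assms(2) by eventually_elim simp
  from measurable_time_AE[OF assms(1) this] show ?thesis using assms by (intro integral_cong_AE)
qed

lemma controlled_trig_coeff: "controlled \<alpha> (\<lambda>f. trig_coeff (\<lambda>x. f x $ l) k c)"
  unfolding trig_coeff_def by (rule controlled_integral[OF smooth_wave])

text \<open>The test functions \<open>\<eta>(t) wave k c x\<close> in the direction of the \<open>l\<close>-th unit vector turn the equation into a scalar one: the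
derivative of a Fourier coefficient of \<open>u - \<alpha>\<^sup>2\<Delta>u\<close> is the flux through the wave plus the pressure term.\<close>

lemma weak_solution_coefficient:
  assumes \<alpha>: "\<alpha> > 0" and ws: "weak_solution \<alpha> T u p" and k: "k \<in> frequencies" and \<eta>: "\<eta> \<in> time_bump T"
  shows "(LINT t|time T. dir_deriv 1 \<eta> t * (symbol \<alpha> k * trig_coeff (\<lambda>x. u t x $ l) k c)
      + \<eta> t * (flux \<alpha> (u t) (\<lambda>j. weak_deriv j (u t)) l (wave k c) + (LINT x|torus. p t x * pd l (wave k c) x))) = 0"
proof -
  have u: "u \<in> bochner_Linf T H1_space (H1_norm \<alpha>)" and p: "p \<in> bochner_Linf T (Lp_space 1) (Lp_norm 1)"
    using ws unfolding weak_solution_def by blast+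
  have uX: "AE t in time T. u t \<in> H1_space" and pX: "AE t in time T. p t \<in> Lp_space 1"
    using u p by (auto simp: bochner_Linf_def strongly_measurable_def)
  have s\<eta>: "smooth \<eta>" using \<eta> by (simp add: time_bump_def)
  have d\<eta>: "smooth (dir_deriv 1 \<eta>)" by (rule smooth_dir_deriv[OF s\<eta>]) simp
  have m: "h \<in> borel_measurable (time T)" if "smooth h" for h :: "real \<Rightarrow> real"
    by (rule continuous_imp_measurable_on_sets_lebesgue[OF smooth_imp_continuous[OF that]]) simp
  let ?\<psi> = "product_test \<eta> (wave k c) (axis l 1 :: real^3)"
  have "?\<psi> \<in> test_functions T" by (rule product_test_in_test_functions[OF \<eta> smooth_wave periodic_wave[OF k]])
  then have z: "(LINT t|time T. LINT x|torus.
          u t x \<bullet> dt ?\<psi> (x, t)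
          + \<alpha>\<^sup>2 * (\<Sum>k\<in>UNIV. weak_deriv k (u t) x \<bullet> dx k (dt ?\<psi>) (x, t))
          + (\<Sum>i\<in>UNIV. \<Sum>j\<in>UNIV. u t x $ i * u t x $ j * dx i ?\<psi> (x, t) $ j)
          + \<alpha>\<^sup>2 * (\<Sum>i\<in>UNIV. \<Sum>j\<in>UNIV. \<Sum>k\<in>UNIV.
                weak_deriv k (u t) x $ i * weak_deriv k (u t) x $ j * dx i ?\<psi> (x, t) $ j)
          + \<alpha>\<^sup>2 * (\<Sum>i\<in>UNIV. \<Sum>j\<in>UNIV. \<Sum>k\<in>UNIV.
                weak_deriv k (u t) x $ i * u t x $ j * dx i (dx k ?\<psi>) (x, t) $ j)
          + p t x * (\<Sum>i\<in>UNIV. dx i ?\<psi> (x, t) $ i)) = 0"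
    using ws unfolding weak_solution_def by blast
  have "(LINT t|time T. LINT x|torus.
          u t x \<bullet> dt ?\<psi> (x, t)
          + \<alpha>\<^sup>2 * (\<Sum>k\<in>UNIV. weak_deriv k (u t) x \<bullet> dx k (dt ?\<psi>) (x, t))
          + (\<Sum>i\<in>UNIV. \<Sum>j\<in>UNIV. u t x $ i * u t x $ j * dx i ?\<psi> (x, t) $ j)
          + \<alpha>\<^sup>2 * (\<Sum>i\<in>UNIV. \<Sum>j\<in>UNIV. \<Sum>k\<in>UNIV.
                weak_deriv k (u t) x $ i * weak_deriv k (u t) x $ j * dx i ?\<psi> (x, t) $ j)
          + \<alpha>\<^sup>2 * (\<Sum>i\<in>UNIV. \<Sum>j\<in>UNIV. \<Sum>k\<in>UNIV.
                weak_deriv k (u t) x $ i * u t x $ j * dx i (dx k ?\<psi>) (x, t) $ j)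
          + p t x * (\<Sum>i\<in>UNIV. dx i ?\<psi> (x, t) $ i))
    = (LINT t|time T. dir_deriv 1 \<eta> t * (symbol \<alpha> k * trig_coeff (\<lambda>x. u t x $ l) k c)
      + \<eta> t * (flux \<alpha> (u t) (\<lambda>j. weak_deriv j (u t)) l (wave k c) + (LINT x|torus. p t x * pd l (wave k c) x)))"
  proof (rule integral_time_cong_AE)
    show "(\<lambda>t. dir_deriv 1 \<eta> t * (symbol \<alpha> k * trig_coeff (\<lambda>x. u t x $ l) k c)
      + \<eta> t * (flux \<alpha> (u t) (\<lambda>j. weak_deriv j (u t)) l (wave k c) + (LINT x|torus. p t x * pd l (wave k c) x))) \<in> borel_measurable (time T)"
      by (intro borel_measurable_add borel_measurable_times m s\<eta> d\<eta> borel_measurable_const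
          controlled_time(1)[OF u controlled_trig_coeff] controlled_time(1)[OF u controlled_flux[OF \<alpha> smooth_wave]] pressure_time(1)[OF p smooth_pd[OF smooth_wave]])
    show "AE t in time T. (LINT x|torus.
          u t x \<bullet> dt ?\<psi> (x, t)
          + \<alpha>\<^sup>2 * (\<Sum>k\<in>UNIV. weak_deriv k (u t) x \<bullet> dx k (dt ?\<psi>) (x, t))
          + (\<Sum>i\<in>UNIV. \<Sum>j\<in>UNIV. u t x $ i * u t x $ j * dx i ?\<psi> (x, t) $ j)
          + \<alpha>\<^sup>2 * (\<Sum>i\<in>UNIV. \<Sum>j\<in>UNIV. \<Sum>k\<in>UNIV.
                weak_deriv k (u t) x $ i * weak_deriv k (u t) x $ j * dx i ?\<psi> (x, t) $ j)
          + \<alpha>\<^sup>2 * (\<Sum>i\<in>UNIV. \<Sum>j\<in>UNIV. \<Sum>k\<in>UNIV.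
                weak_deriv k (u t) x $ i * u t x $ j * dx i (dx k ?\<psi>) (x, t) $ j)
          + p t x * (\<Sum>i\<in>UNIV. dx i ?\<psi> (x, t) $ i))
      = dir_deriv 1 \<eta> t * (symbol \<alpha> k * trig_coeff (\<lambda>x. u t x $ l) k c)
      + \<eta> t * (flux \<alpha> (u t) (\<lambda>j. weak_deriv j (u t)) l (wave k c) + (LINT x|torus. p t x * pd l (wave k c) x))"
      using uX pX by eventually_elim (rule inner_integral[OF _ _ s\<eta> k])
  qed
  then show ?thesis unfolding z by (rule sym)
qed

lemma countable_frequencies: "countable frequencies"
proof -
  have "frequencies \<subseteq> (\<Union>j. low_freq j)"
  proof
    fix k assume k: "k \<in> frequencies"
    obtain j where j: "norm k < 2 ^ j" using real_arch_pow[of 2 "norm k"] by auto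
    have "(2::real) ^ j \<le> 2 ^ (j + 1)" by simp
    then have "\<bar>k $ i\<bar> \<le> 2 ^ (j + 1)" for i using component_le_norm_cart[of k i] j by linarith
    then have "k \<in> low_freq j" using k by (simp add: low_freq_def)
    then show "k \<in> (\<Union>j. low_freq j)" by blast
  qed
  moreover have "countable (\<Union>j. low_freq j)" by (rule countable_UN) (auto intro: countable_finite finite_low_freq)
  ultimately show ?thesis by (rule countable_subset)
qed

text \<open>For a fixed wave the incompressibility equation holds at almost all times by the fundamental lemma; there are only countably many waves.\<close>

lemma weak_solution_divergence_free:
  assumes \<theta>: "lp_cutoff \<theta>" and ws: "weak_solution \<alpha> T u p"
  shows "AE t in time T. divergence_free (u t)"
proof -
  have u: "u \<in> bochner_Linf T H1_space (H1_norm \<alpha>)" using ws unfolding weak_solution_def by blast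
  have uX: "AE t in time T. u t \<in> H1_space" using u by (auto simp: bochner_Linf_def strongly_measurable_def)
  have one: "AE t in time T. (\<Sum>i\<in>UNIV. k $ i * trig_coeff (\<lambda>x. u t x $ i) k c) = 0" if k: "k \<in> frequencies" for k c
  proof -
    \<comment> \<open>The phase anticipates the shift by \<open>pi/2\<close> under differentiation.\<close>
    let ?\<phi> = "wave k (c - pi/2)"
    have ctr: "controlled \<alpha> (\<lambda>f. \<Sum>i\<in>UNIV. LINT x|torus. f x $ i * pd i ?\<phi> x)"
      by (intro controlled_sum controlled_integral smooth_pd smooth_wave)
    define d where "d t = (\<Sum>i\<in>UNIV. LINT x|torus. u t x $ i * pd i ?\<phi> x)" for t
    have dm: "d \<in> borel_measurable (time T)" unfolding d_def by (rule controlled_time(1)[OF u ctr])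
    have di: "integrable (time T) d"
      using dm controlled_time(2)[OF u ctr] unfolding d_def by (rule bounded_measurable_integrable_time)
    have "(LINT t|time T. \<eta> t * d t) = 0" if \<eta>: "\<eta> \<in> time_bump T" for \<eta>
    proof -
      have s\<eta>: "smooth \<eta>" using \<eta> by (simp add: time_bump_def)
      let ?\<psi> = "product_test \<eta> ?\<phi> (1::real)"
      have "?\<psi> \<in> test_functions T" by (rule product_test_in_test_functions[OF \<eta> smooth_wave periodic_wave[OF k]])
      then have "(LINT t|time T. LINT x|torus. (\<Sum>i\<in>UNIV. u t x $ i * dx i ?\<psi> (x, t))) = 0"
        using ws unfolding weak_solution_def by blast
      moreover have "(LINT t|time T. LINT x|torus. (\<Sum>i\<in>UNIV. u t x $ i * dx i ?\<psi> (x, t))) = (LINT t|time T. \<eta> t * d t)"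
      proof (rule integral_time_cong_AE)
        show "(\<lambda>t. \<eta> t * d t) \<in> borel_measurable (time T)"
          by (rule borel_measurable_integrable[OF time_bump_integrable[OF di s\<eta>]])
        show "AE t in time T. (LINT x|torus. (\<Sum>i\<in>UNIV. u t x $ i * dx i ?\<psi> (x, t))) = \<eta> t * d t"
          using uX
        proof eventually_elim
          case (elim t)
          have "integrable torus (u t)" using H1_weak_deriv(1)[OF elim] Lp_space_1_integrable unfolding has_weak_deriv_def by blast
          then have i: "integrable torus (\<lambda>x. u t x $ i * pd i ?\<phi> x)" for i
            by (intro integrable_mult_smooth integrable_vec_nth smooth_pd smooth_wave)
          have "(\<Sum>i\<in>UNIV. u t x $ i * dx i ?\<psi> (x, t)) = \<eta> t * (\<Sum>i\<in>UNIV. u t x $ i * pd i ?\<phi> x)" for x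
            unfolding dx_product_test[OF s\<eta> smooth_wave] by (simp add: product_test_def sum_distrib_left mult_ac)
          then show ?case by (simp only: integral_mult_right_zero Bochner_Integration.integral_sum[OF i] d_def)
        qed
      qed
      ultimately show ?thesis by simp
    qed
    then have "AE t in time T. d t = 0" by (rule fundamental_lemma[OF \<theta> di])
    then show ?thesis
    proof eventually_elim
      case (elim t)
      have "(LINT x|torus. u t x $ i * pd i ?\<phi> x) = 2 * pi * (k $ i * trig_coeff (\<lambda>x. u t x $ i) k c)" for i
      proof -
        have "(LINT x|torus. u t x $ i * pd i ?\<phi> x) = (LINT x|torus. (2 * pi * k $ i) * (u t x $ i * wave k c x))"
          unfolding dir_deriv_wave by (rule Bochner_Integration.integral_cong[OF refl]) simp
        then show ?thesis unfolding trig_coeff_def integral_mult_right_zero by simp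
      qed
      then have "2 * pi * (\<Sum>i\<in>UNIV. k $ i * trig_coeff (\<lambda>x. u t x $ i) k c) = 0"
        using elim by (simp only: d_def sum_distrib_left)
      then show ?case by simp
    qed
  qed
  show ?thesis unfolding divergence_free_def
    unfolding AE_ball_countable[OF countable_frequencies]
  proof
    fix k assume k: "k \<in> frequencies"
    have "countable {0, pi/2}" by simp
    then show "AE t in time T. \<forall>c\<in>{0, pi/2}. (\<Sum>i\<in>UNIV. k $ i * trig_coeff (\<lambda>x. u t x $ i) k c) = 0"
      unfolding AE_ball_countable[OF \<open>countable {0, pi/2}\<close>] using one[OF k] by blast
  qed
qed

section \<open>Conservation of energy\<close>

definition force :: "real \<Rightarrow> (real \<Rightarrow> real^3 \<Rightarrow> real^3) \<Rightarrow> (real \<Rightarrow> real^3 \<Rightarrow> real) \<Rightarrow> real^3 \<Rightarrow> real \<Rightarrow> 3 \<Rightarrow> real \<Rightarrow> real" where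
  "force \<alpha> u p k c l t = flux \<alpha> (u t) (\<lambda>j. weak_deriv j (u t)) l (wave k c) + (LINT x|torus. p t x * pd l (wave k c) x)"

text \<open>The equation determines the derivative of \<open>symbol \<alpha> k\<close> times the coefficient. So the square of this product, divided by the
symbol, is the energy carried by the wave, and \<open>Q\<close> is its continuous version.\<close>

lemma coefficient_energy:
  assumes \<alpha>: "\<alpha> > 0" and T: "T > 0" and \<theta>: "lp_cutoff \<theta>" and ws: "weak_solution \<alpha> T u p" and k: "k \<in> frequencies"
  shows "\<exists>Q. (AE t in time T. symbol \<alpha> k * (trig_coeff (\<lambda>x. u t x $ l) k c)\<^sup>2 = Q t) \<and>
    (\<forall>s t. 0 < s \<longrightarrow> s \<le> t \<longrightarrow> t < T \<longrightarrow>
       integrable (lebesgue_on {s..t}) (\<lambda>\<tau>. trig_coeff (\<lambda>x. u \<tau> x $ l) k c * force \<alpha> u p k c l \<tau>) \<and>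
       Q t - Q s = 2 * (LINT \<tau>|lebesgue_on {s..t}. trig_coeff (\<lambda>x. u \<tau> x $ l) k c * force \<alpha> u p k c l \<tau>))"
proof -
  have u: "u \<in> bochner_Linf T H1_space (H1_norm \<alpha>)" and p: "p \<in> bochner_Linf T (Lp_space 1) (Lp_norm 1)"
    using ws unfolding weak_solution_def by blast+
  let ?sy = "symbol \<alpha> k"
  have sy_pos: "0 < ?sy" by (rule symbol_pos)
  define b where "b t = trig_coeff (\<lambda>x. u t x $ l) k c" for t
  define a where "a t = ?sy * b t" for t
  let ?g = "force \<alpha> u p k c l"
  have bi: "integrable (time T) b" unfolding b_def
    by (rule bounded_measurable_integrable_time[OF controlled_time(1)[OF u controlled_trig_coeff] controlled_time(2)[OF u controlled_trig_coeff]])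
  have ai: "integrable (time T) a" unfolding a_def using bi by simp
  note fl = controlled_time[OF u controlled_flux[OF \<alpha> smooth_wave[of k c], of \<alpha> l]]
  note pr = pressure_time[OF p smooth_pd[OF smooth_wave[of k c], of l]]
  have gm: "?g \<in> borel_measurable (time T)"
    unfolding force_def[abs_def] by (intro borel_measurable_add fl(1) pr(1))
  obtain B1 where B1: "AE t in time T. \<bar>flux \<alpha> (u t) (\<lambda>j. weak_deriv j (u t)) l (wave k c)\<bar> \<le> B1" using fl(2) by blast
  obtain B2 where B2: "AE t in time T. \<bar>LINT x|torus. p t x * pd l (wave k c) x\<bar> \<le> B2" using pr(2) by blast
  have gB: "AE t in time T. \<bar>?g t\<bar> \<le> B1 + B2"
    using B1 B2
  proof eventually_elim
    case (elim t)
    then show ?case unfolding force_def by linarith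
  qed
  have weak: "(LINT t|time T. dir_deriv 1 \<eta> t * a t + \<eta> t * ?g t) = 0" if "\<eta> \<in> time_bump T" for \<eta>
    using weak_solution_coefficient[OF \<alpha> ws k that, of l c] unfolding a_def b_def force_def .
  obtain F where F: "AE t in time T. a t = F t"
    "\<And>s t. 0 < s \<Longrightarrow> s \<le> t \<Longrightarrow> t < T \<Longrightarrow> (F t)\<^sup>2 - (F s)\<^sup>2 = 2 * (LINT \<tau>|lebesgue_on {s..t}. a \<tau> * ?g \<tau>)"
    "\<And>s t. 0 < s \<Longrightarrow> s \<le> t \<Longrightarrow> t < T \<Longrightarrow> integrable (lebesgue_on {s..t}) (\<lambda>\<tau>. a \<tau> * ?g \<tau>)"
    using square_of_weak_primitive[OF \<theta> T ai gm gB weak] by blast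
  have ab: "b \<tau> * ?g \<tau> = (1 / ?sy) * (a \<tau> * ?g \<tau>)" for \<tau> using sy_pos by (simp add: a_def)
  define Q where "Q t = (F t)\<^sup>2 / ?sy" for t
  have 1: "AE t in time T. ?sy * (b t)\<^sup>2 = Q t"
    using F(1)
  proof eventually_elim
    case (elim t)
    then show ?case using sy_pos by (simp add: Q_def a_def power2_eq_square flip: elim)
  qed
  have 2: "integrable (lebesgue_on {s..t}) (\<lambda>\<tau>. b \<tau> * ?g \<tau>) \<and> Q t - Q s = 2 * (LINT \<tau>|lebesgue_on {s..t}. b \<tau> * ?g \<tau>)"
    if st: "0 < s" "s \<le> t" "t < T" for s t
  proof
    show "integrable (lebesgue_on {s..t}) (\<lambda>\<tau>. b \<tau> * ?g \<tau>)"
      unfolding ab by (rule integrable_mult_right[OF F(3)[OF st]])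
    have "Q t - Q s = (1 / ?sy) * ((F t)\<^sup>2 - (F s)\<^sup>2)" by (simp add: Q_def diff_divide_distrib)
    also have "\<dots> = 2 * (LINT \<tau>|lebesgue_on {s..t}. b \<tau> * ?g \<tau>)"
      unfolding F(2)[OF st] ab integral_mult_right_zero by simp
    finally show "Q t - Q s = 2 * (LINT \<tau>|lebesgue_on {s..t}. b \<tau> * ?g \<tau>)" .
  qed
  show ?thesis using 1 2 unfolding b_def by blast
qed

lemma besov_norm_nonneg: "f \<in> besov_space \<theta> s 3 \<Longrightarrow> 0 \<le> besov_norm \<theta> s 3 f"
proof -
  assume "f \<in> besov_space \<theta> s 3"
  then have "bdd_above (range (\<lambda>j. 2 powr (s * real j) * Lp_norm 3 (lp_block \<theta> j f)))" by (simp add: besov_space_def)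
  then have "2 powr (s * real 0) * Lp_norm 3 (lp_block \<theta> 0 f) \<le> besov_norm \<theta> s 3 f"
    unfolding besov_norm_def by (intro cSUP_upper) auto
  moreover have "0 \<le> Lp_norm 3 (lp_block \<theta> 0 f)" by (simp add: Lp_norm_def)
  ultimately show ?thesis by simp
qed

text \<open>The \<open>H\<^sup>1\<close> pairing of \<open>f\<close> with its Littlewood-Paley sum, as in \<open>H1_pairing_lp_sum\<close>.\<close>

definition energy :: "real \<Rightarrow> (real^3 \<Rightarrow> real) \<Rightarrow> nat \<Rightarrow> (real^3 \<Rightarrow> real^3) \<Rightarrow> real" where
  "energy \<alpha> \<theta> J f = (\<Sum>l\<in>UNIV. \<Sum>k\<in>low_freq J. \<Sum>c\<in>{0, pi/2}. \<theta> (k /\<^sub>R 2 ^ J) * (symbol \<alpha> k * (trig_coeff (\<lambda>x. f x $ l) k c)\<^sup>2))"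

definition energy_flux :: "real \<Rightarrow> (real^3 \<Rightarrow> real) \<Rightarrow> nat \<Rightarrow> (real \<Rightarrow> real^3 \<Rightarrow> real^3) \<Rightarrow> (real \<Rightarrow> real^3 \<Rightarrow> real) \<Rightarrow> real \<Rightarrow> real" where
  "energy_flux \<alpha> \<theta> J u p t = (\<Sum>l\<in>UNIV. \<Sum>k\<in>low_freq J. \<Sum>c\<in>{0, pi/2}. \<theta> (k /\<^sub>R 2 ^ J) * (trig_coeff (\<lambda>x. u t x $ l) k c * force \<alpha> u p k c l t))"

text \<open>The balance holds at times where every coefficient agrees with its continuous version. As there are countably many coefficients, the
set \<open>G\<close> of these times has full measure and does not depend on \<open>J\<close>.\<close>

lemma energy_increment:
  assumes \<alpha>: "\<alpha> > 0" and T: "T > 0" and \<theta>: "lp_cutoff \<theta>" and ws: "weak_solution \<alpha> T u p"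
  obtains G where "AE t in time T. t \<in> G"
    "\<And>s t J. s \<in> G \<Longrightarrow> t \<in> G \<Longrightarrow> 0 < s \<Longrightarrow> s \<le> t \<Longrightarrow> t < T \<Longrightarrow>
       energy \<alpha> \<theta> J (u t) - energy \<alpha> \<theta> J (u s) = 2 * (LINT \<tau>|lebesgue_on {s..t}. energy_flux \<alpha> \<theta> J u p \<tau>)"
    "\<And>s t J. 0 < s \<Longrightarrow> s \<le> t \<Longrightarrow> t < T \<Longrightarrow> integrable (lebesgue_on {s..t}) (energy_flux \<alpha> \<theta> J u p)"
proof -
  let ?b = "\<lambda>k c l t. trig_coeff (\<lambda>x. u t x $ l) k c"
  have "\<forall>k\<in>frequencies. \<forall>c l. \<exists>Q. (AE t in time T. symbol \<alpha> k * (?b k c l t)\<^sup>2 = Q t) \<and>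
    (\<forall>s t. 0 < s \<longrightarrow> s \<le> t \<longrightarrow> t < T \<longrightarrow>
       integrable (lebesgue_on {s..t}) (\<lambda>\<tau>. ?b k c l \<tau> * force \<alpha> u p k c l \<tau>) \<and>
       Q t - Q s = 2 * (LINT \<tau>|lebesgue_on {s..t}. ?b k c l \<tau> * force \<alpha> u p k c l \<tau>))"
    by (intro ballI allI coefficient_energy[OF \<alpha> T \<theta> ws])
  then have "\<exists>Q. \<forall>k\<in>frequencies. \<forall>c l. (AE t in time T. symbol \<alpha> k * (?b k c l t)\<^sup>2 = Q k c l t) \<and>
    (\<forall>s t. 0 < s \<longrightarrow> s \<le> t \<longrightarrow> t < T \<longrightarrow>
       integrable (lebesgue_on {s..t}) (\<lambda>\<tau>. ?b k c l \<tau> * force \<alpha> u p k c l \<tau>) \<and>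
       Q k c l t - Q k c l s = 2 * (LINT \<tau>|lebesgue_on {s..t}. ?b k c l \<tau> * force \<alpha> u p k c l \<tau>))"
    unfolding choice_iff bchoice_iff .
  then obtain Q where Q1: "\<And>k c l. k \<in> frequencies \<Longrightarrow> AE t in time T. symbol \<alpha> k * (?b k c l t)\<^sup>2 = Q k c l t"
    and Q2: "\<And>k c l s t. k \<in> frequencies \<Longrightarrow> 0 < s \<Longrightarrow> s \<le> t \<Longrightarrow> t < T \<Longrightarrow> integrable (lebesgue_on {s..t}) (\<lambda>\<tau>. ?b k c l \<tau> * force \<alpha> u p k c l \<tau>)"
    and Q3: "\<And>k c l s t. k \<in> frequencies \<Longrightarrow> 0 < s \<Longrightarrow> s \<le> t \<Longrightarrow> t < T \<Longrightarrow> Q k c l t - Q k c l s = 2 * (LINT \<tau>|lebesgue_on {s..t}. ?b k c l \<tau> * force \<alpha> u p k c l \<tau>)"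
    by blast
  define G where "G = {t. \<forall>k\<in>frequencies. \<forall>c\<in>{0, pi/2}. \<forall>l. symbol \<alpha> k * (?b k c l t)\<^sup>2 = Q k c l t}"
  have G: "AE t in time T. t \<in> G"
  proof -
    have cc: "countable {0, pi/2}" by simp
    show ?thesis
      unfolding G_def mem_Collect_eq AE_ball_countable[OF countable_frequencies] AE_ball_countable[OF cc] AE_all_countable
      by (intro ballI allI Q1)
  qed
  have int: "integrable (lebesgue_on {s..t}) (\<lambda>\<tau>. \<theta> (k /\<^sub>R 2 ^ J) * (?b k c l \<tau> * force \<alpha> u p k c l \<tau>))"
    if "k \<in> low_freq J" "0 < s" "s \<le> t" "t < T" for k c l s t J
    by (rule integrable_mult_right[OF Q2]) (use that low_freq_frequencies in auto)
  have inc: "energy \<alpha> \<theta> J (u t) - energy \<alpha> \<theta> J (u s) = 2 * (LINT \<tau>|lebesgue_on {s..t}. energy_flux \<alpha> \<theta> J u p \<tau>)"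
    if sG: "s \<in> G" and tG: "t \<in> G" and st: "0 < s" "s \<le> t" "t < T" for s t J
  proof -
    have E: "energy \<alpha> \<theta> J (u r) = (\<Sum>l\<in>UNIV. \<Sum>k\<in>low_freq J. \<Sum>c\<in>{0, pi/2}. \<theta> (k /\<^sub>R 2 ^ J) * Q k c l r)" if r: "r \<in> G" for r
      unfolding energy_def
    proof (intro sum.cong refl)
      fix l k c assume "k \<in> low_freq J" "c \<in> {0, pi/2}"
      then have "symbol \<alpha> k * (?b k c l r)\<^sup>2 = Q k c l r"
        using r low_freq_frequencies unfolding G_def by blast
      then show "\<theta> (k /\<^sub>R 2 ^ J) * (symbol \<alpha> k * (?b k c l r)\<^sup>2) = \<theta> (k /\<^sub>R 2 ^ J) * Q k c l r" by (simp only:)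
    qed
    have "energy \<alpha> \<theta> J (u t) - energy \<alpha> \<theta> J (u s)
      = (\<Sum>l\<in>UNIV. \<Sum>k\<in>low_freq J. \<Sum>c\<in>{0, pi/2}. \<theta> (k /\<^sub>R 2 ^ J) * (Q k c l t - Q k c l s))"
      unfolding E[OF sG] E[OF tG] right_diff_distrib sum_subtractf ..
    also have "\<dots> = (\<Sum>l\<in>UNIV. \<Sum>k\<in>low_freq J. \<Sum>c\<in>{0, pi/2}. 2 * (LINT \<tau>|lebesgue_on {s..t}. \<theta> (k /\<^sub>R 2 ^ J) * (?b k c l \<tau> * force \<alpha> u p k c l \<tau>)))"
    proof (intro sum.cong refl)
      fix l k c assume k: "k \<in> low_freq J"
      show "\<theta> (k /\<^sub>R 2 ^ J) * (Q k c l t - Q k c l s) = 2 * (LINT \<tau>|lebesgue_on {s..t}. \<theta> (k /\<^sub>R 2 ^ J) * (?b k c l \<tau> * force \<alpha> u p k c l \<tau>))"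
        unfolding Q3[OF low_freq_frequencies[OF k] st] integral_mult_right_zero by simp
    qed
    also have "\<dots> = 2 * (\<Sum>l\<in>UNIV. \<Sum>k\<in>low_freq J. \<Sum>c\<in>{0, pi/2}. LINT \<tau>|lebesgue_on {s..t}. \<theta> (k /\<^sub>R 2 ^ J) * (?b k c l \<tau> * force \<alpha> u p k c l \<tau>))"
      by (simp only: sum_distrib_left)
    also have "(\<Sum>l\<in>UNIV. \<Sum>k\<in>low_freq J. \<Sum>c\<in>{0, pi/2}. LINT \<tau>|lebesgue_on {s..t}. \<theta> (k /\<^sub>R 2 ^ J) * (?b k c l \<tau> * force \<alpha> u p k c l \<tau>))
      = (\<Sum>l\<in>UNIV. \<Sum>k\<in>low_freq J. LINT \<tau>|lebesgue_on {s..t}. (\<Sum>c\<in>{0, pi/2}. \<theta> (k /\<^sub>R 2 ^ J) * (?b k c l \<tau> * force \<alpha> u p k c l \<tau>)))"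
      by (intro sum.cong refl Bochner_Integration.integral_sum[symmetric] int st)
    also have "\<dots> = (\<Sum>l\<in>UNIV. LINT \<tau>|lebesgue_on {s..t}. (\<Sum>k\<in>low_freq J. \<Sum>c\<in>{0, pi/2}. \<theta> (k /\<^sub>R 2 ^ J) * (?b k c l \<tau> * force \<alpha> u p k c l \<tau>)))"
      by (intro sum.cong refl Bochner_Integration.integral_sum[symmetric] Bochner_Integration.integrable_sum int st)
    also have "\<dots> = (LINT \<tau>|lebesgue_on {s..t}. energy_flux \<alpha> \<theta> J u p \<tau>)"
      unfolding energy_flux_def
      by (intro Bochner_Integration.integral_sum[symmetric] Bochner_Integration.integrable_sum int st)
    finally show ?thesis .
  qed
  have fint: "integrable (lebesgue_on {s..t}) (energy_flux \<alpha> \<theta> J u p)" if st: "0 < s" "s \<le> t" "t < T" for s t J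
    unfolding energy_flux_def[abs_def] by (intro Bochner_Integration.integrable_sum int st)
  show ?thesis by (rule that[OF G inc fint])
qed

text \<open>By linearity the fluxes through the waves add up to the flux through the Littlewood-Paley sum, and the pressure terms add up to an integral
of \<open>p\<close> against its divergence, which is zero.\<close>

lemma energy_flux_eq:
  assumes f: "u t \<in> H1_space" and q: "p t \<in> Lp_space 1" and div: "divergence_free (u t)"
  shows "energy_flux \<alpha> \<theta> J u p t = (\<Sum>l\<in>UNIV. flux \<alpha> (u t) (\<lambda>j. weak_deriv j (u t)) l (lp_sum \<theta> J (\<lambda>x. u t x $ l)))"
proof -
  let ?D = "\<lambda>j. weak_deriv j (u t)"
  have sq: "square_integrable (\<lambda>x. u t x $ i)" "square_integrable (\<lambda>x. ?D j x $ i)" for i j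
    by (rule Lp_space_2_square_integrable(1)[OF H1_weak_deriv(3)[OF f]], rule Lp_space_2_square_integrable(1)[OF H1_weak_deriv(2)[OF f]])
  have qi: "integrable torus (p t)" by (rule Lp_space_1_integrable[OF q])
  have "energy_flux \<alpha> \<theta> J u p t = (\<Sum>l\<in>UNIV. flux \<alpha> (u t) ?D l (lp_sum \<theta> J (\<lambda>x. u t x $ l)) + (LINT x|torus. p t x * pd l (lp_sum \<theta> J (\<lambda>x. u t x $ l)) x))"
    unfolding energy_flux_def flux_lp_sum[OF sq] integral_lp_sum(2)[OF qi] sum.distrib[symmetric]
    by (intro sum.cong refl) (simp only: force_def distrib_left mult.assoc)
  also have "\<dots> = (\<Sum>l\<in>UNIV. flux \<alpha> (u t) ?D l (lp_sum \<theta> J (\<lambda>x. u t x $ l))) + (\<Sum>l\<in>UNIV. LINT x|torus. p t x * pd l (lp_sum \<theta> J (\<lambda>x. u t x $ l)) x)"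
    by (rule sum.distrib)
  also have "(\<Sum>l\<in>UNIV. LINT x|torus. p t x * pd l (lp_sum \<theta> J (\<lambda>x. u t x $ l)) x) = 0"
  proof -
    have "(\<Sum>l\<in>UNIV. LINT x|torus. p t x * pd l (lp_sum \<theta> J (\<lambda>x. u t x $ l)) x) = (LINT x|torus. (\<Sum>l\<in>UNIV. p t x * pd l (lp_sum \<theta> J (\<lambda>x. u t x $ l)) x))"
      by (rule Bochner_Integration.integral_sum[symmetric]) (intro integrable_mult_smooth qi smooth_pd smooth_lp_sum)
    also have "\<dots> = 0" unfolding sum_distrib_left[symmetric] div_lp_sum[OF div] by simp
    finally show ?thesis .
  qed
  finally show ?thesis by simp
qed

theorem theoremA6:
  fixes \<alpha> T s :: real and \<theta> :: "real^3 \<Rightarrow> real"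
    and u :: "real \<Rightarrow> real^3 \<Rightarrow> real^3" and p :: "real \<Rightarrow> real^3 \<Rightarrow> real"
  assumes "\<alpha> > 0" and "T > 0" and "s > 1"
    and "lp_cutoff \<theta>"
    and "weak_solution \<alpha> T u p"
    and "u \<in> bochner_Lq 3 T (besov_space \<theta> s 3) (besov_norm \<theta> s 3)"
  shows "AE t1 in time T. AE t2 in time T. H1_norm \<alpha> (u t1) = H1_norm \<alpha> (u t2)"
proof -
  note \<alpha> = assms(1) and T = assms(2) and s = assms(3) and \<theta> = assms(4) and ws = assms(5)
  have uL: "u \<in> bochner_Linf T H1_space (H1_norm \<alpha>)" and pL: "p \<in> bochner_Linf T (Lp_space 1) (Lp_norm 1)"
    using ws unfolding weak_solution_def by blast+
  let ?W = "\<lambda>t J l. lp_sum \<theta> J (\<lambda>x. u t x $ l)"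
  define good where "good t \<longleftrightarrow> u t \<in> H1_space \<and> p t \<in> Lp_space 1 \<and> u t \<in> besov_space \<theta> s 3 \<and> divergence_free (u t)" for t
  have good: "AE t in time T. good t"
  proof -
    have "AE t in time T. u t \<in> H1_space" "AE t in time T. p t \<in> Lp_space 1" "AE t in time T. u t \<in> besov_space \<theta> s 3"
      using uL pL assms(6) by (auto simp: bochner_Linf_def bochner_Lq_def strongly_measurable_def)
    then show ?thesis using weak_solution_divergence_free[OF \<theta> ws] unfolding good_def by eventually_elim blast
  qed
  \<comment> \<open>The constants of \<open>flux_bound\<close> and of the majorant, for three components.\<close>
  define K where "K = 3 * ((3 + 18 * \<alpha>\<^sup>2) * W13_const s)"
  have at_good: "(\<forall>J. \<bar>energy_flux \<alpha> \<theta> J u p t\<bar> \<le> K * besov_norm \<theta> s 3 (u t) powr 3) \<and>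
      (\<lambda>J. energy_flux \<alpha> \<theta> J u p t) \<longlonglongrightarrow> 0 \<and> (\<lambda>J. energy \<alpha> \<theta> J (u t)) \<longlonglongrightarrow> (H1_norm \<alpha> (u t))\<^sup>2"
    if g: "good t" for t
  proof -
    have H: "u t \<in> H1_space" and q: "p t \<in> Lp_space 1" and b: "u t \<in> besov_space \<theta> s 3" and div: "divergence_free (u t)"
      using g by (auto simp: good_def)
    let ?D = "\<lambda>j. weak_deriv j (u t)"
    have wd: "has_weak_deriv j (u t) (?D j)" for j by (rule H1_weak_deriv(1)[OF H])
    obtain M where M: "divergence_free_approximation (u t) ?D (?W t) M"
      and Mb: "(LINT x|torus. M x ^ 3) \<le> W13_const s * besov_norm \<theta> s 3 (u t) ^ 3"
      by (rule besov_divergence_free_approximation[OF \<theta> s b wd div])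
    interpret divergence_free_approximation "u t" ?D "?W t" M by (rule M)
    have ef: "energy_flux \<alpha> \<theta> J u p t = (\<Sum>l\<in>UNIV. flux \<alpha> (u t) ?D l (?W t J l))" for J
      by (rule energy_flux_eq[where u=u and p=p and t=t, OF H q div])
    have n3: "besov_norm \<theta> s 3 (u t) powr 3 = besov_norm \<theta> s 3 (u t) ^ 3"
      using powr_realpow'[OF besov_norm_nonneg[OF b], of 3] by simp
    have "\<bar>energy_flux \<alpha> \<theta> J u p t\<bar> \<le> K * besov_norm \<theta> s 3 (u t) powr 3" for J
    proof -
      have "\<bar>energy_flux \<alpha> \<theta> J u p t\<bar> \<le> (\<Sum>l\<in>(UNIV :: 3 set). (3 + 18 * \<alpha>\<^sup>2) * (LINT x|torus. M x ^ 3))"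
        unfolding ef by (rule order_trans[OF sum_abs sum_mono]) (rule flux_bound)
      also have "\<dots> = 3 * ((3 + 18 * \<alpha>\<^sup>2) * (LINT x|torus. M x ^ 3))" by simp
      also have "\<dots> \<le> 3 * ((3 + 18 * \<alpha>\<^sup>2) * (W13_const s * besov_norm \<theta> s 3 (u t) ^ 3))"
        by (intro mult_left_mono Mb) auto
      finally show ?thesis unfolding n3 K_def by (simp only: mult.assoc)
    qed
    moreover have "(\<lambda>J. energy_flux \<alpha> \<theta> J u p t) \<longlonglongrightarrow> 0" unfolding ef by (rule flux_tendsto_zero)
    moreover have "(\<lambda>J. energy \<alpha> \<theta> J (u t)) \<longlonglongrightarrow> (H1_norm \<alpha> (u t))\<^sup>2"
    proof -
      have E: "energy \<alpha> \<theta> J (u t) = (\<Sum>l\<in>UNIV. (LINT x|torus. u t x $ l * ?W t J l x) + \<alpha>\<^sup>2 * (\<Sum>k\<in>UNIV. LINT x|torus. ?D k x $ l * pd k (?W t J l) x))" for J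
        unfolding energy_def mult.assoc[symmetric]
        by (rule sum.cong[OF refl H1_pairing_lp_sum[OF wd, symmetric]])
      show ?thesis
        unfolding H1_norm_square_eq[OF H] E by (rule energy_tendsto)
    qed
    ultimately show ?thesis by blast
  qed
  obtain G where G: "AE t in time T. t \<in> G"
    and inc: "\<And>r t J. r \<in> G \<Longrightarrow> t \<in> G \<Longrightarrow> 0 < r \<Longrightarrow> r \<le> t \<Longrightarrow> t < T \<Longrightarrow>
       energy \<alpha> \<theta> J (u t) - energy \<alpha> \<theta> J (u r) = 2 * (LINT \<tau>|lebesgue_on {r..t}. energy_flux \<alpha> \<theta> J u p \<tau>)"
    and fint: "\<And>r t J. 0 < r \<Longrightarrow> r \<le> t \<Longrightarrow> t < T \<Longrightarrow> integrable (lebesgue_on {r..t}) (energy_flux \<alpha> \<theta> J u p)"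
    by (rule energy_increment[OF \<alpha> T \<theta> ws], rule that)
  have conserved: "H1_norm \<alpha> (u r) = H1_norm \<alpha> (u t)"
    if rt: "r \<in> G" "t \<in> G" "good r" "good t" "0 < r" "r \<le> t" "t < T" for r t
  proof -
    have sub: "{r..t} \<subseteq> {0<..<T}" using rt by auto
    note good' = AE_time_subinterval[OF good rt(5,7)]
    have "integrable (time T) (\<lambda>\<tau>. besov_norm \<theta> s 3 (u \<tau>) powr 3)" using assms(6) by (simp add: bochner_Lq_def)
    then have "set_integrable lebesgue {0<..<T} (\<lambda>\<tau>. besov_norm \<theta> s 3 (u \<tau>) powr 3)"
      by (simp add: integrable_restrict_space set_integrable_def)
    then have "set_integrable lebesgue {r..t} (\<lambda>\<tau>. besov_norm \<theta> s 3 (u \<tau>) powr 3)"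
      by (rule set_integrable_subset) (use sub in auto)
    then have bi: "integrable (lebesgue_on {r..t}) (\<lambda>\<tau>. K * besov_norm \<theta> s 3 (u \<tau>) powr 3)"
      by (intro integrable_mult_right) (simp add: integrable_restrict_space set_integrable_def)
    have "(\<lambda>J. LINT \<tau>|lebesgue_on {r..t}. energy_flux \<alpha> \<theta> J u p \<tau>) \<longlonglongrightarrow> (LINT \<tau>|lebesgue_on {r..t}. 0)"
    proof (rule integral_dominated_convergence[OF _ _ bi])
      show "energy_flux \<alpha> \<theta> J u p \<in> borel_measurable (lebesgue_on {r..t})" for J
        by (rule borel_measurable_integrable[OF fint[OF rt(5-7)]])
      show "AE \<tau> in lebesgue_on {r..t}. (\<lambda>J. energy_flux \<alpha> \<theta> J u p \<tau>) \<longlonglongrightarrow> 0"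
        using good' by eventually_elim (use at_good in blast)
      show "AE \<tau> in lebesgue_on {r..t}. norm (energy_flux \<alpha> \<theta> J u p \<tau>) \<le> K * besov_norm \<theta> s 3 (u \<tau>) powr 3" for J
        unfolding real_norm_def using good' by eventually_elim (use at_good in blast)
    qed simp
    then have "(\<lambda>J. 2 * (LINT \<tau>|lebesgue_on {r..t}. energy_flux \<alpha> \<theta> J u p \<tau>)) \<longlonglongrightarrow> 2 * 0"
      by (intro tendsto_mult tendsto_const) simp
    moreover have "(\<lambda>J. energy \<alpha> \<theta> J (u t) - energy \<alpha> \<theta> J (u r)) \<longlonglongrightarrow> (H1_norm \<alpha> (u t))\<^sup>2 - (H1_norm \<alpha> (u r))\<^sup>2"
      using at_good[OF rt(3)] at_good[OF rt(4)] by (intro tendsto_diff) blast+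
    ultimately have "(H1_norm \<alpha> (u t))\<^sup>2 - (H1_norm \<alpha> (u r))\<^sup>2 = 2 * 0"
      unfolding inc[OF rt(1,2,5-7)] by (rule LIMSEQ_unique[rotated])
    then show ?thesis using H1_norm_nonneg[of \<alpha> "u t"] H1_norm_nonneg[of \<alpha> "u r"] by simp
  qed
  have all: "AE t in time T. t \<in> G \<and> good t \<and> t \<in> {0<..<T}"
    using G good AE_space[of "time T"] by eventually_elim simp
  show ?thesis
    using all
  proof eventually_elim
    case (elim t1)
    note t1 = this
    show ?case using all
    proof eventually_elim
      case (elim t2)
      show ?case
      proof (cases "t1 \<le> t2")
        case True
        show ?thesis by (rule conserved) (use t1 elim True in simp_all)
      next
        case False
        show ?thesis by (rule conserved[symmetric]) (use t1 elim False in simp_all)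
      qed
    qed
  qed
qed

end
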